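(* Assume that $a\in H^1(0,1)$ and that there is a constant $a_0>0$ with $a(x)\ge a_0$ for all $x\in[0,1]$; assume also that $|\alpha|<\beta$ and $|\alpha|\le K\le 2\beta-|\alpha|$. Then: (i) The operator $\mathcal{A}$ is densely defined in $\mathcal{X}$ and generates on $\mathcal{X}$ a $C_0$-semigroup of contractions $e^{t\mathcal{A}}$. Moreover, the spectrum $\sigma(\mathcal{A})$ of $\mathcal{A}$ consists of isolated eigenvalues of finite algebraic multiplicity only. (ii) For any initial condition $\Phi_0\in\mathcal{X}$, the Cauchy problem $\dot\Phi(t)=\mathcal{A}\Phi(t)$, $\Phi(0)=\Phi_0$, has a unique mild solution $\Phi\in C([0,\infty);\mathcal{X})$. If moreover $\Phi_0\in\mathcal{D}(\mathcal{A})$, then the solution $\Phi$ is strong and belongs to $C([0,\infty);\mathcal{D}(\mathcal{A}))\cap C^1([0,\infty);\mathcal{X})$.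
   Context: Constants: $m,M,\tau,\beta,K>0$ and $\alpha\in\mathbb{R}$; put $\mu=\beta-\alpha$. The state space is $\mathcal{X}=H^1(0,1)\times L^2(0,1)\times L^2(0,1)\times\mathbb{R}^2$, equipped with the inner product $$\langle(y,z,u,\xi,\eta),(\tilde y,\tilde z,\tilde u,\tilde\xi,\tilde\eta)\rangle_{\mathcal{X}}=\int_0^1(a y_x\tilde y_x+z\tilde z)\,dx+K\tau\int_0^1u\tilde u\,dx+m\xi\tilde\xi+M\eta\tilde\eta+\varpi\,\ell(y,z,u,\xi,\eta)\,\ell(\tilde y,\tilde z,\tilde u,\tilde\xi,\tilde\eta),$$ where $\ell(y,z,u,\xi,\eta)=\int_0^1z\,dx+m\xi+M\eta+\mu y(0)+\tau\alpha\int_0^1u\,dx$ and $\varpi>0$ is a constant fixed small enough that $\mathcal{X}$ with this inner product is a Hilbert space whose norm is equivalent to the usual product norm. (The complex case is analogous, with complex conjugates in the second argument; spectral notions are understood for the complexification.) The linear operator $\mathcal{A}$ is defined by $$\mathcal{D}(\mathcal{A})=\{(y,z,u,\xi,\eta)\in\mathcal{X}:\ y\in H^2(0,1),\ z,u\in H^1(0,1),\ \xi=u(0)=z(0),\ \eta=z(1)\},$$ $$\mathcal{A}(y,z,u,\xi,\eta)=\Big(z,\ (ay_x)_x,\ -\tfrac{u_x}{\tau},\ \tfrac1m\big[(ay_x)(0)-\beta\xi+\alpha u(1)\big],\ -\tfrac{(ay_x)(1)}{M}\Big).$$ $\mathcal{D}(\mathcal{A})$ carries the graph norm. *)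

theory Defs
  imports "HOL-Analysis.Analysis"
begin

section \<open>The spaces $L^2(0,1)$ and $H^1(0,1)$\<close>

abbreviation I01 :: "real measure" where
  "I01 \<equiv> lebesgue_on {0<..<1}"

definition square_integrable :: "(real \<Rightarrow> real) \<Rightarrow> bool" where
  "square_integrable f \<longleftrightarrow> f \<in> borel_measurable I01 \<and> integrable I01 (\<lambda>x. (f x)\<^sup>2)"

lemma square_integrable_mult:
  assumes "square_integrable f" "square_integrable g"
  shows "integrable I01 (\<lambda>x. f x * g x)"
proof (rule Bochner_Integration.integrable_bound)
  show "integrable I01 (\<lambda>x. (f x)\<^sup>2 + (g x)\<^sup>2)"
    using assms by (auto simp: square_integrable_def)
  show "(\<lambda>x. f x * g x) \<in> borel_measurable I01"
    using assms by (auto simp: square_integrable_def)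
  have "\<bar>a * b\<bar> \<le> a\<^sup>2 + b\<^sup>2" for a b :: real
  proof -
    have "0 \<le> (\<bar>a\<bar> - \<bar>b\<bar>)\<^sup>2" by simp
    then have "2 * (\<bar>a\<bar> * \<bar>b\<bar>) \<le> a\<^sup>2 + b\<^sup>2"
      by (simp add: power2_diff)
    moreover have "0 \<le> \<bar>a\<bar> * \<bar>b\<bar>" by simp
    ultimately show ?thesis unfolding abs_mult by linarith
  qed
  then show "AE x in I01. norm (f x * g x) \<le> norm ((f x)\<^sup>2 + (g x)\<^sup>2)"
    by simp
qed

lemma square_integrable_zero: "square_integrable (\<lambda>x. 0)"
  by (simp add: square_integrable_def)

lemma square_integrable_scale: "square_integrable f \<Longrightarrow> square_integrable (\<lambda>x. c * f x)"
  by (auto simp: square_integrable_def power_mult_distrib)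

lemma square_integrable_add:
  assumes "square_integrable f" "square_integrable g"
  shows "square_integrable (\<lambda>x. f x + g x)"
proof -
  have "integrable I01 (\<lambda>x. (f x)\<^sup>2 + (g x)\<^sup>2 + 2 * (f x * g x))"
    using square_integrable_mult[OF assms] assms by (auto simp: square_integrable_def)
  then show ?thesis
    using assms by (auto simp: square_integrable_def power2_sum mult.assoc)
qed

lemma square_integrable_uminus: "square_integrable f \<Longrightarrow> square_integrable (\<lambda>x. - f x)"
  using square_integrable_scale[of f "-1"] by simp

lemma square_integrable_diff:
  "square_integrable f \<Longrightarrow> square_integrable g \<Longrightarrow> square_integrable (\<lambda>x. f x - g x)"
  using square_integrable_add[of f "\<lambda>x. - g x"] square_integrable_uminus[of g] by simp

definition l2_rel :: "(real \<Rightarrow> real) \<Rightarrow> (real \<Rightarrow> real) \<Rightarrow> bool" where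
  "l2_rel f g \<longleftrightarrow> square_integrable f \<and> square_integrable g \<and> (AE x in I01. f x = g x)"

quotient_type l2 = "real \<Rightarrow> real" / partial: l2_rel
proof (rule part_equivpI)
  show "\<exists>f. l2_rel f f"
    using square_integrable_zero by (auto simp: l2_rel_def)
  show "symp l2_rel"
    by (auto simp: symp_def l2_rel_def)
  show "transp l2_rel"
    by (auto simp: transp_def l2_rel_def)
qed

instantiation l2 :: real_inner
begin

lift_definition zero_l2 :: l2 is "\<lambda>x. 0"
  by (simp add: l2_rel_def square_integrable_zero)

lift_definition plus_l2 :: "l2 \<Rightarrow> l2 \<Rightarrow> l2" is "\<lambda>f g x. f x + g x"
  by (auto simp: l2_rel_def square_integrable_add)

lift_definition minus_l2 :: "l2 \<Rightarrow> l2 \<Rightarrow> l2" is "\<lambda>f g x. f x - g x"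
  by (auto simp: l2_rel_def square_integrable_diff)

lift_definition uminus_l2 :: "l2 \<Rightarrow> l2" is "\<lambda>f x. - f x"
  by (auto simp: l2_rel_def square_integrable_uminus)

lift_definition scaleR_l2 :: "real \<Rightarrow> l2 \<Rightarrow> l2" is "\<lambda>c f x. c * f x"
  by (auto simp: l2_rel_def square_integrable_scale)

lift_definition inner_l2 :: "l2 \<Rightarrow> l2 \<Rightarrow> real" is "\<lambda>f g. LINT x|I01. f x * g x"
proof -
  fix f f' g g' assume "l2_rel f f'" "l2_rel g g'"
  then show "(LINT x|I01. f x * g x) = (LINT x|I01. f' x * g' x)"
    unfolding l2_rel_def square_integrable_def
    by (intro integral_cong_AE) auto
qed

definition norm_l2 :: "l2 \<Rightarrow> real" where "norm_l2 f = sqrt (inner f f)"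
definition sgn_l2 :: "l2 \<Rightarrow> l2" where "sgn_l2 f = scaleR (inverse (norm f)) f"
definition dist_l2 :: "l2 \<Rightarrow> l2 \<Rightarrow> real" where "dist_l2 f g = norm (f - g)"
definition uniformity_l2 :: "(l2 \<times> l2) filter" where
  "uniformity_l2 = (INF e\<in>{0<..}. principal {(f, g). dist f g < e})"
definition open_l2 :: "l2 set \<Rightarrow> bool" where
  "open_l2 U \<longleftrightarrow> (\<forall>f\<in>U. \<forall>\<^sub>F (f', g) in uniformity. f' = f \<longrightarrow> g \<in> U)"

instance
proof
  fix f g h :: l2 and r s :: real and U :: "l2 set"
  show "f + g + h = f + (g + h)"
    by transfer (auto simp: l2_rel_def add.assoc square_integrable_add)
  show "f + g = g + f"
    by transfer (auto simp: l2_rel_def add.commute square_integrable_add)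
  show "0 + f = f"
    by transfer (auto simp: l2_rel_def)
  show "- f + f = 0"
    by transfer (auto simp: l2_rel_def square_integrable_zero)
  show "f - g = f + - g"
    by transfer (auto simp: l2_rel_def square_integrable_diff)
  show "r *\<^sub>R (f + g) = r *\<^sub>R f + r *\<^sub>R g"
    by transfer (auto simp: l2_rel_def distrib_left square_integrable_add square_integrable_scale)
  show "(r + s) *\<^sub>R f = r *\<^sub>R f + s *\<^sub>R f"
    by transfer (auto simp: l2_rel_def distrib_right square_integrable_add square_integrable_scale)
  show "r *\<^sub>R s *\<^sub>R f = (r * s) *\<^sub>R f"
    by transfer (auto simp: l2_rel_def mult.assoc square_integrable_scale
        dest: square_integrable_scale[where c = "r * s"])
  show "1 *\<^sub>R f = f"
    by transfer (auto simp: l2_rel_def)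
  show "dist f g = norm (f - g)" by (simp add: dist_l2_def)
  show "sgn f = scaleR (inverse (norm f)) f" by (simp add: sgn_l2_def)
  show "(uniformity :: (l2 \<times> l2) filter) = (INF e\<in>{0<..}. principal {(f, g). dist f g < e})"
    by (simp add: uniformity_l2_def)
  show "open U \<longleftrightarrow> (\<forall>f\<in>U. \<forall>\<^sub>F (f', g) in uniformity. f' = f \<longrightarrow> g \<in> U)"
    by (simp add: open_l2_def)
  show "inner f g = inner g f"
    by transfer (simp add: mult.commute)
  show "inner (f + g) h = inner f h + inner g h"
    by transfer (auto simp: l2_rel_def distrib_right square_integrable_mult)
  show "inner (r *\<^sub>R f) g = r * inner f g"
    by transfer (simp add: mult.assoc)
  show "0 \<le> inner f f"
    by transfer (simp add: integral_nonneg_AE)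
  show "inner f f = 0 \<longleftrightarrow> f = 0"
  proof transfer
    fix f assume f: "l2_rel f f"
    then have "integrable I01 (\<lambda>x. f x * f x)"
      by (auto simp: l2_rel_def square_integrable_mult)
    then have "(LINT x|I01. f x * f x) = 0 \<longleftrightarrow> (AE x in I01. f x * f x = 0)"
      by (intro integral_nonneg_eq_0_iff_AE) auto
    also have "\<dots> \<longleftrightarrow> l2_rel f (\<lambda>x. 0)"
      using f by (simp add: l2_rel_def square_integrable_zero)
    finally show "(LINT x|I01. f x * f x) = 0 \<longleftrightarrow> l2_rel f (\<lambda>x. 0)" .
  qed
  show "norm f = sqrt (inner f f)" by (simp add: norm_l2_def)
qed

end

definition test_function :: "(real \<Rightarrow> real) \<Rightarrow> bool" where
  "test_function \<phi> \<longleftrightarrow>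
     (\<forall>n x. (deriv ^^ n) \<phi> field_differentiable at x) \<and>
     (\<exists>c d. 0 < c \<and> d < 1 \<and> (\<forall>x. x \<notin> {c..d} \<longrightarrow> \<phi> x = 0))"

text \<open>\<open>abs_l2 f\<close> is the class of a square integrable \<open>f\<close>, so the equation below says
  $\int_0^1 f\varphi' = -\int_0^1 g\varphi$.\<close>

definition has_weak_deriv :: "l2 \<Rightarrow> l2 \<Rightarrow> bool" where
  "has_weak_deriv f g \<longleftrightarrow>
     (\<forall>\<phi>. test_function \<phi> \<longrightarrow> inner f (abs_l2 (deriv \<phi>)) = - inner g (abs_l2 \<phi>))"

definition H1 :: "l2 set" where
  "H1 = {f. \<exists>g. has_weak_deriv f g}"

definition weak_deriv :: "l2 \<Rightarrow> l2" where
  "weak_deriv f = (THE g. has_weak_deriv f g)"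

text \<open>Point values of $H^1$ functions are those of the continuous representative on $[0,1]$.\<close>

definition point_value :: "l2 \<Rightarrow> real \<Rightarrow> real" where
  "point_value f x =
     (THE c. \<exists>F. continuous_on {0..1} F \<and> (AE s in I01. F s = rep_l2 f s) \<and> F x = c)"

text \<open>\<open>H1\<close> as a Hilbert space of its own: an element is stored together with its weak derivative
  (which it determines), so that the norm inherited from \<open>l2 \<times> l2\<close> is the usual $H^1$ norm.\<close>

typedef h1 = "{(f, g). has_weak_deriv f g}"
  by (rule exI[of _ "(0, 0)"]) (simp add: has_weak_deriv_def)

lifting_forget l2.lifting
setup_lifting type_definition_h1

lift_definition h1_fun :: "h1 \<Rightarrow> l2" is fst .
lift_definition h1_deriv :: "h1 \<Rightarrow> l2" is snd .

definition to_h1 :: "l2 \<Rightarrow> h1" where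
  "to_h1 f = (THE y. h1_fun y = f)"

instantiation h1 :: real_inner
begin

lift_definition zero_h1 :: h1 is 0
  by (simp add: has_weak_deriv_def zero_prod_def)

lift_definition plus_h1 :: "h1 \<Rightarrow> h1 \<Rightarrow> h1" is "(+)"
  by (auto simp: has_weak_deriv_def inner_add_left)

lift_definition minus_h1 :: "h1 \<Rightarrow> h1 \<Rightarrow> h1" is "(-)"
  by (auto simp: has_weak_deriv_def inner_diff_left)

lift_definition uminus_h1 :: "h1 \<Rightarrow> h1" is uminus
  by (auto simp: has_weak_deriv_def)

lift_definition scaleR_h1 :: "real \<Rightarrow> h1 \<Rightarrow> h1" is scaleR
  by (auto simp: has_weak_deriv_def)

lift_definition inner_h1 :: "h1 \<Rightarrow> h1 \<Rightarrow> real" is inner .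

definition norm_h1 :: "h1 \<Rightarrow> real" where "norm_h1 f = sqrt (inner f f)"
definition sgn_h1 :: "h1 \<Rightarrow> h1" where "sgn_h1 f = scaleR (inverse (norm f)) f"
definition dist_h1 :: "h1 \<Rightarrow> h1 \<Rightarrow> real" where "dist_h1 f g = norm (f - g)"
definition uniformity_h1 :: "(h1 \<times> h1) filter" where
  "uniformity_h1 = (INF e\<in>{0<..}. principal {(f, g). dist f g < e})"
definition open_h1 :: "h1 set \<Rightarrow> bool" where
  "open_h1 U \<longleftrightarrow> (\<forall>f\<in>U. \<forall>\<^sub>F (f', g) in uniformity. f' = f \<longrightarrow> g \<in> U)"

instance
proof
  fix f g h :: h1 and r s :: real and U :: "h1 set"
  show "f + g + h = f + (g + h)" by transfer (simp add: add.assoc)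
  show "f + g = g + f" by transfer (simp add: add.commute)
  show "0 + f = f" by transfer simp
  show "- f + f = 0" by transfer simp
  show "f - g = f + - g" by transfer simp
  show "r *\<^sub>R (f + g) = r *\<^sub>R f + r *\<^sub>R g" by transfer (simp add: scaleR_add_right)
  show "(r + s) *\<^sub>R f = r *\<^sub>R f + s *\<^sub>R f" by transfer (simp add: scaleR_add_left)
  show "r *\<^sub>R s *\<^sub>R f = (r * s) *\<^sub>R f" by transfer simp
  show "1 *\<^sub>R f = f" by transfer simp
  show "dist f g = norm (f - g)" by (simp add: dist_h1_def)
  show "sgn f = scaleR (inverse (norm f)) f" by (simp add: sgn_h1_def)
  show "(uniformity :: (h1 \<times> h1) filter) = (INF e\<in>{0<..}. principal {(f, g). dist f g < e})"
    by (simp add: uniformity_h1_def)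
  show "open U \<longleftrightarrow> (\<forall>f\<in>U. \<forall>\<^sub>F (f', g) in uniformity. f' = f \<longrightarrow> g \<in> U)"
    by (simp add: open_h1_def)
  show "inner f g = inner g f" by transfer (simp add: inner_commute)
  show "inner (f + g) h = inner f h + inner g h" by transfer (simp add: inner_add_left)
  show "inner (r *\<^sub>R f) g = r * inner f g" by transfer simp
  show "0 \<le> inner f f" by transfer simp
  show "inner f f = 0 \<longleftrightarrow> f = 0" by transfer simp
  show "norm f = sqrt (inner f f)" by (simp add: norm_h1_def)
qed

end

abbreviation h1_value :: "h1 \<Rightarrow> real \<Rightarrow> real" where
  "h1_value y x \<equiv> point_value (h1_fun y) x"

section \<open>Semigroups, Cauchy problems and spectrum of unbounded operators\<close>

text \<open>An unbounded operator is given by its domain \<open>D\<close> and a function \<open>A\<close>, whose values outside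
  \<open>D\<close> are irrelevant.\<close>

definition C0_semigroup :: "(real \<Rightarrow> 'a::real_normed_vector \<Rightarrow> 'a) \<Rightarrow> bool" where
  "C0_semigroup T \<longleftrightarrow>
     (\<forall>t\<ge>0. bounded_linear (T t)) \<and>
     (\<forall>x. T 0 x = x) \<and>
     (\<forall>s\<ge>0. \<forall>t\<ge>0. \<forall>x. T (s + t) x = T s (T t x)) \<and>
     (\<forall>x. ((\<lambda>t. T t x) \<longlongrightarrow> x) (at_right 0))"

definition generates ::
  "'a::real_normed_vector set \<Rightarrow> ('a \<Rightarrow> 'a) \<Rightarrow> (real \<Rightarrow> 'a \<Rightarrow> 'a) \<Rightarrow> bool" where
  "generates D A T \<longleftrightarrow>
     D = {x. \<exists>l. ((\<lambda>h. (T h x - x) /\<^sub>R h) \<longlongrightarrow> l) (at_right 0)} \<and>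
     (\<forall>x\<in>D. ((\<lambda>h. (T h x - x) /\<^sub>R h) \<longlongrightarrow> A x) (at_right 0))"

definition mild_solution ::
  "'a::real_normed_vector set \<Rightarrow> ('a \<Rightarrow> 'a) \<Rightarrow> 'a \<Rightarrow> (real \<Rightarrow> 'a) \<Rightarrow> bool" where
  "mild_solution D A x0 u \<longleftrightarrow>
     continuous_on {0..} u \<and>
     (\<forall>t\<ge>0. \<exists>J. (u has_integral J) {0..t} \<and> J \<in> D \<and> u t = x0 + A J)"

definition strong_solution ::
  "'a::real_normed_vector set \<Rightarrow> ('a \<Rightarrow> 'a) \<Rightarrow> 'a \<Rightarrow> (real \<Rightarrow> 'a) \<Rightarrow> bool" where
  "strong_solution D A x0 u \<longleftrightarrow>
     u 0 = x0 \<and>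
     (\<forall>t\<ge>0. u t \<in> D \<and> (u has_vector_derivative A (u t)) (at t within {0..}))"

text \<open>Continuity into the domain with its graph norm: the norm of the pair \<open>(x, A x)\<close> is the graph
  norm of \<open>x\<close>.\<close>

definition continuous_into_domain ::
  "'a::real_normed_vector set \<Rightarrow> ('a \<Rightarrow> 'a) \<Rightarrow> (real \<Rightarrow> 'a) \<Rightarrow> bool" where
  "continuous_into_domain D A u \<longleftrightarrow>
     (\<forall>t\<ge>0. u t \<in> D) \<and> continuous_on {0..} (\<lambda>t. (u t, A (u t)))"

definition continuously_differentiable :: "(real \<Rightarrow> 'a::real_normed_vector) \<Rightarrow> bool" where
  "continuously_differentiable u \<longleftrightarrow>
     (\<exists>u'. (\<forall>t\<ge>0. (u has_vector_derivative u' t) (at t within {0..})) \<and> continuous_on {0..} u')"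

text \<open>The complexification of a real space \<open>'a\<close> is \<open>'a \<times> 'a\<close>, with \<open>(x, y)\<close> standing for
  $x + iy$.\<close>

definition scaleC :: "complex \<Rightarrow> 'a::real_vector \<times> 'a \<Rightarrow> 'a \<times> 'a" where
  "scaleC z v =
     (Re z *\<^sub>R fst v - Im z *\<^sub>R snd v, Re z *\<^sub>R snd v + Im z *\<^sub>R fst v)"

definition complexify :: "('a \<Rightarrow> 'a) \<Rightarrow> 'a \<times> 'a \<Rightarrow> 'a \<times> 'a" where
  "complexify A = map_prod A A"

definition resolvent ::
  "'a::real_normed_vector set \<Rightarrow> ('a \<Rightarrow> 'a) \<Rightarrow> complex \<Rightarrow> 'a \<times> 'a \<Rightarrow> 'a \<times> 'a" where
  "resolvent D A z = inv_into (D \<times> D) (\<lambda>v. scaleC z v - complexify A v)"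

definition resolvent_set :: "'a::real_normed_vector set \<Rightarrow> ('a \<Rightarrow> 'a) \<Rightarrow> complex set" where
  "resolvent_set D A =
     {z. bij_betw (\<lambda>v. scaleC z v - complexify A v) (D \<times> D) UNIV \<and>
         bounded_linear (resolvent D A z)}"

definition spectrum :: "'a::real_normed_vector set \<Rightarrow> ('a \<Rightarrow> 'a) \<Rightarrow> complex set" where
  "spectrum D A = - resolvent_set D A"

definition eigenvalue :: "'a::real_normed_vector set \<Rightarrow> ('a \<Rightarrow> 'a) \<Rightarrow> complex \<Rightarrow> bool" where
  "eigenvalue D A z \<longleftrightarrow> (\<exists>v\<in>D \<times> D. v \<noteq> 0 \<and> complexify A v = scaleC z v)"

text \<open>The Riesz projection $\frac{1}{2\pi i}\oint_{|\zeta-z|=r}(\zeta-A)^{-1}v\,d\zeta$,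
  with $\zeta = z + re^{i\theta}$.\<close>

definition riesz_projection ::
  "'a::real_normed_vector set \<Rightarrow> ('a \<Rightarrow> 'a) \<Rightarrow> complex \<Rightarrow> real \<Rightarrow> 'a \<times> 'a \<Rightarrow> 'a \<times> 'a" where
  "riesz_projection D A z r v =
     (1 / (2 * pi)) *\<^sub>R integral {0..2 * pi}
       (\<lambda>\<theta>. scaleC (of_real r * cis \<theta>) (resolvent D A (z + of_real r * cis \<theta>) v))"

text \<open>The algebraic multiplicity of an isolated point of the spectrum is the dimension of the range
  of its Riesz projection; that dimension is finite over the complex numbers iff it is finite over
  the reals.\<close>

definition finite_algebraic_multiplicity ::
  "'a::real_normed_vector set \<Rightarrow> ('a \<Rightarrow> 'a) \<Rightarrow> complex \<Rightarrow> bool" where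
  "finite_algebraic_multiplicity D A z \<longleftrightarrow>
     (\<exists>r>0. cball z r \<inter> spectrum D A \<subseteq> {z} \<and>
        (\<exists>B. finite B \<and> range (riesz_projection D A z r) \<subseteq> span B))"

section \<open>The state space and the operator\<close>

text \<open>Components $(y,z,u,\xi,\eta)$.  The type-class norm is the usual product norm.\<close>

type_synonym state = "h1 \<times> l2 \<times> l2 \<times> real \<times> real"

definition ell :: "real \<Rightarrow> real \<Rightarrow> real \<Rightarrow> real \<Rightarrow> real \<Rightarrow> state \<Rightarrow> real" where
  "ell m M \<tau> \<alpha> \<beta> = (\<lambda>(y, z, u, \<xi>, \<eta>).
     (LINT x|I01. rep_l2 z x) + m * \<xi> + M * \<eta> + (\<beta> - \<alpha>) * h1_value y 0
       + \<tau> * \<alpha> * (LINT x|I01. rep_l2 u x))"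

definition inner_X ::
  "h1 \<Rightarrow> real \<Rightarrow> real \<Rightarrow> real \<Rightarrow> real \<Rightarrow> real \<Rightarrow> real \<Rightarrow> real \<Rightarrow> state \<Rightarrow> state \<Rightarrow> real" where
  "inner_X a m M \<tau> \<alpha> \<beta> K \<omega> = (\<lambda>(y, z, u, \<xi>, \<eta>) (y', z', u', \<xi>', \<eta>').
     (LINT x|I01. h1_value a x * rep_l2 (h1_deriv y) x * rep_l2 (h1_deriv y') x
                  + rep_l2 z x * rep_l2 z' x)
     + K * \<tau> * (LINT x|I01. rep_l2 u x * rep_l2 u' x)
     + m * \<xi> * \<xi>' + M * \<eta> * \<eta>'
     + \<omega> * ell m M \<tau> \<alpha> \<beta> (y, z, u, \<xi>, \<eta>) * ell m M \<tau> \<alpha> \<beta> (y', z', u', \<xi>', \<eta>'))"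

definition norm_X ::
  "h1 \<Rightarrow> real \<Rightarrow> real \<Rightarrow> real \<Rightarrow> real \<Rightarrow> real \<Rightarrow> real \<Rightarrow> real \<Rightarrow> state \<Rightarrow> real" where
  "norm_X a m M \<tau> \<alpha> \<beta> K \<omega> \<Phi> = sqrt (inner_X a m M \<tau> \<alpha> \<beta> K \<omega> \<Phi> \<Phi>)"

text \<open>As \<open>l2\<close> and \<open>h1\<close> are complete, the following makes the state space with
  \<open>inner_X\<close> a Hilbert space, and closures, limits, bounded operators and integrals with respect to
  \<open>norm_X\<close> are those of the type-class norm.\<close>

definition norm_X_equivalent ::
  "h1 \<Rightarrow> real \<Rightarrow> real \<Rightarrow> real \<Rightarrow> real \<Rightarrow> real \<Rightarrow> real \<Rightarrow> real \<Rightarrow> bool" where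
  "norm_X_equivalent a m M \<tau> \<alpha> \<beta> K \<omega> \<longleftrightarrow>
     (\<exists>c>0. \<exists>C>0. \<forall>\<Phi>. c * norm \<Phi> \<le> norm_X a m M \<tau> \<alpha> \<beta> K \<omega> \<Phi> \<and>
                        norm_X a m M \<tau> \<alpha> \<beta> K \<omega> \<Phi> \<le> C * norm \<Phi>)"

definition flux :: "h1 \<Rightarrow> h1 \<Rightarrow> l2" where
  "flux a y = abs_l2 (\<lambda>x. h1_value a x * rep_l2 (h1_deriv y) x)"

definition dom_A :: "state set" where
  "dom_A = {(y, z, u, \<xi>, \<eta>).
     h1_deriv y \<in> H1 \<and> z \<in> H1 \<and> u \<in> H1 \<and>
     \<xi> = point_value u 0 \<and> \<xi> = point_value z 0 \<and> \<eta> = point_value z 1}"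

definition op_A ::
  "h1 \<Rightarrow> real \<Rightarrow> real \<Rightarrow> real \<Rightarrow> real \<Rightarrow> real \<Rightarrow> state \<Rightarrow> state" where
  "op_A a m M \<tau> \<alpha> \<beta> = (\<lambda>(y, z, u, \<xi>, \<eta>).
     (to_h1 z,
      weak_deriv (flux a y),
      - (1 / \<tau>) *\<^sub>R weak_deriv u,
      (1 / m) * (point_value (flux a y) 0 - \<beta> * \<xi> + \<alpha> * point_value u 1),
      - point_value (flux a y) 1 / M))"

end

theory Submission
  imports Defs "HOL-Complex_Analysis.Conformal_Mappings" "Jordan_Normal_Form.Determinant"
begin

text \<open>The operator $A$ is dissipative for the given inner product.  The functional
$\Lambda=\ell$ vanishes on the range of $A$, so it does not contribute to $\langle A\Phi,\Phi\rangle$, and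
integration by parts leaves
$$-\tfrac K2u(1)^2+\bigl(\tfrac K2-\beta\bigr)\xi^2+\alpha\,u(1)\,\xi\le 0 ,$$
where the inequality is exactly what $|\alpha|\le K\le 2\beta-|\alpha|$ provides (\<open>A_dissipative\<close>).

The compactness of the resolvent comes from explicit integral operators.  The kernel of $A$ is spanned by the rigid displacement
$e=(1,0,0,0,0)$, on which $\Lambda$ takes the value $\mu=\beta-\alpha>0$.  The operator
$\Phi\mapsto A\Phi-y(0)e$ therefore has an inverse $R$, which is found by integrating the equations and
satisfies $AR=1+S$ with $S$ of rank one (\<open>A_R\<close>, \<open>dom_A_eq\<close>).  Apart from finite rank terms
$R$ consists of Volterra operators $g\mapsto\int_0^xg$, and these are limits in norm of finite rank operators
because primitives of $L^2$ functions are Hoelder continuous (\<open>R_approx\<close>).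

Hence on every disc $\zeta-A$ can be written as $-(1-\zeta E-\sum_if_i^\zeta(\cdot)v_i)R^{-1}$ with $E$ small and
finitely many functionals that are affine in $\zeta$.  Inverting $1-\zeta E$ by a Neumann series
reduces all questions about the resolvent to an $n\times n$ matrix that is holomorphic in $\zeta$: its
determinant vanishes exactly at the eigenvalues, and there are no other points of the spectrum
(\<open>fredholm_determinant\<close>).  Dissipativity shows that positive numbers are not eigenvalues, so the determinant
is not identically zero; its zeros are isolated, and Cramer's rule bounds the rank of the principal part of the
resolvent, hence of the Riesz projection (\<open>spectrum_discrete\<close>).

The same fact makes $1-hA$ bijective for every $h>0$.  For a dissipative operator with this property and with dense
domain, the implicit Euler scheme with step lengths $2^{-k}$ converges, and the limit is a semigroup of
contractions generated by $A$ (\<open>C0_semigroup_T\<close>, \<open>generates_T\<close>); existence and uniqueness for the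
Cauchy problem follow from this (\<open>mild_solution_T\<close>, \<open>mild_solution_unique\<close>, \<open>strong_solution_T\<close>).

The function spaces are handled through one description: $f$ has the weak derivative $g$ if and only if
$f=c+\int_0^xg$ for a constant $c$ (\<open>has_weak_deriv_iff\<close>).  Point values, integration by parts, products and reciprocals
are read off from it.\<close>

section \<open>Contraction semigroups of maximal dissipative operators\<close>

text \<open>The generation theorem is needed for a norm \<open>N\<close> that is only equivalent to the norm of the type, so the
locale carries the inner product \<open>ip\<close> as data.  Its positivity is a consequence of \<open>N_lower\<close>, because the
square root of a negative number is negative.\<close>

locale maximal_dissipative =
  fixes D :: "'a::banach set" and A :: "'a \<Rightarrow> 'a"
    and ip :: "'a \<Rightarrow> 'a \<Rightarrow> real" and N :: "'a \<Rightarrow> real" and c C :: real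
  assumes subspace_D: "subspace D"
    and A_add: "x \<in> D \<Longrightarrow> y \<in> D \<Longrightarrow> A (x + y) = A x + A y"
    and A_scale: "x \<in> D \<Longrightarrow> A (r *\<^sub>R x) = r *\<^sub>R A x"
    and ip_add: "ip (x + y) z = ip x z + ip y z"
    and ip_scale: "ip (r *\<^sub>R x) z = r * ip x z"
    and ip_sym: "ip x y = ip y x"
    and N_eq: "N x = sqrt (ip x x)"
    and c_pos: "c > 0" and N_lower: "c * norm x \<le> N x" and N_upper: "N x \<le> C * norm x"
    and dissipative: "x \<in> D \<Longrightarrow> ip (A x) x \<le> 0"
    and surj: "h > 0 \<Longrightarrow> \<exists>x\<in>D. x - h *\<^sub>R A x = y"
    and dense: "closure D = UNIV"
begin

lemma ip_add_right: "ip z (x + y) = ip z x + ip z y"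
  and ip_scale_right: "ip z (r *\<^sub>R x) = r * ip z x"
  using ip_add ip_scale ip_sym by metis+

lemma ip_minus: "ip (- x) z = - ip x z" "ip z (- x) = - ip z x"
  using ip_scale[of "-1"] ip_scale_right[of _ "-1"] by auto

lemma ip_diff: "ip (x - y) z = ip x z - ip y z" "ip z (x - y) = ip z x - ip z y"
  unfolding diff_conv_add_uminus ip_add ip_add_right ip_minus by auto

lemma N_nonneg: "N x \<ge> 0"
  using N_lower[of x] c_pos by (meson order_trans norm_ge_zero zero_le_mult_iff less_imp_le)

lemma ip_nonneg: "ip x x \<ge> 0"
  using N_nonneg[of x] by (simp add: N_eq)

lemma N_square: "(N x)\<^sup>2 = ip x x"
  using ip_nonneg[of x] by (simp add: N_eq)

lemma N_eq_0: "N x = 0 \<longleftrightarrow> x = 0"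
proof
  assume "N x = 0"
  then have "c * norm x \<le> 0" using N_lower[of x] by simp
  then show "x = 0" using c_pos by (simp add: mult_le_0_iff)
next
  assume "x = 0"
  then show "N x = 0" using ip_scale[of 0 0 0] by (simp add: N_eq)
qed

lemma ip_zero [simp]: "ip 0 x = 0" "ip x 0 = 0"
  using ip_scale[of 0 0 x] ip_scale_right[of x 0 0] by auto

lemma C_nonneg: "C * norm (x::'a) \<ge> 0"
  using N_nonneg[of x] N_upper[of x] by linarith

lemma ip_Cauchy_Schwarz: "ip x y \<le> N x * N y"
proof (cases "y = 0")
  case True
  then show ?thesis by (simp add: N_eq)
next
  case False
  then have p: "ip y y > 0"
    using N_eq_0[of y] ip_nonneg[of y] by (auto simp: N_eq order.strict_iff_order)
  (* the minimiser of the energy of x - s y *)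
  define s where "s = ip x y / ip y y"
  have "0 \<le> ip (x - s *\<^sub>R y) (x - s *\<^sub>R y)" by (rule ip_nonneg)
  also have "\<dots> = ip x x - 2 * s * ip x y + s\<^sup>2 * ip y y"
    by (simp add: ip_diff ip_scale ip_scale_right ip_sym[of y x] power2_eq_square algebra_simps)
  also have "\<dots> = ip x x - (ip x y)\<^sup>2 / ip y y"
    using p by (simp add: s_def power2_eq_square field_simps)
  finally have "(ip x y)\<^sup>2 \<le> ip x x * ip y y" using p by (simp add: field_simps)
  then have "(ip x y)\<^sup>2 \<le> (N x * N y)\<^sup>2" by (simp add: power_mult_distrib N_square)
  then show ?thesis by (rule power2_le_imp_le) (simp add: N_nonneg)
qed

lemma N_triangle: "N (x + y) \<le> N x + N y"
proof (rule power2_le_imp_le)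
  have "(N (x + y))\<^sup>2 = ip x x + 2 * ip x y + ip y y"
    by (simp add: N_square ip_add ip_add_right ip_sym[of y x])
  also have "\<dots> \<le> (N x)\<^sup>2 + 2 * (N x * N y) + (N y)\<^sup>2"
    using ip_Cauchy_Schwarz[of x y] by (simp add: N_square)
  finally show "(N (x + y))\<^sup>2 \<le> (N x + N y)\<^sup>2" by (simp add: power2_sum)
qed (simp add: N_nonneg)

lemma N_scale: "N (r *\<^sub>R x) = \<bar>r\<bar> * N x"
  by (simp add: N_eq ip_scale ip_scale_right real_sqrt_mult mult.assoc[symmetric])

lemma N_minus: "N (- x) = N x"
  using N_scale[of "-1" x] by simp

lemma N_minus_commute: "N (x - y) = N (y - x)"
  using N_minus[of "x - y"] by simp

lemma N_triangle_diff: "N (x - z) \<le> N (x - y) + N (y - z)"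
  using N_triangle[of "x - y" "y - z"] by simp

lemma N_sum_diff: "N (x - y) \<le> N x + N y"
  using N_triangle[of x "-y"] by (simp add: N_minus)

lemma norm_le_N: "norm x \<le> N x / c"
  using N_lower[of x] c_pos by (simp add: field_simps)

lemma tendsto_iff_N: "(f \<longlongrightarrow> l) F \<longleftrightarrow> ((\<lambda>t. N (f t - l)) \<longlongrightarrow> 0) F"
proof
  assume "(f \<longlongrightarrow> l) F"
  then have "((\<lambda>t. C * norm (f t - l)) \<longlongrightarrow> 0) F"
    by (intro tendsto_mult_right_zero tendsto_norm_zero) (simp add: LIM_zero)
  then show "((\<lambda>t. N (f t - l)) \<longlongrightarrow> 0) F"
    by (rule tendsto_sandwich[rotated 2, OF tendsto_const]) (auto simp: N_nonneg N_upper)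
next
  assume "((\<lambda>t. N (f t - l)) \<longlongrightarrow> 0) F"
  then have "((\<lambda>t. N (f t - l) / c) \<longlongrightarrow> 0) F" by (rule tendsto_divide_zero)
  then have "((\<lambda>t. norm (f t - l)) \<longlongrightarrow> 0) F"
    by (rule tendsto_sandwich[rotated 2, OF tendsto_const]) (auto simp: norm_le_N)
  then show "(f \<longlongrightarrow> l) F"
    by (rule LIM_zero_cancel[OF tendsto_norm_zero_cancel])
qed

lemma tendsto_N:
  assumes "(f \<longlongrightarrow> l) F"
  shows "((\<lambda>t. N (f t)) \<longlongrightarrow> N l) F"
proof -
  have "((\<lambda>t. N (f t - l)) \<longlongrightarrow> 0) F" using assms tendsto_iff_N by blast
  then have "((\<lambda>t. N (f t) - N l) \<longlongrightarrow> 0) F"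
  proof (rule Lim_null_comparison[rotated])
    have "\<bar>N x - N l\<bar> \<le> N (x - l)" for x
      using N_triangle[of "x - l" l] N_triangle[of "l - x" x] N_minus_commute[of x l] by auto
    then show "\<forall>\<^sub>F t in F. norm (N (f t) - N l) \<le> N (f t - l)" by simp
  qed
  then show ?thesis by (rule LIM_zero_cancel)
qed

lemma dense_N:
  assumes "closure S = UNIV" "e > 0"
  obtains y where "y \<in> S" "N (x - y) < e"
proof -
  have "x \<in> closure S" using assms by simp
  then obtain f where f: "\<And>n. f n \<in> S" "f \<longlonglongrightarrow> x" by (auto simp: closure_sequential)
  have "((\<lambda>n. N (f n - x)) \<longlonglongrightarrow> 0)" using f(2) tendsto_iff_N by blast
  then have "\<forall>\<^sub>F n in sequentially. N (f n - x) < e" using assms(2) by (rule order_tendstoD)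
  then obtain n where "N (f n - x) < e" by (auto simp: eventually_sequentially)
  then show ?thesis using that[of "f n"] f(1) by (simp add: N_minus_commute)
qed

lemma D_zero: "0 \<in> D" and D_add: "x \<in> D \<Longrightarrow> y \<in> D \<Longrightarrow> x + y \<in> D"
  and D_scale: "x \<in> D \<Longrightarrow> r *\<^sub>R x \<in> D" and D_diff: "x \<in> D \<Longrightarrow> y \<in> D \<Longrightarrow> x - y \<in> D"
  using subspace_D by (auto simp: subspace_0 subspace_add subspace_scale subspace_diff)

lemma A_zero: "A 0 = 0"
  using A_scale[OF D_zero, of 0] by simp

lemma A_diff: "x \<in> D \<Longrightarrow> y \<in> D \<Longrightarrow> A (x - y) = A x - A y"
  using A_add[of x "(-1) *\<^sub>R y"] A_scale[of y "-1"] D_scale[of y "-1"] by simp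

text \<open>The resolvent $(1-hA)^{-1}$, that is, one implicit Euler step of length $h$.\<close>

definition J :: "real \<Rightarrow> 'a \<Rightarrow> 'a" where
  "J h y = (SOME x. x \<in> D \<and> x - h *\<^sub>R A x = y)"

lemma N_resolvent_bound:
  assumes "h > 0" "x \<in> D"
  shows "N x \<le> N (x - h *\<^sub>R A x)"
proof (rule power2_le_imp_le)
  have "ip (x - h *\<^sub>R A x) (x - h *\<^sub>R A x) = ip x x - 2 * h * ip (A x) x + h\<^sup>2 * ip (A x) (A x)"
    by (simp add: ip_diff ip_scale ip_scale_right ip_sym[of x "A x"] power2_eq_square algebra_simps)
  moreover have "h * ip (A x) x \<le> 0" using assms dissipative by (simp add: mult_le_0_iff)
  moreover have "h\<^sup>2 * ip (A x) (A x) \<ge> 0" using ip_nonneg by simp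
  ultimately show "(N x)\<^sup>2 \<le> (N (x - h *\<^sub>R A x))\<^sup>2" by (simp add: N_square)
qed (simp add: N_nonneg)

lemma J_in_D: "h > 0 \<Longrightarrow> J h y \<in> D" and J_solves: "h > 0 \<Longrightarrow> J h y - h *\<^sub>R A (J h y) = y"
proof -
  assume "h > 0"
  then have "\<exists>x. x \<in> D \<and> x - h *\<^sub>R A x = y" using surj by blast
  then have "J h y \<in> D \<and> J h y - h *\<^sub>R A (J h y) = y" unfolding J_def by (rule someI_ex)
  then show "J h y \<in> D" "J h y - h *\<^sub>R A (J h y) = y" by auto
qed

lemma J_unique:
  assumes "h > 0" "x \<in> D" "x - h *\<^sub>R A x = y"
  shows "J h y = x"
proof -
  let ?w = "J h y - x"
  have D: "?w \<in> D" using assms J_in_D D_diff by blast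
  have "?w - h *\<^sub>R A ?w = (J h y - h *\<^sub>R A (J h y)) - (x - h *\<^sub>R A x)"
    using assms J_in_D by (simp add: A_diff algebra_simps)
  also have "\<dots> = 0" using assms J_solves by simp
  finally have "N ?w \<le> N 0" using N_resolvent_bound[OF assms(1) D] by simp
  then have "N ?w = 0" using N_eq_0[of 0] N_nonneg[of ?w] by simp
  then show ?thesis by (simp add: N_eq_0)
qed

lemma J_contraction: "h > 0 \<Longrightarrow> N (J h y) \<le> N y"
  using N_resolvent_bound[of h "J h y"] J_in_D J_solves by simp

lemma J_add: "h > 0 \<Longrightarrow> J h (x + y) = J h x + J h y"
proof (rule J_unique)
  assume h: "h > 0"
  show "J h x + J h y \<in> D" using h J_in_D D_add by blast
  show "J h x + J h y - h *\<^sub>R A (J h x + J h y) = x + y"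
    using J_solves[OF h, of x] J_solves[OF h, of y] J_in_D[OF h]
    by (simp add: A_add scaleR_add_right add_diff_add)
qed auto

lemma J_scale: "h > 0 \<Longrightarrow> J h (r *\<^sub>R x) = r *\<^sub>R J h x"
proof (rule J_unique)
  assume h: "h > 0"
  show "r *\<^sub>R J h x \<in> D" using h J_in_D D_scale by blast
  show "r *\<^sub>R J h x - h *\<^sub>R A (r *\<^sub>R J h x) = r *\<^sub>R x"
    using J_solves[OF h, of x] J_in_D[OF h]
    by (metis A_scale scaleR_diff_right scaleR_left_commute)
qed auto

lemma J_commutes:
  assumes "h > 0" "x \<in> D"
  shows "A (J h x) \<in> D" "A (J h x) = J h (A x)"
proof -
  have e: "A (J h x) = (1 / h) *\<^sub>R (J h x - x)"
  proof -
    have "J h x - x = h *\<^sub>R A (J h x)"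
      using J_solves[OF assms(1), of x] by (metis add_diff_cancel_left' diff_add_cancel)
    then show ?thesis using assms(1) by simp
  qed
  show D: "A (J h x) \<in> D" unfolding e using assms J_in_D D_diff D_scale by blast
  have "A (J h x) - h *\<^sub>R A (A (J h x)) = A (J h x - h *\<^sub>R A (J h x))"
    using A_diff[OF J_in_D[OF assms(1)] D_scale[OF D]] A_scale[OF D] by simp
  also have "\<dots> = A x" using J_solves assms by simp
  finally show "A (J h x) = J h (A x)" by (rule J_unique[OF assms(1) D, symmetric])
qed

lemma J_pow_contraction: "h > 0 \<Longrightarrow> N ((J h ^^ n) x) \<le> N x"
  by (induction n) (auto intro: order_trans[OF J_contraction])

lemma J_pow_add: "h > 0 \<Longrightarrow> (J h ^^ n) (x + y) = (J h ^^ n) x + (J h ^^ n) y"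
  by (induction n) (auto simp: J_add)

lemma J_pow_scale: "h > 0 \<Longrightarrow> (J h ^^ n) (r *\<^sub>R x) = r *\<^sub>R (J h ^^ n) x"
  by (induction n) (auto simp: J_scale)

lemma J_pow_diff: "h > 0 \<Longrightarrow> (J h ^^ n) (x - y) = (J h ^^ n) x - (J h ^^ n) y"
  using J_pow_add[of h n x "(-1) *\<^sub>R y"] J_pow_scale[of h n "-1" y] by simp

lemma J_diff: "h > 0 \<Longrightarrow> J h (x - y) = J h x - J h y"
  using J_pow_diff[of h 1] by simp

lemma J_pow_commutes:
  assumes "h > 0" "x \<in> D"
  shows "(J h ^^ n) x \<in> D" "A ((J h ^^ n) x) = (J h ^^ n) (A x)"
proof -
  have "(J h ^^ n) x \<in> D \<and> A ((J h ^^ n) x) = (J h ^^ n) (A x)"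
    by (induction n) (use assms in \<open>auto simp: J_in_D J_commutes\<close>)
  then show "(J h ^^ n) x \<in> D" "A ((J h ^^ n) x) = (J h ^^ n) (A x)" by auto
qed

lemma J_step: "h > 0 \<Longrightarrow> x \<in> D \<Longrightarrow> J h x - x = h *\<^sub>R J h (A x)"
  using J_solves[of h x] J_commutes[of h x] by (simp add: algebra_simps)

lemma J_pow_Lipschitz:
  assumes "h > 0" "x \<in> D"
  shows "N ((J h ^^ n) x - x) \<le> n * h * N (A x)"
proof (induction n)
  case 0
  then show ?case using N_eq_0[of 0] by simp
next
  case (Suc n)
  let ?y = "(J h ^^ n) x"
  have "N ((J h ^^ Suc n) x - x) \<le> N (J h ?y - ?y) + N (?y - x)"
    using N_triangle_diff by simp
  also have "N (J h ?y - ?y) \<le> h * N (A x)"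
    using assms J_step[of h ?y] J_pow_commutes[of h x n] J_pow_contraction[of h "Suc n" "A x"]
    by (simp add: N_scale)
  finally show ?case using Suc by (simp add: algebra_simps)
qed

text \<open>One Euler step of length $2h$ and two of length $h$ agree up to $O(h^2)$: with $q=(1-hA)^{-2}x$ one has
$(1-2hA)q = x-h^2A^2q$, and the resolvent on the right-hand side is a contraction that commutes with $A$.\<close>

lemma J_halving:
  assumes "h > 0" "x \<in> D" "A x \<in> D"
  shows "N (J (2 * h) x - J h (J h x)) \<le> h\<^sup>2 * N (A (A x))"
proof -
  define r where "r = J h x"
  define q where "q = J h r"
  (* all iterated applications of A are pulled through the resolvents *)
  have rD: "r \<in> D" "A r \<in> D" "A r = J h (A x)" using assms J_in_D J_commutes by (auto simp: r_def)
  have qD: "q \<in> D" "A q \<in> D" "A q = J h (A r)" using assms rD J_in_D J_commutes by (auto simp: q_def)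
  have AAr: "A (A r) = J h (A (A x))" using rD(3) assms J_commutes by simp
  have AAq: "A (A q) = J h (J h (A (A x)))" using qD(3) rD AAr assms J_commutes by simp
  have r: "q - h *\<^sub>R A q = r" unfolding q_def using J_solves assms by simp
  have "r - h *\<^sub>R A r = x" unfolding r_def using J_solves assms by simp
  moreover have "A r = A q - h *\<^sub>R A (A q)"
    using r qD A_diff[of q "h *\<^sub>R A q"] A_scale[of "A q" h] D_scale by simp
  ultimately have "q - (2 * h) *\<^sub>R A q = x - h\<^sup>2 *\<^sub>R A (A q)"
  proof -
    assume x: "r - h *\<^sub>R A r = x" and Ar: "A r = A q - h *\<^sub>R A (A q)"
    have "x = r - h *\<^sub>R A q + h\<^sup>2 *\<^sub>R A (A q)"
      unfolding x[symmetric] Ar by (simp add: scaleR_diff_right power2_eq_square)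
    moreover have "r = q - h *\<^sub>R A q" using r by simp
    ultimately show ?thesis
      by (simp add: scaleR_2 flip: scaleR_scaleR)
  qed
  then have "q = J (2 * h) (x - h\<^sup>2 *\<^sub>R A (A q))"
    using J_unique[of "2 * h" q] qD assms by simp
  also have "\<dots> = J (2 * h) x - h\<^sup>2 *\<^sub>R J (2 * h) (A (A q))"
    using assms by (simp add: J_diff J_scale)
  finally have "J (2 * h) x - q = h\<^sup>2 *\<^sub>R J (2 * h) (A (A q))" by (metis diff_diff_eq2 add_diff_cancel_left')
  then have "N (J (2 * h) x - q) = h\<^sup>2 * N (J (2 * h) (A (A q)))" by (simp add: N_scale)
  also have "N (J (2 * h) (A (A q))) \<le> N (A (A x))"
    unfolding AAq using assms J_contraction[of "2 * h"] J_contraction[of h] order_trans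
    by (metis mult_pos_pos zero_less_numeral)
  finally show ?thesis by (simp add: q_def r_def mult_left_mono)
qed

lemma J_halving_pow:
  assumes "h > 0" "x \<in> D" "A x \<in> D"
  shows "N ((J (2 * h) ^^ n) x - (J h ^^ (2 * n)) x) \<le> n * h\<^sup>2 * N (A (A x))"
proof (induction n)
  case 0
  then show ?case using N_eq_0[of 0] by simp
next
  case (Suc n)
  let ?y = "(J (2 * h) ^^ n) x" and ?z = "(J h ^^ (2 * n)) x"
  have h2: "2 * h > 0" using assms by simp
  have zD: "?z \<in> D" and Az: "A ?z = (J h ^^ (2 * n)) (A x)"
    and AzD: "A ?z \<in> D" and AAz: "A (A ?z) = (J h ^^ (2 * n)) (A (A x))"
    using J_pow_commutes[OF assms(1,2), of "2 * n"] J_pow_commutes[OF assms(1,3), of "2 * n"] by auto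
  have "N ((J (2 * h) ^^ Suc n) x - (J h ^^ (2 * Suc n)) x)
      = N (J (2 * h) ?y - J h (J h ?z))" by simp
  also have "\<dots> \<le> N (J (2 * h) ?y - J (2 * h) ?z) + N (J (2 * h) ?z - J h (J h ?z))"
    by (rule N_triangle_diff)
  also have "N (J (2 * h) ?y - J (2 * h) ?z) \<le> N (?y - ?z)"
    using J_contraction[OF h2, of "?y - ?z"] J_diff[OF h2] by simp
  also have "N (J (2 * h) ?z - J h (J h ?z)) \<le> h\<^sup>2 * N (A (A ?z))"
    by (rule J_halving[OF assms(1) zD AzD])
  also have "\<dots> \<le> h\<^sup>2 * N (A (A x))"
    unfolding AAz using J_pow_contraction[OF assms(1)] by (simp add: mult_left_mono)
  finally show ?case using Suc by (simp add: algebra_simps)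
qed

text \<open>The semigroup is built as the limit of the implicit Euler scheme along the step lengths $2^{-k}$.  Halving
the step makes consecutive schemes comparable, so exponentials of bounded operators do not enter.\<close>

definition Tk :: "nat \<Rightarrow> real \<Rightarrow> 'a \<Rightarrow> 'a" where
  "Tk k t = J ((1/2) ^ k) ^^ nat \<lfloor>t * 2 ^ k\<rfloor>"

definition T :: "real \<Rightarrow> 'a \<Rightarrow> 'a" where
  "T t x = lim (\<lambda>k. Tk k t x)"

lemma J_pow_close:
  assumes "h > 0" "x \<in> D" "n \<le> m" "m \<le> Suc n"
  shows "N ((J h ^^ n) x - (J h ^^ m) x) \<le> h * N (A x)"
proof -
  consider "m = n" | "m = Suc n" using assms by linarith
  then show ?thesis
  proof cases
    case 1
    then show ?thesis using assms N_nonneg[of "A x"] N_eq_0[of 0] by simp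
  next
    case 2
    let ?y = "(J h ^^ n) x"
    have "N (J h ?y - ?y) = h * N (J h ((J h ^^ n) (A x)))"
      using assms J_step[of h ?y] J_pow_commutes[of h x n] by (simp add: N_scale)
    also have "\<dots> \<le> h * N (A x)"
      using J_pow_contraction[of h "Suc n" "A x"] assms by simp
    finally show ?thesis using 2 N_minus_commute by simp
  qed
qed

lemma Tk_contraction: "N (Tk k t x) \<le> N x"
  unfolding Tk_def by (rule J_pow_contraction) simp

lemma Tk_add: "Tk k t (x + y) = Tk k t x + Tk k t y"
  and Tk_diff: "Tk k t (x - y) = Tk k t x - Tk k t y"
  and Tk_scale: "Tk k t (r *\<^sub>R x) = r *\<^sub>R Tk k t x"
  unfolding Tk_def by (auto simp: J_pow_add J_pow_diff J_pow_scale)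

text \<open>The two schemes differ by the accumulated halving errors, about $t/h$ of size $h^2$, and by at most one
step that rounding down may add.\<close>

lemma Tk_refine:
  assumes "t \<ge> 0" "x \<in> D" "A x \<in> D"
  shows "N (Tk (Suc k) t x - Tk k t x) \<le> (1/2) ^ k * (t * N (A (A x)) + N (A x))"
proof -
  define h :: real where "h = (1/2) ^ Suc k"
  define n where "n = nat \<lfloor>t * 2 ^ k\<rfloor>"
  define m where "m = nat \<lfloor>t * 2 ^ Suc k\<rfloor>"
  have h: "h > 0" "(1/2) ^ k = 2 * h" by (auto simp: h_def)
  have nm: "2 * n \<le> m" "m \<le> Suc (2 * n)" unfolding n_def m_def
    using assms(1) by (auto simp: le_nat_iff nat_le_iff) linarith+
  have "real n \<le> t * 2 ^ k" using assms(1) by (simp add: n_def)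
  then have "real n * h \<le> t * 2 ^ k * h" using h by (simp add: mult_right_mono)
  also have "\<dots> = t / 2" by (simp add: h_def field_simps)
  also have "\<dots> \<le> t" using assms(1) by simp
  finally have nh: "real n * h \<le> t" .
  have "N (Tk (Suc k) t x - Tk k t x) = N ((J h ^^ m) x - (J (2 * h) ^^ n) x)"
    by (simp add: Tk_def h_def m_def n_def)
  also have "\<dots> \<le> N ((J h ^^ m) x - (J h ^^ (2 * n)) x) + N ((J h ^^ (2 * n)) x - (J (2 * h) ^^ n) x)"
    by (rule N_triangle_diff)
  also have "N ((J h ^^ m) x - (J h ^^ (2 * n)) x) \<le> h * N (A x)"
    using J_pow_close[OF h(1) assms(2) nm] N_minus_commute by metis
  also have "N ((J h ^^ (2 * n)) x - (J (2 * h) ^^ n) x) \<le> real n * h\<^sup>2 * N (A (A x))"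
    using J_halving_pow[OF h(1) assms(2,3), of n] N_minus_commute by metis
  also have "real n * h\<^sup>2 * N (A (A x)) \<le> h * (t * N (A (A x)))"
    using mult_right_mono[OF nh, of "h * N (A (A x))"] h N_nonneg
    by (simp add: power2_eq_square algebra_simps)
  finally have "N (Tk (Suc k) t x - Tk k t x) \<le> h * (t * N (A (A x)) + N (A x))"
    by (simp add: algebra_simps)
  also have "\<dots> \<le> 2 * h * (t * N (A (A x)) + N (A x))"
    using h assms(1) N_nonneg by (intro mult_right_mono) auto
  finally show ?thesis using h by simp
qed

lemma dense2: "closure {x \<in> D. A x \<in> D} = UNIV" (is "closure ?D2 = _")
proof -
  have "D \<subseteq> closure ?D2"
  proof
    fix x assume x: "x \<in> D"
    let ?f = "\<lambda>n. J (inverse (real (Suc n))) x"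
    have "\<And>n. ?f n \<in> ?D2" using x J_in_D J_commutes by simp
    moreover have "?f \<longlonglongrightarrow> x"
      unfolding tendsto_iff_N
    proof (rule Lim_null_comparison)
      show "\<forall>\<^sub>F n in sequentially. norm (N (?f n - x)) \<le> inverse (real (Suc n)) * N (A x)"
        using J_pow_Lipschitz[OF _ x, of "inverse (real (Suc n))" 1 for n] N_nonneg by simp
      show "(\<lambda>n. inverse (real (Suc n)) * N (A x)) \<longlonglongrightarrow> 0"
        using LIMSEQ_inverse_real_of_nat by (rule tendsto_mult_left_zero)
    qed
    ultimately show "x \<in> closure ?D2" unfolding closure_sequential by (intro exI[of _ ?f]) blast
  qed
  then have "closure D \<subseteq> closure (closure ?D2)" by (rule closure_mono)
  then show ?thesis using dense by auto
qed

text \<open>On the dense set where \<open>Tk_refine\<close> applies the increments are dominated by a geometric series; the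
contraction property carries the Cauchy property to all initial values.\<close>

lemma Tk_convergent:
  assumes t: "t \<ge> 0"
  shows "convergent (\<lambda>k. Tk k t x)"
proof -
  have smooth: "convergent (\<lambda>k. Tk k t y)" if y: "y \<in> D" "A y \<in> D" for y
  proof -
    let ?B = "(t * N (A (A y)) + N (A y)) / c"
    have "summable (\<lambda>k. Tk (Suc k) t y - Tk k t y)"
    proof (rule summable_comparison_test')
      show "summable (\<lambda>k. (1/2) ^ k * ?B)"
        by (intro summable_mult2 summable_geometric) simp
      fix k :: nat
      have "norm (Tk (Suc k) t y - Tk k t y) \<le> N (Tk (Suc k) t y - Tk k t y) / c"
        by (rule norm_le_N)
      also have "\<dots> \<le> (1/2) ^ k * (t * N (A (A y)) + N (A y)) / c"
        using Tk_refine[OF t y] c_pos by (simp add: divide_right_mono)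
      finally show "norm (Tk (Suc k) t y - Tk k t y) \<le> (1/2) ^ k * ?B" by simp
    qed
    then have "convergent (\<lambda>n. \<Sum>k<n. Tk (Suc k) t y - Tk k t y)"
      by (simp add: summable_iff_convergent)
    then have "convergent (\<lambda>n. Tk n t y - Tk 0 t y)" by (simp add: sum_lessThan_telescope[of "\<lambda>k. Tk k t y"])
    then have "convergent (\<lambda>n. (Tk n t y - Tk 0 t y) + Tk 0 t y)"
      by (intro convergent_add convergent_const)
    then show ?thesis by simp
  qed
  have "Cauchy (\<lambda>k. Tk k t x)"
  proof (rule metric_CauchyI)
    fix e :: real assume e: "e > 0"
    define d where "d = e * c / 3"
    have d: "d > 0" using e c_pos by (simp add: d_def)
    obtain y where y: "y \<in> {x \<in> D. A x \<in> D}" "N (x - y) < d"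
      using dense_N[OF dense2 d] by blast
    have "Cauchy (\<lambda>k. Tk k t y)" using smooth y(1) by (simp add: convergent_Cauchy)
    then obtain M where M: "\<And>m n. m \<ge> M \<Longrightarrow> n \<ge> M \<Longrightarrow> dist (Tk m t y) (Tk n t y) < e / 3"
      using e by (meson metric_CauchyD divide_pos_pos zero_less_numeral)
    have near: "dist (Tk k t x) (Tk k t y) < e / 3" for k
    proof -
      have "dist (Tk k t x) (Tk k t y) \<le> N (Tk k t (x - y)) / c"
        using norm_le_N by (simp add: dist_norm Tk_diff)
      also have "\<dots> \<le> N (x - y) / c" using Tk_contraction c_pos by (simp add: divide_right_mono)
      also have "\<dots> < e / 3" using y(2) c_pos by (simp add: d_def field_simps)
      finally show ?thesis .
    qed
    show "\<exists>M. \<forall>m\<ge>M. \<forall>n\<ge>M. dist (Tk m t x) (Tk n t x) < e"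
    proof (intro exI allI impI)
      fix m n assume "M \<le> m" "M \<le> n"
      then show "dist (Tk m t x) (Tk n t x) < e"
        using near[of m] near[of n] M[of m n] dist_triangle[of "Tk m t x" "Tk n t x" "Tk m t y"]
          dist_triangle[of "Tk m t y" "Tk n t x" "Tk n t y"] dist_commute[of "Tk n t x" "Tk n t y"]
        by linarith
    qed
  qed
  then show ?thesis by (rule Cauchy_convergent)
qed

lemma T_tendsto: "t \<ge> 0 \<Longrightarrow> (\<lambda>k. Tk k t x) \<longlonglongrightarrow> T t x"
  unfolding T_def using Tk_convergent convergent_LIMSEQ_iff by blast

lemma T_contraction: "t \<ge> 0 \<Longrightarrow> N (T t x) \<le> N x"
  by (rule LIMSEQ_le_const2[OF tendsto_N[OF T_tendsto]]) (auto intro: Tk_contraction)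

lemma T_add: "t \<ge> 0 \<Longrightarrow> T t (x + y) = T t x + T t y"
  using tendsto_add[OF T_tendsto[of t x] T_tendsto[of t y]] T_tendsto[of t "x + y"]
    LIMSEQ_unique by (auto simp: Tk_add)

lemma T_scale: "t \<ge> 0 \<Longrightarrow> T t (r *\<^sub>R x) = r *\<^sub>R T t x"
  using tendsto_scaleR[OF tendsto_const T_tendsto[of t x], of r] T_tendsto[of t "r *\<^sub>R x"]
    LIMSEQ_unique by (auto simp: Tk_scale)

lemma T_diff: "t \<ge> 0 \<Longrightarrow> T t (x - y) = T t x - T t y"
  using T_add[of t x "(-1) *\<^sub>R y"] T_scale[of t "-1" y] by simp

lemma T_bounded_linear: "t \<ge> 0 \<Longrightarrow> bounded_linear (T t)"
proof (rule bounded_linear_intro)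
  assume t: "t \<ge> 0"
  show "norm (T t x) \<le> norm x * (C / c)" for x
  proof -
    have "norm (T t x) \<le> N (T t x) / c" by (rule norm_le_N)
    also have "\<dots> \<le> (C * norm x) / c"
      using T_contraction[OF t, of x] N_upper[of x] c_pos by (intro divide_right_mono) auto
    finally show ?thesis by (simp add: mult.commute)
  qed
qed (auto simp: T_add T_scale)

lemma T_zero: "T 0 x = x"
proof -
  have "(\<lambda>k. Tk k 0 x) \<longlonglongrightarrow> x" by (simp add: Tk_def)
  then show ?thesis using T_tendsto[of 0 x] LIMSEQ_unique by blast
qed

text \<open>The numbers of steps used for $s$ and for $t$ add up to the number used for $s+t$ or to one less, and one
step moves a point of the domain by at most $2^{-k}N(Ay)$.\<close>

lemma T_semigroup:
  assumes s: "s \<ge> 0" and t: "t \<ge> 0"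
  shows "T (s + t) x = T s (T t x)"
proof -
  have onD: "T (s + t) y = T s (T t y)" if y: "y \<in> D" for y
  proof -
    have 1: "(\<lambda>k. Tk k s (Tk k t y)) \<longlonglongrightarrow> T s (T t y)"
      unfolding tendsto_iff_N
    proof (rule Lim_null_comparison)
      show "\<forall>\<^sub>F k in sequentially. norm (N (Tk k s (Tk k t y) - T s (T t y)))
          \<le> N (Tk k t y - T t y) + N (Tk k s (T t y) - T s (T t y))"
      proof (rule always_eventually, rule allI)
        fix k
        have "N (Tk k s (Tk k t y) - T s (T t y))
           \<le> N (Tk k s (Tk k t y) - Tk k s (T t y)) + N (Tk k s (T t y) - T s (T t y))"
          by (rule N_triangle_diff)
        then show "norm (N (Tk k s (Tk k t y) - T s (T t y)))
          \<le> N (Tk k t y - T t y) + N (Tk k s (T t y) - T s (T t y))"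
          using Tk_contraction[of k s "Tk k t y - T t y"] N_nonneg by (simp add: Tk_diff)
      qed
      show "(\<lambda>k. N (Tk k t y - T t y) + N (Tk k s (T t y) - T s (T t y))) \<longlonglongrightarrow> 0"
        using T_tendsto[OF t, of y] T_tendsto[OF s, of "T t y"]
        unfolding tendsto_iff_N by (rule tendsto_add_zero)
    qed
    have 2: "(\<lambda>k. Tk k s (Tk k t y) - Tk k (s + t) y) \<longlonglongrightarrow> 0"
      unfolding tendsto_iff_N
    proof (rule Lim_null_comparison)
      show "(\<lambda>k. (1/2) ^ k * N (A y)) \<longlonglongrightarrow> 0"
        by (intro tendsto_mult_left_zero LIMSEQ_realpow_zero) auto
      show "\<forall>\<^sub>F k in sequentially. norm (N (Tk k s (Tk k t y) - Tk k (s + t) y - 0)) \<le> (1/2) ^ k * N (A y)"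
      proof (rule always_eventually, rule allI)
        fix k :: nat
        let ?n = "nat \<lfloor>s * 2 ^ k\<rfloor> + nat \<lfloor>t * 2 ^ k\<rfloor>" and ?m = "nat \<lfloor>(s + t) * 2 ^ k\<rfloor>"
        have "s * 2 ^ k \<ge> 0" "t * 2 ^ k \<ge> 0" using s t by auto
        then have nm: "?n \<le> ?m" "?m \<le> Suc ?n"
          unfolding distrib_right by linarith+
        have "Tk k s (Tk k t y) = (J ((1/2) ^ k) ^^ ?n) y" by (simp add: Tk_def funpow_add)
        then have "N (Tk k s (Tk k t y) - Tk k (s + t) y) \<le> (1/2) ^ k * N (A y)"
          using J_pow_close[OF _ y nm, of "(1/2) ^ k"] by (simp add: Tk_def)
        then show "norm (N (Tk k s (Tk k t y) - Tk k (s + t) y - 0)) \<le> (1/2) ^ k * N (A y)"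
          using N_nonneg by simp
      qed
    qed
    have "(\<lambda>k. Tk k (s + t) y) \<longlonglongrightarrow> T s (T t y)"
      using tendsto_diff[OF 1 2] by simp
    then show ?thesis using T_tendsto[of "s + t" y] s t LIMSEQ_unique by auto
  qed
  have "x \<in> closure D" using dense by simp
  then obtain f where f: "\<And>n. f n \<in> D" "f \<longlonglongrightarrow> x" by (auto simp: closure_sequential)
  have "(\<lambda>n. T (s + t) (f n)) \<longlonglongrightarrow> T (s + t) x"
    using bounded_linear.tendsto[OF T_bounded_linear f(2)] s t by simp
  moreover have "(\<lambda>n. T s (T t (f n))) \<longlonglongrightarrow> T s (T t x)"
    using bounded_linear.tendsto[OF T_bounded_linear bounded_linear.tendsto[OF T_bounded_linear f(2)]]
      s t by simp
  ultimately show ?thesis using onD[OF f(1)] LIMSEQ_unique by simp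
qed

text \<open>A first order Taylor estimate for \<open>x\<close> in the domain alone.  The auxiliary point \<open>y\<close> stands for an
approximation of $Ax$ inside the domain, where the scheme is Lipschitz in time.\<close>

lemma J_pow_taylor:
  assumes "h > 0" "x \<in> D" "y \<in> D"
  shows "N ((J h ^^ n) x - x - (n * h) *\<^sub>R A x) \<le> n * h * (2 * N (A x - y) + n * h * N (A y))"
proof (induction n)
  case 0
  then show ?case using N_eq_0[of 0] by simp
next
  case (Suc n)
  let ?u = "(J h ^^ n) x" and ?v = "A x" and ?a = "N (A x - y)" and ?b = "N (A y)"
  have "J h ?u - ?u = h *\<^sub>R (J h ^^ Suc n) ?v"
    using assms J_step[of h ?u] J_pow_commutes[of h x n] by simp
  then have "(J h ^^ Suc n) x - x - (Suc n * h) *\<^sub>R ?v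
     = (?u - x - (n * h) *\<^sub>R ?v) + h *\<^sub>R ((J h ^^ Suc n) ?v - ?v)"
    by (simp add: algebra_simps)
  then have "N ((J h ^^ Suc n) x - x - (Suc n * h) *\<^sub>R ?v)
     \<le> N (?u - x - (n * h) *\<^sub>R ?v) + h * N ((J h ^^ Suc n) ?v - ?v)"
    using N_triangle assms(1) by (metis N_scale abs_of_pos)
  also have "N ((J h ^^ Suc n) ?v - ?v) \<le> 2 * ?a + Suc n * h * ?b"
  proof -
    have "(J h ^^ Suc n) ?v - ?v = ((J h ^^ Suc n) (?v - y) - (?v - y)) + ((J h ^^ Suc n) y - y)"
      using assms(1) by (simp only: J_pow_diff) simp
    then have "N ((J h ^^ Suc n) ?v - ?v) \<le> N ((J h ^^ Suc n) (?v - y) - (?v - y)) + N ((J h ^^ Suc n) y - y)"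
      using N_triangle by metis
    also have "N ((J h ^^ Suc n) (?v - y) - (?v - y)) \<le> N ((J h ^^ Suc n) (?v - y)) + ?a"
      by (rule N_sum_diff)
    also have "N ((J h ^^ Suc n) (?v - y)) \<le> ?a" by (rule J_pow_contraction[OF assms(1)])
    also have "N ((J h ^^ Suc n) y - y) \<le> Suc n * h * ?b" by (rule J_pow_Lipschitz[OF assms(1,3)])
    finally show ?thesis by simp
  qed
  also have "N (?u - x - (n * h) *\<^sub>R ?v) \<le> n * h * (2 * ?a + n * h * ?b)" by (rule Suc)
  finally have "N ((J h ^^ Suc n) x - x - (Suc n * h) *\<^sub>R ?v)
     \<le> n * h * (2 * ?a + n * h * ?b) + h * (2 * ?a + Suc n * h * ?b)"
    using assms(1) by (simp add: mult_left_mono)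
  also have "\<dots> \<le> n * h * (2 * ?a + Suc n * h * ?b) + h * (2 * ?a + Suc n * h * ?b)"
    using assms(1) N_nonneg[of "A y"] by (intro add_right_mono mult_left_mono add_left_mono mult_right_mono) auto
  finally show ?case by (simp add: algebra_simps)
qed

lemma T_taylor:
  assumes "t \<ge> 0" "x \<in> D" "y \<in> D"
  shows "N (T t x - x - t *\<^sub>R A x) \<le> t * (2 * N (A x - y) + t * N (A y))"
proof -
  let ?n = "\<lambda>k. real (nat \<lfloor>t * 2 ^ k\<rfloor>) * (1/2) ^ k"
  have n: "?n \<longlonglongrightarrow> t"
  proof (rule tendsto_sandwich)
    have b: "t * 2 ^ k - 1 \<le> real (nat \<lfloor>t * 2 ^ k\<rfloor>)" "real (nat \<lfloor>t * 2 ^ k\<rfloor>) \<le> t * 2 ^ k" for k :: nat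
      using assms(1) by (auto simp: le_floor_iff)
    show "\<forall>\<^sub>F k in sequentially. t - (1/2) ^ k \<le> ?n k"
    proof (rule always_eventually, rule allI)
      fix k
      have "(t * 2 ^ k - 1) * (1/2) ^ k \<le> ?n k" using b(1)[of k] by (rule mult_right_mono) simp
      moreover have "(2::real) ^ k * (1/2) ^ k = 1" by (simp flip: power_mult_distrib)
      ultimately show "t - (1/2) ^ k \<le> ?n k" by (simp add: left_diff_distrib mult.assoc)
    qed
    show "\<forall>\<^sub>F k in sequentially. ?n k \<le> t"
      using b(2) by (auto intro!: always_eventually simp: field_simps)
    have "(\<lambda>k. t - (1/2) ^ k) \<longlonglongrightarrow> t - 0"
      by (intro tendsto_diff tendsto_const LIMSEQ_realpow_zero) auto
    then show "(\<lambda>k. t - (1/2) ^ k) \<longlonglongrightarrow> t" by simp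
  qed auto
  show ?thesis
  proof (rule LIMSEQ_le)
    show "(\<lambda>k. N (Tk k t x - x - ?n k *\<^sub>R A x)) \<longlonglongrightarrow> N (T t x - x - t *\<^sub>R A x)"
      by (intro tendsto_N tendsto_diff T_tendsto tendsto_scaleR n tendsto_const assms)
    show "(\<lambda>k. ?n k * (2 * N (A x - y) + ?n k * N (A y))) \<longlonglongrightarrow> t * (2 * N (A x - y) + t * N (A y))"
      by (intro tendsto_mult tendsto_add n tendsto_const)
    show "\<exists>K. \<forall>k\<ge>K. N (Tk k t x - x - ?n k *\<^sub>R A x) \<le> ?n k * (2 * N (A x - y) + ?n k * N (A y))"
      using J_pow_taylor[OF _ assms(2,3)] by (simp add: Tk_def)
  qed
qed

lemma T_little_o:
  assumes x: "x \<in> D" and e: "e > 0"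
  obtains d where "d > 0" "\<And>t. 0 \<le> t \<Longrightarrow> t < d \<Longrightarrow> N (T t x - x - t *\<^sub>R A x) \<le> t * e"
proof -
  obtain y where y: "y \<in> D" "N (A x - y) < e / 4" using dense_N[OF dense, of "e/4"] e by auto
  (* the 1 keeps the denominator positive when A y = 0 *)
  define d where "d = e / (2 * (N (A y) + 1))"
  have p: "N (A y) + 1 > 0" using N_nonneg[of "A y"] by linarith
  have "d > 0" using p e by (simp add: d_def)
  moreover have "N (T t x - x - t *\<^sub>R A x) \<le> t * e" if t: "0 \<le> t" "t < d" for t
  proof -
    have "t * N (A y) \<le> d * (N (A y) + 1)" using t N_nonneg[of "A y"] by (intro mult_mono) auto
    also have "\<dots> = e / 2" using p by (simp add: d_def del: distrib_left_numeral)
    finally have "t * (2 * N (A x - y) + t * N (A y)) \<le> t * e"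
      using y(2) t by (intro mult_left_mono) auto
    then show ?thesis using T_taylor[OF t(1) x y(1)] by linarith
  qed
  ultimately show ?thesis using that by blast
qed

lemma T_right_derivative:
  assumes "x \<in> D"
  shows "((\<lambda>h. (T h x - x) /\<^sub>R h) \<longlongrightarrow> A x) (at_right 0)"
  unfolding tendsto_iff_N
proof (rule tendstoI)
  fix e :: real assume e: "e > 0"
  obtain d where d: "d > 0" "\<And>t. 0 \<le> t \<Longrightarrow> t < d \<Longrightarrow> N (T t x - x - t *\<^sub>R A x) \<le> t * (e/2)"
    using T_little_o[OF assms, of "e/2"] e by auto
  have "dist (N ((T h x - x) /\<^sub>R h - A x)) 0 < e" if h: "0 < h" "h < d" for h
  proof -
    have "(T h x - x) /\<^sub>R h - A x = inverse h *\<^sub>R (T h x - x - h *\<^sub>R A x)"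
      using h by (simp add: algebra_simps)
    then have "N ((T h x - x) /\<^sub>R h - A x) = inverse h * N (T h x - x - h *\<^sub>R A x)"
      using h by (simp add: N_scale)
    also have "\<dots> \<le> inverse h * (h * (e/2))" using d(2)[of h] h by (intro mult_left_mono) auto
    also have "\<dots> < e" using h e by simp
    finally show ?thesis using N_nonneg by simp
  qed
  then show "\<forall>\<^sub>F h in at_right 0. dist (N ((T h x - x) /\<^sub>R h - A x)) 0 < e"
    unfolding eventually_at_right_field using d(1) by blast
qed

lemma T_Lipschitz:
  assumes "t \<ge> 0" "x \<in> D"
  shows "N (T t x - x) \<le> t * N (A x)"
proof -
  have "N (Tk k t x - x) \<le> t * N (A x)" for k
  proof -
    have "real (nat \<lfloor>t * 2 ^ k\<rfloor>) \<le> t * 2 ^ k" using assms(1) by simp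
    then have "real (nat \<lfloor>t * 2 ^ k\<rfloor>) * (1/2) ^ k \<le> t"  by (simp add: field_simps)
    then have "real (nat \<lfloor>t * 2 ^ k\<rfloor>) * (1/2) ^ k * N (A x) \<le> t * N (A x)"
      using N_nonneg by (rule mult_right_mono)
    then show ?thesis
      using J_pow_Lipschitz[OF _ assms(2), of "(1/2)^k" "nat \<lfloor>t * 2 ^ k\<rfloor>"] by (simp add: Tk_def)
  qed
  then show ?thesis
    by (intro LIMSEQ_le_const2[OF tendsto_N[OF tendsto_diff[OF T_tendsto tendsto_const]]])
      (use assms in auto)
qed

lemma T_strongly_continuous: "((\<lambda>t. T t x) \<longlongrightarrow> x) (at_right 0)"
  unfolding tendsto_iff_N
proof (rule tendstoI)
  fix e :: real assume e: "e > 0"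
  obtain y where y: "y \<in> D" "N (x - y) < e / 4" using dense_N[OF dense, of "e/4"] e by auto
  define d where "d = e / (4 * (N (A y) + 1))"
  have p: "N (A y) + 1 > 0" using N_nonneg[of "A y"] by linarith
  have d: "d > 0" using p e by (simp add: d_def)
  have "dist (N (T t x - x)) 0 < e" if t: "0 < t" "t < d" for t
  proof -
    have "N (T t x - x) \<le> N (T t x - T t y) + N (T t y - x)" by (rule N_triangle_diff)
    also have "N (T t y - x) \<le> N (T t y - y) + N (y - x)" by (rule N_triangle_diff)
    also have "N (T t x - T t y) \<le> N (x - y)" using T_contraction[of t "x - y"] T_diff[of t] t by simp
    also have "N (T t y - y) \<le> t * N (A y)" using T_Lipschitz y t by simp
    also have "t * N (A y) \<le> d * (N (A y) + 1)" using t N_nonneg[of "A y"] by (intro mult_mono) auto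
    also have "\<dots> = e / 4" using p by (simp add: d_def del: distrib_left_numeral)
    finally show ?thesis using y(2) e N_nonneg[of "T t x - x"] N_minus_commute[of x y] by simp
  qed
  then show "\<forall>\<^sub>F t in at_right 0. dist (N (T t x - x)) 0 < e"
    unfolding eventually_at_right_field using d by blast
qed

theorem C0_semigroup_T: "C0_semigroup T"
  unfolding C0_semigroup_def
  using T_bounded_linear T_zero T_semigroup T_strongly_continuous by blast

text \<open>Contractivity makes the generator dissipative; this is what rules out a generator larger than $A$.\<close>

lemma generator_dissipative:
  assumes "((\<lambda>h. (T h x - x) /\<^sub>R h) \<longlongrightarrow> l) (at_right 0)"
  shows "ip l x \<le> 0"
proof -
  have "ip ((T h x - x) /\<^sub>R h) x \<le> 0" if "h > 0" for h
  proof -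
    have "ip (T h x) x \<le> N (T h x) * N x" by (rule ip_Cauchy_Schwarz)
    also have "\<dots> \<le> N x * N x" using T_contraction[of h x] that N_nonneg by (simp add: mult_right_mono)
    also have "\<dots> = ip x x" using N_square by (simp add: power2_eq_square)
    finally show ?thesis using that by (simp add: ip_scale ip_diff mult_le_0_iff)
  qed
  then have bd: "ip l x \<le> N (l - (T h x - x) /\<^sub>R h) * N x" if "h > 0" for h
    using ip_Cauchy_Schwarz[of "l - (T h x - x) /\<^sub>R h" x] that by (simp add: ip_diff) (smt (verit))
  have "((\<lambda>h. N (l - (T h x - x) /\<^sub>R h) * N x) \<longlongrightarrow> 0) (at_right 0)"
    using assms unfolding tendsto_iff_N N_minus_commute[of l] by (rule tendsto_mult_left_zero)
  then show ?thesis
    by (rule tendsto_lowerbound) (auto simp: eventually_at_right_field intro!: exI[of _ 1] bd)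
qed

text \<open>If the difference quotients at $x$ converge to $l$, solve $y-Ay=x-l$ in the domain.  Then $w=x-y$ is in the
domain of the generator with value $w$, and dissipativity forces $w=0$.\<close>

theorem generates_T: "generates D A T"
  unfolding generates_def
proof (intro conjI ballI)
  have "x \<in> D" if l: "((\<lambda>h. (T h x - x) /\<^sub>R h) \<longlongrightarrow> l) (at_right 0)" for x l
  proof -
    obtain y where y: "y \<in> D" "y - 1 *\<^sub>R A y = x - l" using surj[of 1 "x - l"] by auto
    have "((\<lambda>h. (T h x - x) /\<^sub>R h - (T h y - y) /\<^sub>R h) \<longlongrightarrow> l - A y) (at_right 0)"
      by (intro tendsto_diff l T_right_derivative y)
    then have "((\<lambda>h. (T h (x - y) - (x - y)) /\<^sub>R h) \<longlongrightarrow> l - A y) (at_right 0)"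
      by (rule Lim_transform_eventually)
        (auto simp: eventually_at_right_field T_diff algebra_simps intro!: exI[of _ 1])
    moreover have "l - A y = x - y" using y(2) by (simp add: algebra_simps)
    ultimately have "ip (x - y) (x - y) \<le> 0" using generator_dissipative by metis
    then have "N (x - y) = 0" using ip_nonneg[of "x - y"] by (simp add: N_eq)
    then show ?thesis using y(1) by (simp add: N_eq_0)
  qed
  then show "D = {x. \<exists>l. ((\<lambda>h. (T h x - x) /\<^sub>R h) \<longlongrightarrow> l) (at_right 0)}"
    using T_right_derivative by blast
qed (rule T_right_derivative)

lemma T_continuous: "continuous_on {0..} (\<lambda>t. T t x)"
  unfolding continuous_on_iff
proof (intro ballI allI impI)
  fix t e :: real assume t: "t \<in> {0..}" and e: "0 < e"
  have "\<forall>\<^sub>F h in at_right 0. N (T h x - x) < e * c"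
    using T_strongly_continuous[of x] unfolding tendsto_iff_N
    by (rule order_tendstoD) (use e c_pos in simp)
  then obtain d where d: "d > 0" "\<And>h. 0 < h \<Longrightarrow> h < d \<Longrightarrow> N (T h x - x) < e * c"
    unfolding eventually_at_right_field by blast
  have near: "dist (T b x) (T a x) < e" if ab: "0 \<le> a" "a \<le> b" "b - a < d" for a b
  proof (cases "a = b")
    case False
    have "T b x - T a x = T a (T (b - a) x - x)"
      using T_semigroup[of a "b - a" x] T_diff[of a] ab by simp
    then have "N (T b x - T a x) \<le> N (T (b - a) x - x)" using T_contraction ab by simp
    also have "\<dots> < e * c" using d(2)[of "b - a"] ab False by simp
    finally have "N (T b x - T a x) / c < e" using c_pos by (simp add: field_simps)
    then show ?thesis using norm_le_N[of "T b x - T a x"] by (simp add: dist_norm)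
  qed (use e in simp)
  show "\<exists>d>0. \<forall>s\<in>{0..}. dist s t < d \<longrightarrow> dist (T s x) (T t x) < e"
  proof (intro exI conjI ballI impI)
    fix s assume "s \<in> {0..}" "dist s t < d"
    then show "dist (T s x) (T t x) < e"
      using near[of s t] near[of t s] t by (cases "s \<le> t") (auto simp: dist_real_def dist_commute)
  qed (rule d)
qed

lemma T_commutes:
  assumes "t \<ge> 0" "x \<in> D"
  shows T_in_D: "T t x \<in> D" and A_T: "A (T t x) = T t (A x)"
proof -
  have "((\<lambda>h. T t ((T h x - x) /\<^sub>R h)) \<longlongrightarrow> T t (A x)) (at_right 0)"
    by (rule bounded_linear.tendsto[OF T_bounded_linear[OF assms(1)] T_right_derivative[OF assms(2)]])
  then have lim: "((\<lambda>h. (T h (T t x) - T t x) /\<^sub>R h) \<longlongrightarrow> T t (A x)) (at_right 0)"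
  proof (rule Lim_transform_eventually)
    have "T t ((T h x - x) /\<^sub>R h) = (T h (T t x) - T t x) /\<^sub>R h" if "h > 0" for h
      using that assms(1) T_semigroup[of t h x] T_semigroup[of h t x]
      by (simp add: T_scale T_diff add.commute)
    then show "\<forall>\<^sub>F h in at_right 0. T t ((T h x - x) /\<^sub>R h) = (T h (T t x) - T t x) /\<^sub>R h"
      unfolding eventually_at_right_field by (intro exI[of _ 1]) auto
  qed
  then show D: "T t x \<in> D" using generates_T unfolding generates_def by blast
  show "A (T t x) = T t (A x)"
    by (rule tendsto_unique[OF _ T_right_derivative[OF D] lim]) simp
qed

lemma T_has_vector_derivative:
  assumes t: "t \<ge> 0" and x: "x \<in> D"
  shows "((\<lambda>s. T s x) has_vector_derivative T t (A x)) (at t within {0..})"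
  unfolding has_vector_derivative_def has_derivative_within_alt
proof (intro conjI allI impI)
  show "bounded_linear (\<lambda>r. r *\<^sub>R T t (A x))" by (rule bounded_linear_scaleR_left)
  fix e :: real assume e: "e > 0"
  (* half for the Taylor remainder, half for the change of the derivative; c converts N into the norm *)
  define e' where "e' = e * c / 2"
  have e': "e' > 0" using e c_pos by (simp add: e'_def)
  obtain d1 where d1: "d1 > 0" "\<And>h. 0 \<le> h \<Longrightarrow> h < d1 \<Longrightarrow> N (T h x - x - h *\<^sub>R A x) \<le> h * e'"
    using T_little_o[OF x e'] by blast
  have "((\<lambda>s. T s (A x)) \<longlongrightarrow> T t (A x)) (at t within {0..})"
    using T_continuous[of "A x"] t by (simp add: continuous_on)
  then have "\<forall>\<^sub>F s in at t within {0..}. N (T s (A x) - T t (A x)) < e'"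
    unfolding tendsto_iff_N by (rule order_tendstoD) (rule e')
  then obtain d2 where d2: "d2 > 0"
    "\<And>s. s \<ge> 0 \<Longrightarrow> s \<noteq> t \<Longrightarrow> dist s t < d2 \<Longrightarrow> N (T s (A x) - T t (A x)) < e'"
    unfolding eventually_at by auto
  have taylor: "N (T b x - T a x - (b - a) *\<^sub>R T a (A x)) \<le> (b - a) * e'"
    if "0 \<le> a" "a \<le> b" "b - a < d1" for a b
  proof -
    have "T b x - T a x - (b - a) *\<^sub>R T a (A x) = T a (T (b - a) x - x - (b - a) *\<^sub>R A x)"
      using T_semigroup[of a "b - a" x] that by (simp add: T_diff T_scale)
    then show ?thesis
      using T_contraction[OF that(1), of "T (b - a) x - x - (b - a) *\<^sub>R A x"] d1(2)[of "b - a"] that by simp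
  qed
  show "\<exists>d>0. \<forall>s\<in>{0..}. norm (s - t) < d \<longrightarrow>
      norm (T s x - T t x - (s - t) *\<^sub>R T t (A x)) \<le> e * norm (s - t)"
  proof (intro exI[of _ "min d1 d2"] conjI ballI impI)
    fix s assume s: "s \<in> {0..}" "norm (s - t) < min d1 d2"
    have "N (T s x - T t x - (s - t) *\<^sub>R T t (A x)) \<le> \<bar>s - t\<bar> * (2 * e')"
    proof (cases "t \<le> s")
      case True
      then have "N (T s x - T t x - (s - t) *\<^sub>R T t (A x)) \<le> (s - t) * e'"
        using taylor[of t s] t s by simp
      also have "\<dots> \<le> (s - t) * (2 * e')" using True e' by (intro mult_left_mono) auto
      finally show ?thesis using True by simp
    next
      case False
      have eq: "T s x - T t x - (s - t) *\<^sub>R T t (A x)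
          = - (T t x - T s x - (t - s) *\<^sub>R T s (A x)) + (t - s) *\<^sub>R (T t (A x) - T s (A x))"
        by (simp add: algebra_simps)
      have "N (T s x - T t x - (s - t) *\<^sub>R T t (A x))
          \<le> N (T t x - T s x - (t - s) *\<^sub>R T s (A x)) + (t - s) * N (T t (A x) - T s (A x))"
        unfolding eq using N_triangle[of "- (T t x - T s x - (t - s) *\<^sub>R T s (A x))"] False
        by (metis N_minus N_scale abs_of_nonneg diff_ge_0_iff_ge linear)
      also have "\<dots> \<le> (t - s) * e' + (t - s) * e'"
        using taylor[of s t] d2(2)[of s] s False N_minus_commute[of "T t (A x)" "T s (A x)"]
        by (intro add_mono mult_left_mono) (auto simp: dist_real_def)
      finally show ?thesis using False by (simp add: mult_ac)
    qed
    then have "N (T s x - T t x - (s - t) *\<^sub>R T t (A x)) / c \<le> e * norm (s - t)"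
      using c_pos by (simp add: e'_def field_simps)
    then show "norm (T s x - T t x - (s - t) *\<^sub>R T t (A x)) \<le> e * norm (s - t)"
      using norm_le_N order_trans by blast
  qed (use d1 d2 in auto)
qed

lemma integral_has_vector_derivative_ray:
  fixes u :: "real \<Rightarrow> 'a"
  assumes u: "continuous_on {0..} u" and t: "t \<ge> 0"
  shows "((\<lambda>s. integral {0..s} u) has_vector_derivative u t) (at t within {0..})"
proof -
  have "((\<lambda>s. integral {0..s} u) has_vector_derivative u t) (at t within {0..t + 1})"
    by (rule integral_has_vector_derivative) (use t in \<open>auto intro: continuous_on_subset[OF u]\<close>)
  moreover have "at t within {0..t + 1} = at t within {0..}"
    by (rule at_within_nhd[of _ "{t - 1<..<t + 1}"]) (use t in auto)
  ultimately show ?thesis by simp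
qed

lemma right_difference_quotient:
  fixes F :: "real \<Rightarrow> 'a"
  assumes "(F has_vector_derivative v) (at t within {0..})" "t \<ge> 0"
  shows "((\<lambda>h. (F (t + h) - F t) /\<^sub>R h) \<longlongrightarrow> v) (at_right 0)"
proof (rule tendstoI)
  fix e :: real assume e: "e > 0"
  then obtain d where d: "d > 0" "\<And>s. s \<in> {0..} \<Longrightarrow> norm (s - t) < d \<Longrightarrow>
      norm (F s - F t - (s - t) *\<^sub>R v) \<le> e / 2 * norm (s - t)"
    using assms(1) unfolding has_vector_derivative_def has_derivative_within_alt
    by (metis half_gt_zero)
  have "dist ((F (t + h) - F t) /\<^sub>R h) v < e" if h: "0 < h" "h < d" for h
  proof -
    have "(F (t + h) - F t) /\<^sub>R h - v = inverse h *\<^sub>R (F (t + h) - F t - h *\<^sub>R v)"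
      using h by (simp add: algebra_simps)
    then have "norm ((F (t + h) - F t) /\<^sub>R h - v) = inverse h * norm (F (t + h) - F t - h *\<^sub>R v)"
      using h by simp
    also have "\<dots> \<le> inverse h * (e / 2 * h)" using d(2)[of "t + h"] h assms(2) by (intro mult_left_mono) auto
    also have "\<dots> < e" using h e by simp
    finally show ?thesis by (simp add: dist_norm)
  qed
  then show "\<forall>\<^sub>F h in at_right 0. dist ((F (t + h) - F t) /\<^sub>R h) v < e"
    unfolding eventually_at_right_field using d(1) by blast
qed

text \<open>With $F(t)=\int_0^t T(s)x\,ds$ the semigroup law gives $T(h)F(t)-F(t)=(F(t+h)-F(t))-F(h)$, so the
difference quotients of the semigroup at $F(t)$ converge to $T(t)x-x$.\<close>

theorem mild_solution_T: "mild_solution D A x (\<lambda>t. T t x)"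
  unfolding mild_solution_def
proof (intro conjI allI impI)
  show "continuous_on {0..} (\<lambda>t. T t x)" by (rule T_continuous)
  fix t :: real assume t: "t \<ge> 0"
  define F where "F = (\<lambda>s. integral {0..s} (\<lambda>s. T s x))"
  have int: "(\<lambda>s. T s x) integrable_on {a..b}" if "0 \<le> a" for a b
    by (rule integrable_continuous_real, rule continuous_on_subset[OF T_continuous]) (use that in auto)
  have shift: "T h (F t) = F (t + h) - F h" if h: "h > 0" for h
  proof -
    have "T h (F t) = integral {0..t} (T h \<circ> (\<lambda>s. T s x))"
      unfolding F_def using integral_linear[OF int[of 0 t] T_bounded_linear[of h]] h by simp
    also have "\<dots> = integral {0..t} ((\<lambda>s. T s x) \<circ> (+) h)"
      by (rule integral_cong) (use h T_semigroup[of h _ x] in auto)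
    also have "\<dots> = integral {0 + h..t + h} (\<lambda>s. T s x)"
      by (rule integral_shift_Icc_real)
    also have "\<dots> = F (t + h) - F h"
      unfolding F_def using Henstock_Kurzweil_Integration.integral_combine[OF _ _ int[of 0 "t + h"], of h] h t
      by (simp add: eq_diff_eq add.commute)
    finally show ?thesis .
  qed
  have "((\<lambda>h. (F (t + h) - F t) /\<^sub>R h - (F (0 + h) - F 0) /\<^sub>R h) \<longlongrightarrow> T t x - T 0 x) (at_right 0)"
    unfolding F_def
    by (intro tendsto_diff right_difference_quotient integral_has_vector_derivative_ray T_continuous t) simp_all
  then have "((\<lambda>h. (F (t + h) - F t) /\<^sub>R h - (F (0 + h) - F 0) /\<^sub>R h) \<longlongrightarrow> T t x - x) (at_right 0)"
    by (simp only: T_zero)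
  then have lim: "((\<lambda>h. (T h (F t) - F t) /\<^sub>R h) \<longlongrightarrow> T t x - x) (at_right 0)"
  proof (rule Lim_transform_eventually)
    have "F 0 = 0" by (simp add: F_def)
    then have "(F (t + h) - F t) /\<^sub>R h - (F (0 + h) - F 0) /\<^sub>R h = (T h (F t) - F t) /\<^sub>R h" if "h > 0" for h
      by (simp add: shift[OF that] scaleR_diff_right algebra_simps)
    then show "\<forall>\<^sub>F h in at_right 0. (F (t + h) - F t) /\<^sub>R h - (F (0 + h) - F 0) /\<^sub>R h = (T h (F t) - F t) /\<^sub>R h"
      unfolding eventually_at_right_field by (intro exI[of _ 1]) auto
  qed
  then have D: "F t \<in> D" using generates_T unfolding generates_def by blast
  have "A (F t) = T t x - x"
    by (rule tendsto_unique[OF _ T_right_derivative[OF D] lim]) simp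
  moreover have "((\<lambda>s. T s x) has_integral F t) {0..t}"
    unfolding F_def using int[of 0 t] by (simp add: integrable_integral)
  ultimately show "\<exists>J. ((\<lambda>s. T s x) has_integral J) {0..t} \<and> J \<in> D \<and> T t x = x + A J"
    using D by (intro exI[of _ "F t"]) simp
qed

lemma ip_bounded_bilinear: "bounded_bilinear ip"
proof
  show "\<exists>K. \<forall>a b. norm (ip a b) \<le> norm a * norm b * K"
  proof (intro exI allI)
    fix a b
    have "ip a b \<le> N a * N b" "- ip a b \<le> N a * N b"
      using ip_Cauchy_Schwarz[of a b] ip_Cauchy_Schwarz[of "- a" b] by (auto simp: ip_minus N_minus)
    then have "norm (ip a b) \<le> N a * N b" by simp
    also have "\<dots> \<le> (C * norm a) * (C * norm b)" by (intro mult_mono N_upper N_nonneg C_nonneg)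
    finally show "norm (ip a b) \<le> norm a * norm b * (C * C)" by (simp add: mult_ac)
  qed
qed (auto simp: ip_add ip_add_right ip_scale ip_scale_right)

text \<open>The difference $v$ of two mild solutions satisfies $v=AK$ for $K(t)=\int_0^t v$, hence $K'=AK$ and $K(0)=0$;
dissipativity makes the energy of $K$ nonincreasing.\<close>

theorem mild_solution_unique:
  assumes u: "mild_solution D A x u" and w: "mild_solution D A x w" and t: "t \<ge> 0"
  shows "u t = w t"
proof -
  define v where "v = (\<lambda>s. u s - w s)"
  define K where "K = (\<lambda>s. integral {0..s} v)"
  have v: "continuous_on {0..} v"
    using u w unfolding v_def mild_solution_def by (intro continuous_intros) auto
  have K: "K s \<in> D \<and> v s = A (K s)" if "s \<ge> 0" for s
  proof -
    obtain J1 J2 where J: "(u has_integral J1) {0..s}" "J1 \<in> D" "u s = x + A J1"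
        "(w has_integral J2) {0..s}" "J2 \<in> D" "w s = x + A J2"
      using u w \<open>s \<ge> 0\<close> unfolding mild_solution_def by blast
    have "K s = J1 - J2"
      unfolding K_def v_def using has_integral_diff[OF J(1,4)] by (rule integral_unique)
    then show ?thesis using J A_diff D_diff by (simp add: v_def)
  qed
  interpret ip: bounded_bilinear ip by (rule ip_bounded_bilinear)
  have der: "((\<lambda>s. ip (K s) (K s)) has_vector_derivative (ip (K s) (v s) + ip (v s) (K s))) (at s within {0..})"
    if "s \<ge> 0" for s
    unfolding K_def
    by (intro ip.has_vector_derivative integral_has_vector_derivative_ray v that)
  have "ip (K t) (K t) \<le> ip (K 0) (K 0)"
  proof (cases "t = 0")
    case False
    show ?thesis
    proof (rule DERIV_nonpos_imp_decreasing_open[of 0 t "\<lambda>s. ip (K s) (K s)"])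
      show "0 \<le> t" using t .
      show "continuous_on {0..t} (\<lambda>s. ip (K s) (K s))"
      proof (rule continuous_on_subset[of "{0..}"])
        show "continuous_on {0..} (\<lambda>s. ip (K s) (K s))"
          by (rule continuous_on_vector_derivative) (use der in auto)
      qed auto
      fix s assume s: "0 < s" "s < t"
      (* interior times have two-sided derivatives *)
      have "at s within {0..} = at s" by (rule at_within_interior) (use s in \<open>simp add: interior_real_atLeast\<close>)
      then have "((\<lambda>s. ip (K s) (K s)) has_real_derivative (ip (K s) (v s) + ip (v s) (K s))) (at s)"
        using der[of s] s by (simp add: has_real_derivative_iff_has_vector_derivative)
      moreover have "ip (K s) (v s) + ip (v s) (K s) \<le> 0"
        using K[of s] dissipative[of "K s"] s ip_sym[of "K s" "v s"] by simp
      ultimately show "\<exists>y. ((\<lambda>s. ip (K s) (K s)) has_real_derivative y) (at s) \<and> y \<le> 0" by blast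
    qed
  qed simp
  also have "\<dots> = 0" by (simp add: K_def)
  finally have "N (K t) = 0" using ip_nonneg[of "K t"] by (simp add: N_eq)
  then have "v t = 0" using K[OF t] A_zero by (simp add: N_eq_0)
  then show ?thesis by (simp add: v_def)
qed

theorem strong_solution_T:
  assumes x: "x \<in> D"
  shows "strong_solution D A x (\<lambda>t. T t x)"
    and "continuous_into_domain D A (\<lambda>t. T t x)"
    and "continuously_differentiable (\<lambda>t. T t x)"
proof -
  show "strong_solution D A x (\<lambda>t. T t x)"
    unfolding strong_solution_def
    using T_zero T_in_D[OF _ x] A_T[OF _ x] T_has_vector_derivative[OF _ x] by simp
  have "continuous_on {0..} (\<lambda>t. (T t x, T t (A x)))"
    by (intro continuous_on_Pair T_continuous)
  then have "continuous_on {0..} (\<lambda>t. (T t x, A (T t x)))"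
    by (rule continuous_on_eq) (simp add: A_T[OF _ x])
  then show "continuous_into_domain D A (\<lambda>t. T t x)"
    unfolding continuous_into_domain_def using T_in_D[OF _ x] by blast
  show "continuously_differentiable (\<lambda>t. T t x)"
    unfolding continuously_differentiable_def
    by (rule exI[of _ "\<lambda>t. T t (A x)"]) (simp add: T_has_vector_derivative x T_continuous)
qed

end

section \<open>Determinants of holomorphic matrices\<close>

lemma det_holomorphic:
  assumes "\<And>\<zeta>. B \<zeta> \<in> carrier_mat n n"
    and "\<And>i j. i < n \<Longrightarrow> j < n \<Longrightarrow> (\<lambda>\<zeta>. B \<zeta> $$ (i, j)) holomorphic_on S"
  shows "(\<lambda>\<zeta>. Determinant.det (B \<zeta>)) holomorphic_on S"
  unfolding det_def'[OF assms(1)]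
  by (intro holomorphic_intros assms(2)) (auto dest: permutes_in_image)

text \<open>Cramer's rule for a family of matrices, phrased with plain functions: \<open>d\<close> is the determinant and \<open>b\<close> the
adjugate.\<close>

lemma holomorphic_matrix_inverse:
  fixes a :: "complex \<Rightarrow> nat \<Rightarrow> nat \<Rightarrow> complex"
  assumes hol: "\<And>i j. i < n \<Longrightarrow> j < n \<Longrightarrow> (\<lambda>\<zeta>. a \<zeta> i j) holomorphic_on S"
  obtains d b where "d holomorphic_on S"
    and "\<And>i j. i < n \<Longrightarrow> j < n \<Longrightarrow> (\<lambda>\<zeta>. b \<zeta> i j) holomorphic_on S"
    and "\<And>\<zeta> i k. i < n \<Longrightarrow> k < n \<Longrightarrow> (\<Sum>j<n. a \<zeta> i j * b \<zeta> j k) = (if i = k then d \<zeta> else 0)"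
    and "\<And>\<zeta> i k. i < n \<Longrightarrow> k < n \<Longrightarrow> (\<Sum>j<n. b \<zeta> i j * a \<zeta> j k) = (if i = k then d \<zeta> else 0)"
    and "\<And>\<zeta>. d \<zeta> = 0 \<Longrightarrow> \<exists>x. (\<exists>i<n. x i \<noteq> 0) \<and> (\<forall>i<n. (\<Sum>j<n. a \<zeta> i j * x j) = 0)"
proof -
  let ?A = "\<lambda>\<zeta>. Matrix.mat n n (\<lambda>(i, j). a \<zeta> i j)"
  let ?d = "\<lambda>\<zeta>. Determinant.det (?A \<zeta>)" and ?b = "\<lambda>\<zeta> i j. adj_mat (?A \<zeta>) $$ (i, j)"
  have A: "?A \<zeta> \<in> carrier_mat n n" for \<zeta> by simp
  show ?thesis
  proof (rule that[of ?d ?b])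
    show "?d holomorphic_on S" by (rule det_holomorphic[where n = n]) (auto simp: hol)
    show "(\<lambda>\<zeta>. ?b \<zeta> i j) holomorphic_on S" if ij: "i < n" "j < n" for i j
    proof -
      have "(\<lambda>\<zeta>. Determinant.det (mat_delete (?A \<zeta>) j i)) holomorphic_on S"
      proof (rule det_holomorphic[where n = "n - 1"])
        show "mat_delete (?A \<zeta>) j i \<in> carrier_mat (n - 1) (n - 1)" for \<zeta>
          by (rule mat_delete_carrier[OF A])
        fix k l assume "k < n - 1" "l < n - 1"
        then show "(\<lambda>\<zeta>. mat_delete (?A \<zeta>) j i $$ (k, l)) holomorphic_on S"
          by (auto simp: mat_delete_def intro!: hol)
      qed
      then show ?thesis using ij by (auto simp: adj_mat_def cofactor_def intro!: holomorphic_intros)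
    qed
    show "(\<Sum>j<n. a \<zeta> i j * ?b \<zeta> j k) = (if i = k then ?d \<zeta> else 0)" if ik: "i < n" "k < n" for \<zeta> i k
    proof -
      have "(?A \<zeta> * adj_mat (?A \<zeta>)) $$ (i, k) = (\<Sum>j<n. a \<zeta> i j * ?b \<zeta> j k)"
        using ik adj_mat(1)[OF A, of \<zeta>] by (auto simp: scalar_prod_def lessThan_atLeast0 intro!: sum.cong)
      moreover have "(?A \<zeta> * adj_mat (?A \<zeta>)) $$ (i, k) = (if i = k then ?d \<zeta> else 0)"
        unfolding adj_mat(2)[OF A] using ik by (simp add: one_mat_def)
      ultimately show ?thesis by simp
    qed
    show "(\<Sum>j<n. ?b \<zeta> i j * a \<zeta> j k) = (if i = k then ?d \<zeta> else 0)" if ik: "i < n" "k < n" for \<zeta> i k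
    proof -
      have "(adj_mat (?A \<zeta>) * ?A \<zeta>) $$ (i, k) = (\<Sum>j<n. ?b \<zeta> i j * a \<zeta> j k)"
        using ik adj_mat(1)[OF A, of \<zeta>] by (auto simp: scalar_prod_def lessThan_atLeast0 intro!: sum.cong)
      moreover have "(adj_mat (?A \<zeta>) * ?A \<zeta>) $$ (i, k) = (if i = k then ?d \<zeta> else 0)"
        unfolding adj_mat(3)[OF A] using ik by (simp add: one_mat_def)
      ultimately show ?thesis by simp
    qed
    show "\<exists>x. (\<exists>i<n. x i \<noteq> 0) \<and> (\<forall>i<n. (\<Sum>j<n. a \<zeta> i j * x j) = 0)" if d0: "?d \<zeta> = 0" for \<zeta>
    proof -
      obtain w where w: "w \<in> carrier_vec n" "w \<noteq> 0\<^sub>v n" "?A \<zeta> *\<^sub>v w = 0\<^sub>v n"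
        using iffD1[OF det_0_iff_vec_prod_zero[OF A] d0] by auto
      have "(\<Sum>j<n. a \<zeta> i j * vec_index w j) = 0" if i: "i < n" for i
      proof -
        have "vec_index (?A \<zeta> *\<^sub>v w) i = (\<Sum>j<n. a \<zeta> i j * vec_index w j)"
          using i w(1) by (auto simp: scalar_prod_def lessThan_atLeast0 intro!: sum.cong)
        then show ?thesis using w(3) i by simp
      qed
      moreover have "\<exists>i<n. vec_index w i \<noteq> 0" using w(1,2) by (auto simp: Matrix.vec_eq_iff)
      ultimately show ?thesis by blast
    qed
  qed
qed

section \<open>Complex linear operators on the complexification\<close>

lemma norm_scaleC: "norm (scaleC z v) \<le> cmod z * norm (v :: 'a::real_inner \<times> 'a)"
proof -
  obtain x y where v: "v = (x, y)" by fastforce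
  have "(norm (Re z *\<^sub>R x - Im z *\<^sub>R y))\<^sup>2 + (norm (Re z *\<^sub>R y + Im z *\<^sub>R x))\<^sup>2
     = ((Re z)\<^sup>2 + (Im z)\<^sup>2) * ((norm x)\<^sup>2 + (norm y)\<^sup>2)"
    unfolding power2_norm_eq_inner inner_diff_left inner_diff_right inner_add_left inner_add_right
    by (simp add: inner_commute[of y x] power2_eq_square algebra_simps del: dot_square_norm)
  then show ?thesis
    by (simp add: v scaleC_def norm_Pair cmod_def real_sqrt_mult)
qed

lemma scaleC_add_right: "scaleC z (v + w) = scaleC z v + scaleC z w"
  and scaleC_add_left: "scaleC (z + z') v = scaleC z v + scaleC z' v"
  and scaleC_scaleC: "scaleC z (scaleC z' v) = scaleC (z * z') v"
  and scaleC_one: "scaleC 1 v = v" and scaleC_zero: "scaleC 0 v = 0"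
  and scaleC_scaleR: "scaleC (r *\<^sub>R z) v = r *\<^sub>R scaleC z v" "scaleC z (r *\<^sub>R v) = r *\<^sub>R scaleC z v"
  by (auto simp: scaleC_def algebra_simps prod_eq_iff)

lemma scaleC_of_real: "scaleC (of_real r) v = r *\<^sub>R v"
  by (simp add: scaleC_def prod_eq_iff)

interpretation scaleC: bounded_bilinear "scaleC :: complex \<Rightarrow> 'a::real_inner \<times> 'a \<Rightarrow> 'a \<times> 'a"
  by unfold_locales
    (auto simp: scaleC_add_right scaleC_add_left scaleC_scaleR intro!: exI[of _ 1] norm_scaleC)

text \<open>The complexification is a real normed space on which the complex scalars act by \<open>scaleC\<close>; complex
linearity is therefore stated as real linearity together with compatibility with \<open>scaleC\<close>.\<close>

definition clinear_op :: "('a::real_inner \<times> 'a \<Rightarrow> 'a \<times> 'a) \<Rightarrow> bool" where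
  "clinear_op f \<longleftrightarrow> bounded_linear f \<and> (\<forall>z v. f (scaleC z v) = scaleC z (f v))"

definition clinear_functional :: "('a::real_inner \<times> 'a \<Rightarrow> complex) \<Rightarrow> bool" where
  "clinear_functional f \<longleftrightarrow> bounded_linear f \<and> (\<forall>z v. f (scaleC z v) = z * f v)"

lemma bounded_linear_map_prod:
  assumes "bounded_linear (f::'a::real_normed_vector \<Rightarrow> 'b::real_normed_vector)"
  shows "bounded_linear (map_prod f f)"
proof -
  have "bounded_linear (\<lambda>v. (f (fst v), f (snd v)))"
    by (intro bounded_linear_Pair bounded_linear_compose[OF assms] bounded_linear_fst bounded_linear_snd)
  moreover have "map_prod f f = (\<lambda>v. (f (fst v), f (snd v)))" by auto
  ultimately show ?thesis by simp
qed

lemma clinear_op_map_prod: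
  assumes "bounded_linear f"
  shows "clinear_op (map_prod f f)"
proof -
  interpret bounded_linear f by fact
  show ?thesis
    unfolding clinear_op_def
    by (auto simp: bounded_linear_map_prod assms scaleC_def add diff scaleR)
qed

lemma clinear_functional_complexified:
  assumes "bounded_linear (f :: 'a::real_inner \<Rightarrow> real)"
  shows "clinear_functional (\<lambda>v. Complex (f (fst v)) (f (snd v)))"
proof -
  interpret bounded_linear f by fact
  have "bounded_linear (\<lambda>v. of_real (f (fst v)) + \<i> * of_real (f (snd v)) :: complex)"
    by (intro bounded_linear_add bounded_linear_const_mult
        bounded_linear_compose[OF bounded_linear_of_real] bounded_linear_compose[OF assms]
        bounded_linear_fst bounded_linear_snd)
  moreover have "(\<lambda>v. of_real (f (fst v)) + \<i> * of_real (f (snd v)) :: complex)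
      = (\<lambda>v. Complex (f (fst v)) (f (snd v)))"
    by (intro ext) (simp add: complex_eq_iff)
  ultimately show ?thesis
    unfolding clinear_functional_def
    by (auto simp: scaleC_def add diff scaleR complex_eq_iff)
qed

lemma clinear_functional_comp:
  "clinear_functional f \<Longrightarrow> clinear_op T \<Longrightarrow> clinear_functional (\<lambda>v. f (T v))"
  by (auto simp: clinear_functional_def clinear_op_def intro: bounded_linear_compose simp del: split_paired_All)

lemma clinear_op_comp: "clinear_op f \<Longrightarrow> clinear_op T \<Longrightarrow> clinear_op (\<lambda>v. f (T v))"
  by (auto simp: clinear_op_def intro: bounded_linear_compose simp del: split_paired_All)

lemma clinear_op_id: "clinear_op (\<lambda>v. v)"
  by (auto simp: clinear_op_def)

lemma clinear_op_funpow: "clinear_op f \<Longrightarrow> clinear_op (f ^^ n)"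
  by (induction n) (auto simp: clinear_op_id clinear_op_comp id_def o_def)

lemma clinear_functional_affine:
  assumes "clinear_functional f" "clinear_functional g"
  shows "clinear_functional (\<lambda>v. z * f v + g v)"
  using assms unfolding clinear_functional_def
  by (auto intro!: bounded_linear_add bounded_linear_const_mult simp: algebra_simps)

locale clinear_opL =
  fixes f :: "'a::real_inner \<times> 'a \<Rightarrow> 'a \<times> 'a"
  assumes clinear_op: "clinear_op f"
begin
sublocale bounded_linear f using clinear_op by (simp add: clinear_op_def)
lemma scaleC: "f (scaleC z v) = scaleC z (f v)" using clinear_op by (simp add: clinear_op_def del: split_paired_All)
end

locale clinear_functionalL =
  fixes f :: "'a::real_inner \<times> 'a \<Rightarrow> complex"
  assumes clinear_functional: "clinear_functional f"
begin
sublocale bounded_linear f using clinear_functional by (simp add: clinear_functional_def)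
lemma scaleC: "f (scaleC z v) = z * f v" using clinear_functional by (simp add: clinear_functional_def del: split_paired_All)
end

section \<open>Holomorphic Fredholm families\<close>

text \<open>For $|\zeta|<\rho$ the Neumann series $G(\zeta)=\sum_n\zeta^nE^n$ inverts $1-\zeta E$.\<close>

locale small_perturbation =
  fixes E :: "'a::{real_inner,banach} \<times> 'a \<Rightarrow> 'a \<times> 'a" and \<epsilon> \<rho> :: real
  assumes E: "clinear_op E" and E_bound: "norm (E v) \<le> \<epsilon> * norm v"
    and eps: "\<epsilon> \<ge> 0" and rho: "\<rho> > 0" and small: "\<rho> * \<epsilon> < 1"
begin

sublocale E: clinear_opL E by unfold_locales (rule E)

definition G :: "complex \<Rightarrow> 'a \<times> 'a \<Rightarrow> 'a \<times> 'a" where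
  "G \<zeta> v = (\<Sum>n. scaleC (\<zeta> ^ n) ((E ^^ n) v))"

lemma E_pow_bound: "norm ((E ^^ n) v) \<le> \<epsilon> ^ n * norm v"
proof (induction n)
  case (Suc n)
  have "norm ((E ^^ Suc n) v) \<le> \<epsilon> * norm ((E ^^ n) v)" using E_bound by simp
  also have "\<dots> \<le> \<epsilon> * (\<epsilon> ^ n * norm v)" using Suc eps by (rule mult_left_mono)
  finally show ?case by simp
qed simp

lemma ratio:
  assumes "\<zeta> \<in> ball 0 \<rho>"
  shows "0 \<le> cmod \<zeta> * \<epsilon>" "cmod \<zeta> * \<epsilon> < 1"
proof -
  have "cmod \<zeta> * \<epsilon> \<le> \<rho> * \<epsilon>" using assms eps by (intro mult_right_mono) auto
  then show "cmod \<zeta> * \<epsilon> < 1" using small by simp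
qed (use eps in simp)

lemma G_term_bound: "norm (scaleC (\<zeta> ^ n) ((E ^^ n) v)) \<le> (cmod \<zeta> * \<epsilon>) ^ n * norm v"
proof -
  have "norm (scaleC (\<zeta> ^ n) ((E ^^ n) v)) \<le> cmod \<zeta> ^ n * norm ((E ^^ n) v)"
    using norm_scaleC[of "\<zeta> ^ n"] by (simp add: norm_power)
  also have "\<dots> \<le> cmod \<zeta> ^ n * (\<epsilon> ^ n * norm v)" by (intro mult_left_mono E_pow_bound) simp
  finally show ?thesis by (simp add: power_mult_distrib)
qed

lemma summable_bound:
  assumes "\<zeta> \<in> ball 0 \<rho>"
  shows "summable (\<lambda>n. (cmod \<zeta> * \<epsilon>) ^ n * norm v)"
  using ratio[OF assms] by (intro summable_mult2 summable_geometric) auto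

lemma summable_G:
  assumes "\<zeta> \<in> ball 0 \<rho>"
  shows "summable (\<lambda>n. scaleC (\<zeta> ^ n) ((E ^^ n) v))"
  by (rule summable_comparison_test'[OF summable_bound[OF assms]]) (rule G_term_bound)

lemma G_scaleC: "\<zeta> \<in> ball 0 \<rho> \<Longrightarrow> G \<zeta> (scaleC z v) = scaleC z (G \<zeta> v)"
proof -
  assume z: "\<zeta> \<in> ball 0 \<rho>"
  have "(E ^^ n) (scaleC z v) = scaleC z ((E ^^ n) v)" for n
    using clinear_op_funpow[OF E, of n] by (simp add: clinear_op_def del: split_paired_All)
  then have "G \<zeta> (scaleC z v) = (\<Sum>n. scaleC z (scaleC (\<zeta> ^ n) ((E ^^ n) v)))"
    by (simp add: G_def scaleC_scaleC mult.commute)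
  also have "\<dots> = scaleC z (G \<zeta> v)" unfolding G_def
    by (rule bounded_linear.suminf[OF scaleC.bounded_linear_right summable_G[OF z], symmetric])
  finally show ?thesis .
qed

lemma G_clinear:
  assumes z: "\<zeta> \<in> ball 0 \<rho>"
  shows "clinear_op (G \<zeta>)"
  unfolding clinear_op_def
proof (intro conjI allI G_scaleC z)
  have lin: "linear (E ^^ n)" for n
    using clinear_op_funpow[OF E, of n] by (simp add: clinear_op_def bounded_linear.linear)
  show "bounded_linear (G \<zeta>)"
  proof (rule bounded_linear_intro)
    fix v w :: "'a \<times> 'a" and r :: real
    show "G \<zeta> (v + w) = G \<zeta> v + G \<zeta> w"
      unfolding G_def using suminf_add[OF summable_G[OF z] summable_G[OF z], of v w]
      by (simp add: linear_add[OF lin] scaleC_add_right)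
    show "G \<zeta> (r *\<^sub>R v) = r *\<^sub>R G \<zeta> v"
      using G_scaleC[OF z, of "of_real r" v] by (simp add: scaleC_of_real)
    have "norm (G \<zeta> v) \<le> (\<Sum>n. norm (scaleC (\<zeta> ^ n) ((E ^^ n) v)))"
      unfolding G_def
      by (intro summable_norm summable_comparison_test'[OF summable_bound[OF z, of v]])
        (simp add: G_term_bound)
    also have "\<dots> \<le> (\<Sum>n. (cmod \<zeta> * \<epsilon>) ^ n * norm v)"
      by (intro suminf_le G_term_bound summable_bound z summable_comparison_test'[OF summable_bound[OF z, of v]])
        (simp add: G_term_bound)
    also have "\<dots> = norm v * (1 / (1 - cmod \<zeta> * \<epsilon>))"
      using ratio[OF z] by (simp add: suminf_mult2[symmetric] summable_geometric suminf_geometric)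
    finally show "norm (G \<zeta> v) \<le> norm v * (1 / (1 - cmod \<zeta> * \<epsilon>))" .
  qed
qed

lemma G_unfold:
  assumes z: "\<zeta> \<in> ball 0 \<rho>"
  shows "G \<zeta> v = v + scaleC \<zeta> (G \<zeta> (E v))" "G \<zeta> (E v) = E (G \<zeta> v)"
proof -
  have t: "scaleC (\<zeta> ^ Suc n) ((E ^^ Suc n) v) = scaleC \<zeta> (scaleC (\<zeta> ^ n) ((E ^^ n) (E v)))" for n
    by (simp add: scaleC_scaleC funpow_swap1)
  have "G \<zeta> v = scaleC (\<zeta> ^ 0) ((E ^^ 0) v) + (\<Sum>n. scaleC (\<zeta> ^ Suc n) ((E ^^ Suc n) v))"
    unfolding G_def using suminf_split_head[OF summable_G[OF z, of v]] by simp
  also have "(\<Sum>n. scaleC (\<zeta> ^ Suc n) ((E ^^ Suc n) v)) = scaleC \<zeta> (G \<zeta> (E v))"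
    unfolding t G_def
    by (rule bounded_linear.suminf[OF scaleC.bounded_linear_right summable_G[OF z], symmetric])
  finally show "G \<zeta> v = v + scaleC \<zeta> (G \<zeta> (E v))" by (simp add: scaleC_one)
  have "E (G \<zeta> v) = (\<Sum>n. E (scaleC (\<zeta> ^ n) ((E ^^ n) v)))"
    unfolding G_def by (rule E.suminf[OF summable_G[OF z]])
  then show "G \<zeta> (E v) = E (G \<zeta> v)" by (simp add: G_def E.scaleC funpow_swap1)
qed

lemma G_right_inverse:
  assumes z: "\<zeta> \<in> ball 0 \<rho>"
  shows "G \<zeta> v - scaleC \<zeta> (E (G \<zeta> v)) = v"
  unfolding diff_eq_eq by (rule G_unfold(1)[OF z, of v, unfolded G_unfold(2)[OF z]])

lemma G_left_inverse:
  assumes z: "\<zeta> \<in> ball 0 \<rho>"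
  shows "G \<zeta> (v - scaleC \<zeta> (E v)) = v"
proof -
  interpret G: clinear_opL "G \<zeta>" by unfold_locales (rule G_clinear[OF z])
  show ?thesis unfolding G.diff G.scaleC diff_eq_eq by (rule G_unfold(1)[OF z])
qed

lemma G_holomorphic:
  assumes chi: "clinear_functional \<kappa>"
  shows "(\<lambda>\<zeta>. \<kappa> (G \<zeta> v)) holomorphic_on ball 0 \<rho>"
proof (rule power_series_holomorphic)
  interpret chi: clinear_functionalL \<kappa> by unfold_locales (rule chi)
  fix \<zeta> :: complex assume z: "\<zeta> \<in> ball 0 \<rho>"
  have "(\<lambda>n. \<kappa> (scaleC (\<zeta> ^ n) ((E ^^ n) v))) sums \<kappa> (G \<zeta> v)"
    unfolding G_def by (rule chi.sums[OF summable_sums[OF summable_G[OF z]]])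
  then show "(\<lambda>n. \<kappa> ((E ^^ n) v) * (\<zeta> - 0) ^ n) sums \<kappa> (G \<zeta> v)"
    by (simp add: chi.scaleC mult.commute)
qed

lemma G_shift:
  assumes "z \<in> ball 0 \<rho>" "\<zeta> \<in> ball 0 \<rho>"
  shows "G \<zeta> v = G z v + scaleC (\<zeta> - z) (G z (E (G \<zeta> v)))"
proof -
  interpret G: clinear_opL "G z" by unfold_locales (rule G_clinear[OF assms(1)])
  have 1: "G \<zeta> v = G z (G \<zeta> v - scaleC z (E (G \<zeta> v)))"
    by (rule G_left_inverse[OF assms(1), symmetric])
  have 2: "G \<zeta> v - scaleC z (E (G \<zeta> v)) = v + scaleC (\<zeta> - z) (E (G \<zeta> v))"
    using G_right_inverse[OF assms(2), of v] unfolding scaleC.diff_left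
    by (metis add_diff_eq diff_add_cancel)
  have "G \<zeta> v = G z (v + scaleC (\<zeta> - z) (E (G \<zeta> v)))"
    by (rule trans[OF 1 arg_cong[OF 2, of "G z"]])
  also have "\<dots> = G z v + scaleC (\<zeta> - z) (G z (E (G \<zeta> v)))"
    by (simp only: G.add G.scaleC)
  finally show ?thesis .
qed

text \<open>Iterating $G(\zeta)=G(z)+(\zeta-z)G(z)E\,G(\zeta)$ expands $G(\zeta)$ around $z$ with coefficients
$(G(z)E)^kG(z)$ and an exact remainder.\<close>

definition GE :: "complex \<Rightarrow> 'a \<times> 'a \<Rightarrow> 'a \<times> 'a" where
  "GE z v = G z (E v)"

lemma GE_clinear: "z \<in> ball 0 \<rho> \<Longrightarrow> clinear_op (GE z)"
  using clinear_op_comp[OF G_clinear E] by (simp add: GE_def[abs_def])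

lemma GE_pow_shift:
  assumes z: "z \<in> ball 0 \<rho>" and \<zeta>: "\<zeta> \<in> ball 0 \<rho>"
  shows "(GE z ^^ p) (G \<zeta> w) = (GE z ^^ p) (G z w) + scaleC (\<zeta> - z) ((GE z ^^ Suc p) (G \<zeta> w))"
proof -
  interpret H: clinear_opL "GE z ^^ p"
    by unfold_locales (rule clinear_op_funpow[OF GE_clinear[OF z]])
  have "(GE z ^^ p) (G \<zeta> w) = (GE z ^^ p) (G z w + scaleC (\<zeta> - z) (GE z (G \<zeta> w)))"
    using arg_cong[OF G_shift[OF z \<zeta>], of "GE z ^^ p"] by (simp only: GE_def[symmetric])
  then show ?thesis by (simp only: H.add H.scaleC funpow_Suc_right o_apply)
qed

text \<open>A functional that kills the first $p$ Taylor coefficients of $\zeta\mapsto G(\zeta)w$ at $z$ sees a zero of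
order $p$ there.  This cancels a pole of order $p$ of the resolvent.\<close>

lemma G_vanishing_order:
  fixes z \<zeta> :: complex and \<kappa> :: "'a \<times> 'a \<Rightarrow> complex"
  assumes z: "z \<in> ball 0 \<rho>" and \<zeta>: "\<zeta> \<in> ball 0 \<rho>" and chi: "clinear_functional \<kappa>"
  shows "(\<forall>k<p. \<kappa> ((GE z ^^ k) (G z w)) = 0) \<Longrightarrow>
    \<kappa> (G \<zeta> w) = (\<zeta> - z) ^ p * \<kappa> ((GE z ^^ p) (G \<zeta> w))"
proof (induction p)
  case 0
  show ?case by simp
next
  case (Suc p)
  interpret chi: clinear_functionalL \<kappa> by unfold_locales (rule chi)
  have IH: "\<kappa> (G \<zeta> w) = (\<zeta> - z) ^ p * \<kappa> ((GE z ^^ p) (G \<zeta> w))" using Suc by simp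
  have "\<kappa> ((GE z ^^ p) (G \<zeta> w)) = (\<zeta> - z) * \<kappa> ((GE z ^^ Suc p) (G \<zeta> w))"
    unfolding GE_pow_shift[OF z \<zeta>, of p] chi.add chi.scaleC using Suc.prems by simp
  then show ?case unfolding IH by (simp only: power_Suc2 mult.assoc)
qed

end

text \<open>The family $T(\zeta)=1-\zeta E-\sum_i f_i^\zeta(\cdot)\,v_i$ with functionals $f_i^\zeta=\zeta\varphi_i+\psi_i$
that depend affinely on $\zeta$.  Multiplication by $G(\zeta)$ turns the invertibility of $T(\zeta)$ into
that of the $n\times n$ matrix $\delta_{ij}-f_i^\zeta(G(\zeta)v_j)$.\<close>

locale fredholm_family = small_perturbation E \<epsilon> \<rho>
  for E :: "'a::{real_inner,banach} \<times> 'a \<Rightarrow> 'a \<times> 'a" and \<epsilon> \<rho> :: real +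
  fixes n :: nat and \<phi> \<psi> :: "nat \<Rightarrow> 'a \<times> 'a \<Rightarrow> complex" and v :: "nat \<Rightarrow> 'a \<times> 'a"
  assumes phi: "clinear_functional (\<phi> i)" and psi: "clinear_functional (\<psi> i)"
begin

definition f :: "complex \<Rightarrow> nat \<Rightarrow> 'a \<times> 'a \<Rightarrow> complex" where
  "f \<zeta> i x = \<zeta> * \<phi> i x + \<psi> i x"

definition T :: "complex \<Rightarrow> 'a \<times> 'a \<Rightarrow> 'a \<times> 'a" where
  "T \<zeta> x = x - scaleC \<zeta> (E x) - (\<Sum>i<n. scaleC (f \<zeta> i x) (v i))"

lemma f_clinear: "clinear_functional (f \<zeta> i)"
  unfolding f_def by (rule clinear_functional_affine[OF phi psi])

lemma f_G_holomorphic: "(\<lambda>\<zeta>. f \<zeta> i (G \<zeta> x)) holomorphic_on ball 0 \<rho>"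
  unfolding f_def by (intro holomorphic_intros G_holomorphic phi psi)

lemma f_sum: "f \<zeta> i (\<Sum>j<n. scaleC (c j) (w j)) = (\<Sum>j<n. c j * f \<zeta> i (w j))"
proof -
  interpret clinear_functionalL "f \<zeta> i" by unfold_locales (rule f_clinear)
  show ?thesis by (simp add: sum scaleC)
qed

lemma T_linear: "T \<zeta> (x - y) = T \<zeta> x - T \<zeta> y"
proof -
  have "f \<zeta> i (x - y) = f \<zeta> i x - f \<zeta> i y" for i
  proof -
    interpret clinear_functionalL "f \<zeta> i" by unfold_locales (rule f_clinear)
    show ?thesis by (rule diff)
  qed
  then show ?thesis
    by (simp add: T_def E.diff scaleC.diff_left scaleC.diff_right sum_subtractf)
qed

text \<open>If $T(\zeta)x=0$ then $x$ is determined by the numbers $f_i^\zeta(x)$, which form a vector in the kernel of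
  the matrix, and conversely.  When the determinant \<open>d\<close> is not zero, the adjugate \<open>b\<close> gives the solution in
  a form whose dependence on $\zeta$ is explicit.\<close>

lemma fredholm_determinant:
  obtains d :: "complex \<Rightarrow> complex" and b :: "complex \<Rightarrow> nat \<Rightarrow> nat \<Rightarrow> complex"
  where "d holomorphic_on ball 0 \<rho>"
    and "\<And>i j. i < n \<Longrightarrow> j < n \<Longrightarrow> (\<lambda>\<zeta>. b \<zeta> i j) holomorphic_on ball 0 \<rho>"
    and "\<And>\<zeta>. \<zeta> \<in> ball 0 \<rho> \<Longrightarrow> d \<zeta> = 0 \<Longrightarrow> \<exists>x. x \<noteq> 0 \<and> T \<zeta> x = 0"
    and "\<And>\<zeta> x. \<zeta> \<in> ball 0 \<rho> \<Longrightarrow> d \<zeta> \<noteq> 0 \<Longrightarrow> T \<zeta> x = 0 \<Longrightarrow> x = 0"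
    and "\<And>\<zeta> y. \<zeta> \<in> ball 0 \<rho> \<Longrightarrow> d \<zeta> \<noteq> 0 \<Longrightarrow>
      T \<zeta> (G \<zeta> y + (\<Sum>j<n. scaleC ((\<Sum>i<n. b \<zeta> j i * f \<zeta> i (G \<zeta> y)) / d \<zeta>) (G \<zeta> (v j)))) = y"
proof -
  define a where "a = (\<lambda>\<zeta> i j. (if i = j then 1 else 0) - f \<zeta> i (G \<zeta> (v j)))"
  have hol: "(\<lambda>\<zeta>. a \<zeta> i j) holomorphic_on ball 0 \<rho>" for i j
    unfolding a_def by (intro holomorphic_on_diff holomorphic_on_const f_G_holomorphic)
  have a_sum: "(\<Sum>j<n. a \<zeta> i j * x j) = x i - (\<Sum>j<n. x j * f \<zeta> i (G \<zeta> (v j)))" if "i < n" for \<zeta> i x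
  proof -
    have "(\<Sum>j<n. a \<zeta> i j * x j) = (\<Sum>j<n. (if i = j then x j else 0) - x j * f \<zeta> i (G \<zeta> (v j)))"
      by (intro sum.cong) (auto simp: a_def algebra_simps)
    then show ?thesis using that by (simp add: sum_subtractf)
  qed
  have G_sum: "G \<zeta> (\<Sum>j<n. scaleC (c j) (v j)) = (\<Sum>j<n. scaleC (c j) (G \<zeta> (v j)))"
    if "\<zeta> \<in> ball 0 \<rho>" for \<zeta> c
  proof -
    interpret G: clinear_opL "G \<zeta>" by unfold_locales (rule G_clinear[OF that])
    show ?thesis by (simp add: G.sum G.scaleC)
  qed
  show thesis
  proof (rule holomorphic_matrix_inverse[of n a "ball 0 \<rho>", OF hol])
    fix d :: "complex \<Rightarrow> complex" and b :: "complex \<Rightarrow> nat \<Rightarrow> nat \<Rightarrow> complex"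
    assume d: "d holomorphic_on ball 0 \<rho>"
      and b: "\<And>i j. i < n \<Longrightarrow> j < n \<Longrightarrow> (\<lambda>\<zeta>. b \<zeta> i j) holomorphic_on ball 0 \<rho>"
      and ab: "\<And>\<zeta> i k. i < n \<Longrightarrow> k < n \<Longrightarrow> (\<Sum>j<n. a \<zeta> i j * b \<zeta> j k) = (if i = k then d \<zeta> else 0)"
      and ba: "\<And>\<zeta> i k. i < n \<Longrightarrow> k < n \<Longrightarrow> (\<Sum>j<n. b \<zeta> i j * a \<zeta> j k) = (if i = k then d \<zeta> else 0)"
      and ker: "\<And>\<zeta>. d \<zeta> = 0 \<Longrightarrow> \<exists>x. (\<exists>i<n. x i \<noteq> 0) \<and> (\<forall>i<n. (\<Sum>j<n. a \<zeta> i j * x j) = 0)"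
    show thesis
  proof (rule that[OF d b])
    fix \<zeta> :: complex assume z: "\<zeta> \<in> ball 0 \<rho>"
    {
      assume "d \<zeta> = 0"
      then obtain c where c: "\<exists>i<n. c i \<noteq> 0" "\<And>i. i < n \<Longrightarrow> (\<Sum>j<n. a \<zeta> i j * c j) = 0"
        using ker by blast
      define x where "x = (\<Sum>j<n. scaleC (c j) (G \<zeta> (v j)))"
      have fx: "f \<zeta> i x = c i" if "i < n" for i
        using c(2)[OF that] a_sum[OF that, of \<zeta> c] by (simp add: x_def f_sum)
      interpret F: clinear_functionalL "f \<zeta> i" for i by unfold_locales (rule f_clinear)
      have "x \<noteq> 0" using c(1) fx F.zero by metis
      moreover have "T \<zeta> x = 0"
      proof -
        have "x - scaleC \<zeta> (E x) = (\<Sum>j<n. scaleC (c j) (v j))"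
          using G_right_inverse[OF z, of "\<Sum>j<n. scaleC (c j) (v j)"] by (simp add: G_sum[OF z] x_def)
        also have "\<dots> = (\<Sum>j<n. scaleC (f \<zeta> j x) (v j))" by (intro sum.cong) (auto simp: fx)
        finally show ?thesis by (simp add: T_def)
      qed
      ultimately show "\<exists>x. x \<noteq> 0 \<and> T \<zeta> x = 0" by blast
    }
    {
      fix x assume nz: "d \<zeta> \<noteq> 0" and x: "T \<zeta> x = 0"
      have "x - scaleC \<zeta> (E x) = (\<Sum>j<n. scaleC (f \<zeta> j x) (v j))" using x by (simp add: T_def)
      then have xe: "x = (\<Sum>j<n. scaleC (f \<zeta> j x) (G \<zeta> (v j)))"
        using G_left_inverse[OF z, of x] by (simp add: G_sum[OF z])
      have a0: "(\<Sum>j<n. a \<zeta> i j * f \<zeta> j x) = 0" if "i < n" for i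
        using a_sum[OF that, of \<zeta> "\<lambda>j. f \<zeta> j x"] f_sum[of \<zeta> i "\<lambda>j. f \<zeta> j x" "\<lambda>j. G \<zeta> (v j)"] xe by simp
      have "f \<zeta> i x = 0" if i: "i < n" for i
      proof -
        have "d \<zeta> * f \<zeta> i x = (\<Sum>k<n. (if i = k then d \<zeta> else 0) * f \<zeta> k x)"
          using i by (simp add: if_distrib[of "\<lambda>t. t * _"] cong: if_cong)
        also have "\<dots> = (\<Sum>k<n. (\<Sum>j<n. b \<zeta> i j * a \<zeta> j k) * f \<zeta> k x)"
          using i by (intro sum.cong) (auto simp: ba)
        also have "\<dots> = (\<Sum>j<n. b \<zeta> i j * (\<Sum>k<n. a \<zeta> j k * f \<zeta> k x))"
          unfolding sum_distrib_left sum_distrib_right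
          by (subst sum.swap) (simp add: mult.assoc)
        also have "\<dots> = 0" by (simp add: a0)
        finally show ?thesis using nz by simp
      qed
      then show "x = 0" using xe by (simp add: scaleC_zero)
    }
    {
      fix y assume nz: "d \<zeta> \<noteq> 0"
      define c where "c = (\<lambda>j. (\<Sum>i<n. b \<zeta> j i * f \<zeta> i (G \<zeta> y)) / d \<zeta>)"
      define x where "x = G \<zeta> y + (\<Sum>j<n. scaleC (c j) (G \<zeta> (v j)))"
      have Mc: "(\<Sum>j<n. a \<zeta> i j * c j) = f \<zeta> i (G \<zeta> y)" if i: "i < n" for i
      proof -
        have "(\<Sum>j<n. a \<zeta> i j * c j) = (\<Sum>j<n. \<Sum>k<n. a \<zeta> i j * b \<zeta> j k * f \<zeta> k (G \<zeta> y)) / d \<zeta>"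
          by (simp add: c_def sum_divide_distrib sum_distrib_left mult.assoc)
        also have "(\<Sum>j<n. \<Sum>k<n. a \<zeta> i j * b \<zeta> j k * f \<zeta> k (G \<zeta> y))
            = (\<Sum>k<n. (\<Sum>j<n. a \<zeta> i j * b \<zeta> j k) * f \<zeta> k (G \<zeta> y))"
          by (subst sum.swap) (simp add: sum_distrib_right)
        also have "\<dots> = (\<Sum>k<n. (if i = k then d \<zeta> else 0) * f \<zeta> k (G \<zeta> y))"
          using i by (intro sum.cong) (auto simp: ab)
        also have "\<dots> = d \<zeta> * f \<zeta> i (G \<zeta> y)"
          using i by (simp add: if_distrib[of "\<lambda>t. t * _"] cong: if_cong)
        finally show ?thesis using nz by simp
      qed
      have fx: "f \<zeta> i x = c i" if "i < n" for i
      proof -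
        interpret F: clinear_functionalL "f \<zeta> i" by unfold_locales (rule f_clinear)
        have "f \<zeta> i x = f \<zeta> i (G \<zeta> y) + (\<Sum>j<n. c j * f \<zeta> i (G \<zeta> (v j)))"
          by (simp add: x_def F.add f_sum)
        then show ?thesis using a_sum[OF that, of \<zeta> c] Mc[OF that] by simp
      qed
      have "x = G \<zeta> (y + (\<Sum>j<n. scaleC (c j) (v j)))"
      proof -
        interpret G: clinear_opL "G \<zeta>" by unfold_locales (rule G_clinear[OF z])
        show ?thesis by (simp add: x_def G.add G_sum[OF z])
      qed
      then have "x - scaleC \<zeta> (E x) = y + (\<Sum>j<n. scaleC (c j) (v j))"
        using G_right_inverse[OF z] by simp
      also have "(\<Sum>j<n. scaleC (c j) (v j)) = (\<Sum>j<n. scaleC (f \<zeta> j x) (v j))"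
        by (intro sum.cong) (auto simp: fx)
      finally show "T \<zeta> (G \<zeta> y + (\<Sum>j<n. scaleC ((\<Sum>i<n. b \<zeta> j i * f \<zeta> i (G \<zeta> y)) / d \<zeta>) (G \<zeta> (v j)))) = y"
        by (simp add: T_def x_def c_def)
    }
  qed
  qed
qed

end


section \<open>Discrete spectrum and Riesz projections\<close>

text \<open>A list of functionals and vectors makes sums of such operators a concatenation.\<close>

definition finite_rank :: "('a::real_normed_vector \<Rightarrow> 'b::real_normed_vector) \<Rightarrow> bool" where
  "finite_rank F \<longleftrightarrow> (\<exists>xs :: (('a \<Rightarrow> real) \<times> 'b) list. (\<forall>p\<in>set xs. bounded_linear (fst p)) \<and>
     (\<forall>x. F x = (\<Sum>p\<leftarrow>xs. fst p x *\<^sub>R snd p)))"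

lemma finite_rank_one: "bounded_linear f \<Longrightarrow> finite_rank (\<lambda>x. f x *\<^sub>R w)"
  unfolding finite_rank_def by (rule exI[of _ "[(f, w)]"]) simp

lemma finite_rank_zero: "finite_rank (\<lambda>x. 0)"
  unfolding finite_rank_def by (rule exI[of _ "[]"]) simp

lemma finite_rank_add:
  assumes "finite_rank F" "finite_rank H"
  shows "finite_rank (\<lambda>x. F x + H x)"
proof -
  obtain xs where "\<forall>p\<in>set xs. bounded_linear (fst p)" "\<And>x. F x = (\<Sum>p\<leftarrow>xs. fst p x *\<^sub>R snd p)"
    using assms(1) unfolding finite_rank_def by metis
  moreover obtain ys where "\<forall>p\<in>set ys. bounded_linear (fst p)" "\<And>x. H x = (\<Sum>p\<leftarrow>ys. fst p x *\<^sub>R snd p)"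
    using assms(2) unfolding finite_rank_def by metis
  ultimately show ?thesis unfolding finite_rank_def by (intro exI[of _ "xs @ ys"]) auto
qed

lemma finite_rank_sum:
  assumes "finite I" "\<And>i. i \<in> I \<Longrightarrow> finite_rank (F i)"
  shows "finite_rank (\<lambda>x. \<Sum>i\<in>I. F i x)"
  using assms by (induction I rule: finite_induct) (auto simp: finite_rank_zero finite_rank_add)

lemma finite_rank_compose_left:
  assumes "finite_rank F" "bounded_linear L"
  shows "finite_rank (\<lambda>x. L (F x))"
proof -
  interpret L: bounded_linear L by fact
  obtain xs where xs: "\<forall>p\<in>set xs. bounded_linear (fst p)" "\<And>x. F x = (\<Sum>p\<leftarrow>xs. fst p x *\<^sub>R snd p)"
    using assms unfolding finite_rank_def by metis
  have "L (\<Sum>p\<leftarrow>ys. fst p x *\<^sub>R snd p) = (\<Sum>p\<leftarrow>map (\<lambda>p. (fst p, L (snd p))) ys. fst p x *\<^sub>R snd p)"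
    for ys :: "(('a \<Rightarrow> real) \<times> 'b) list" and x
    by (induction ys) (auto simp: L.zero L.add L.scaleR)
  then show ?thesis
    unfolding finite_rank_def using xs
    by (intro exI[of _ "map (\<lambda>p. (fst p, L (snd p))) xs"]) auto
qed

lemma finite_rank_compose_right:
  assumes "finite_rank F" "bounded_linear L"
  shows "finite_rank (\<lambda>x. F (L x))"
proof -
  obtain xs where xs: "\<forall>p\<in>set xs. bounded_linear (fst p)" "\<And>x. F x = (\<Sum>p\<leftarrow>xs. fst p x *\<^sub>R snd p)"
    using assms unfolding finite_rank_def by metis
  have "(\<Sum>p\<leftarrow>ys. fst p (L x) *\<^sub>R snd p) = (\<Sum>p\<leftarrow>map (\<lambda>p. (\<lambda>x. fst p (L x), snd p)) ys. fst p x *\<^sub>R snd p)"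
    for ys :: "(('a \<Rightarrow> real) \<times> 'b) list" and x
    by (induction ys) auto
  moreover have "\<forall>p\<in>set xs. bounded_linear (\<lambda>x. fst p (L x))"
    using xs(1) bounded_linear_compose[OF _ assms(2)] by blast
  ultimately show ?thesis
    unfolding finite_rank_def using xs(2)
    by (intro exI[of _ "map (\<lambda>p. (\<lambda>x. fst p (L x), snd p)) xs"]) auto
qed

text \<open>Subtract from \<open>x\<close> its projection onto the finite dimensional span; the rest is orthogonal to \<open>B\<close>, hence to
\<open>x\<close> and to itself.\<close>

lemma in_span_if_orthogonal:
  fixes B :: "'a::real_inner set"
  assumes "finite B" and orth: "\<And>q. (\<And>b. b \<in> B \<Longrightarrow> inner q b = 0) \<Longrightarrow> inner q x = 0"
  shows "x \<in> span B"
proof -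
  obtain C where C: "finite C" "span C = span B" "pairwise Linear_Algebra.orthogonal C"
    using basis_orthogonal[OF assms(1)] by blast
  define s where "s = (\<Sum>c\<in>C. (inner c x / inner c c) *\<^sub>R c)"
  have s: "s \<in> span B" unfolding s_def C(2)[symmetric] by (intro span_sum span_scale span_base)
  have c0: "inner (x - s) c = 0" if c: "c \<in> C" for c
  proof -
    have "inner s c = (\<Sum>b\<in>C. (inner b x / inner b b) * inner b c)"
      by (simp add: s_def inner_sum_left)
    also have "\<dots> = (\<Sum>b\<in>C. if b = c then inner c x else 0)"
      by (intro sum.cong) (use C(3) c in \<open>auto simp: pairwise_def Linear_Algebra.orthogonal_def\<close>)
    also have "\<dots> = inner c x" using C(1) c by simp
    finally show ?thesis by (simp add: inner_diff_left inner_commute[of x c])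
  qed
  have span0: "inner (x - s) b = 0" if "b \<in> span C" for b
    using that by (induction rule: span_induct_alt) (auto simp: inner_add_right c0)
  have "inner (x - s) x = 0" by (rule orth) (auto intro!: span0 simp: C(2) span_base)
  moreover have "inner (x - s) s = 0" by (rule span0) (simp add: C(2) s)
  ultimately have "inner (x - s) (x - s) = 0" by (simp add: inner_diff_right)
  then show ?thesis using s by simp
qed

lemma Cauchy_circle_integral:
  assumes "h holomorphic_on ball z R" "0 < r" "r < R"
  shows "((\<lambda>t. of_real r * cis t * h (z + of_real r * cis t)) has_integral 0) {0..2 * pi}"
proof -
  have "(h has_contour_integral 0) (circlepath z r)"
    by (rule Cauchy_theorem_disc_simple[OF assms(1)]) (use assms in auto)
  then have "((\<lambda>t. h (z + of_real r * cis t) * of_real r * \<i> * cis t) has_integral 0) {0..2 * pi}"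
    unfolding circlepath_def by (subst (asm) has_contour_integral_part_circlepath_iff) auto
  from has_integral_mult_right[OF this, of "- \<i>"] show ?thesis
    by (simp add: mult_ac)
qed

text \<open>An operator $A$ whose domain is parametrised by an injective bounded operator $R$ with $AR=1+S$.  When $S$
has finite rank and $R$ is a norm limit of finite rank operators, $\zeta-A$ is turned by $R$ into a
Fredholm family: $(\zeta-A)R=-(1-\zeta R+S)$.\<close>

locale finite_rank_approximable_resolvent =
  fixes D :: "'a::{real_inner,banach} set" and A R S :: "'a \<Rightarrow> 'a" and z0 :: complex
  assumes R: "bounded_linear R" and inj_R: "inj R" and D_range: "D = range R"
    and A_R: "\<And>x. A (R x) = x + S x" and S: "finite_rank S"
    and approx: "\<And>e. e > 0 \<Longrightarrow> \<exists>E. bounded_linear E \<and> (\<forall>x. norm (E x) \<le> e * norm x) \<and>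
      finite_rank (\<lambda>x. R x - E x)"
    and z0: "\<not> eigenvalue D A z0"
begin

abbreviation RC :: "'a \<times> 'a \<Rightarrow> 'a \<times> 'a" where "RC \<equiv> map_prod R R"
abbreviation SC :: "'a \<times> 'a \<Rightarrow> 'a \<times> 'a" where "SC \<equiv> map_prod S S"

lemma RC_clinear: "clinear_op RC" by (rule clinear_op_map_prod[OF R])

lemma RC_bounded_linear: "bounded_linear RC" by (rule bounded_linear_map_prod[OF R])

lemma inj_RC: "inj RC" using inj_R by (simp add: prod.inj_map)

lemma range_RC: "range RC = D \<times> D" unfolding D_range by auto

lemma complexify_RC: "complexify A (RC x) = x + SC x"
  by (cases x) (simp add: complexify_def A_R)

text \<open>On the disc of radius $\rho$ around $0$ it is enough to split $R=E+F$ with $\|E\|\le 1/(2\rho)$ and $F$ of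
finite rank.  The functionals of $F$ enter with the factor $\zeta$, those of $-S$ without it.\<close>

lemma reduce_to_fredholm_family:
  fixes z :: complex
  obtains E \<epsilon> \<rho> n \<phi> \<psi> v where "fredholm_family E \<epsilon> \<rho> \<phi> \<psi>" "z \<in> ball 0 \<rho>" "z0 \<in> ball 0 \<rho>"
    "\<And>\<zeta> x. fredholm_family.T E n \<phi> \<psi> v \<zeta> x = x - scaleC \<zeta> (RC x) + SC x"
proof -
  (* the disc has to contain z and z0 *)
  define \<rho> :: real where "\<rho> = max (cmod z) (cmod z0) + 1"
  define \<epsilon> :: real where "\<epsilon> = 1 / (2 * \<rho>)"
  have rho: "\<rho> > 0" "z \<in> ball 0 \<rho>" "z0 \<in> ball 0 \<rho>"
    unfolding \<rho>_def by (auto simp: max_def intro: add_nonneg_pos)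
  have eps: "\<epsilon> > 0" "\<rho> * \<epsilon> < 1" using rho by (auto simp: \<epsilon>_def)
  obtain E where E: "bounded_linear E" "\<And>x. norm (E x) \<le> \<epsilon> * norm x" "finite_rank (\<lambda>x. R x - E x)"
    using approx[OF eps(1)] by blast
  obtain xs where xs: "\<forall>p\<in>set xs. bounded_linear (fst p)" "\<And>x. R x - E x = (\<Sum>p\<leftarrow>xs. fst p x *\<^sub>R snd p)"
    using E(3) unfolding finite_rank_def by metis
  obtain ys where ys: "\<forall>p\<in>set ys. bounded_linear (fst p)" "\<And>x. S x = (\<Sum>p\<leftarrow>ys. fst p x *\<^sub>R snd p)"
    using S unfolding finite_rank_def by metis
  define cf :: "('a \<Rightarrow> real) \<Rightarrow> 'a \<times> 'a \<Rightarrow> complex" where "cf = (\<lambda>f x. Complex (f (fst x)) (f (snd x)))"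
  (* the triples (phi, psi, v): the pairs of F with psi = 0, those of S with phi = 0 and psi negated *)
  define zs where "zs = map (\<lambda>p. (fst p, (\<lambda>x. 0::real), snd p)) xs @ map (\<lambda>p. ((\<lambda>x. 0), (\<lambda>x. - fst p x), snd p)) ys"
  define n where "n = length zs"
  define \<phi> where "\<phi> = (\<lambda>i. if i < n then cf (fst (zs ! i)) else (\<lambda>x. 0))"
  define \<psi> where "\<psi> = (\<lambda>i. if i < n then cf (fst (snd (zs ! i))) else (\<lambda>x. 0))"
  define v :: "nat \<Rightarrow> 'a \<times> 'a" where "v = (\<lambda>i. (snd (snd (zs ! i)), 0))"
  have zs: "bounded_linear (fst p) \<and> bounded_linear (fst (snd p))" if "p \<in> set zs" for p
    using that xs(1) ys(1) bounded_linear_minus by (fastforce simp: zs_def)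
  have cfun: "clinear_functional (cf f)" if "bounded_linear f" for f
    unfolding cf_def by (rule clinear_functional_complexified[OF that])
  have zero: "clinear_functional (\<lambda>x. 0)" by (simp add: clinear_functional_def)
  have phi: "clinear_functional (\<phi> i)" "clinear_functional (\<psi> i)" for i
    using zs[OF nth_mem, of i] cfun zero by (auto simp: \<phi>_def \<psi>_def n_def)
  have fam: "fredholm_family (map_prod E E) \<epsilon> \<rho> \<phi> \<psi>"
  proof
    show "clinear_op (map_prod E E)" by (rule clinear_op_map_prod[OF E(1)])
    show "norm (map_prod E E x) \<le> \<epsilon> * norm x" for x
    proof (rule power2_le_imp_le)
      obtain x1 x2 where x: "x = (x1, x2)" by fastforce
      have "(norm (E x1))\<^sup>2 + (norm (E x2))\<^sup>2 \<le> (\<epsilon> * norm x1)\<^sup>2 + (\<epsilon> * norm x2)\<^sup>2"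
        by (intro add_mono power_mono E(2)) auto
      then show "(norm (map_prod E E x))\<^sup>2 \<le> (\<epsilon> * norm x)\<^sup>2"
        by (simp add: x norm_Pair power_mult_distrib algebra_simps)
    qed (use eps in auto)
  qed (use rho eps phi in auto)
  then interpret fam: fredholm_family "map_prod E E" \<epsilon> \<rho> n \<phi> \<psi> v .
  have "fam.T \<zeta> x = x - scaleC \<zeta> (RC x) + SC x" for \<zeta> x
  proof -
    define g where "g = (\<lambda>p. scaleC (\<zeta> * cf (fst p) x + cf (fst (snd p)) x) (snd (snd p), 0 :: 'a))"
    have "(\<Sum>i<n. scaleC (fam.f \<zeta> i x) (v i)) = (\<Sum>i<n. g (zs ! i))"
      by (intro sum.cong refl) (simp add: fam.f_def, simp add: g_def \<phi>_def \<psi>_def v_def)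
    also have "\<dots> = (\<Sum>p\<leftarrow>zs. g p)"
      by (simp add: sum_list_sum_nth n_def lessThan_atLeast0)
    also have "\<dots> = (\<Sum>p\<leftarrow>xs. scaleC (\<zeta> * cf (fst p) x) (snd p, 0)) + (\<Sum>p\<leftarrow>ys. scaleC (- cf (fst p) x) (snd p, 0))"
    proof -
      have "cf (\<lambda>x. 0) x = 0" "cf (\<lambda>x. - f x) x = - cf f x" for f
        by (auto simp: cf_def complex_eq_iff)
      then show ?thesis by (simp add: zs_def g_def o_def)
    qed
    also have "(\<Sum>p\<leftarrow>xs. scaleC (\<zeta> * cf (fst p) x) (snd p, 0)) = scaleC \<zeta> (RC x - map_prod E E x)"
    proof -
      have "(\<Sum>p\<leftarrow>l. scaleC (\<zeta> * cf (fst p) x) (snd p, 0))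
        = scaleC \<zeta> (\<Sum>p\<leftarrow>l. fst p (fst x) *\<^sub>R snd p, \<Sum>p\<leftarrow>l. fst p (snd x) *\<^sub>R snd p)"
        for l :: "(('a \<Rightarrow> real) \<times> 'a) list"
      proof (induction l)
        case (Cons p l)
        have "scaleC (\<zeta> * cf (fst p) x) (snd p, 0) = scaleC \<zeta> (fst p (fst x) *\<^sub>R snd p, fst p (snd x) *\<^sub>R snd p)"
          by (simp add: scaleC_scaleC[symmetric]) (simp add: scaleC_def cf_def)
        then show ?case using Cons by (simp flip: scaleC_add_right)
      qed (simp add: scaleC_def zero_prod_def)
      then show ?thesis by (cases x) (simp flip: xs(2))
    qed
    also have "(\<Sum>p\<leftarrow>ys. scaleC (- cf (fst p) x) (snd p, 0)) = - SC x"
    proof -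
      have "(\<Sum>p\<leftarrow>l. scaleC (- cf (fst p) x) (snd p, 0))
        = - (\<Sum>p\<leftarrow>l. fst p (fst x) *\<^sub>R snd p, \<Sum>p\<leftarrow>l. fst p (snd x) *\<^sub>R snd p)"
        for l :: "(('a \<Rightarrow> real) \<times> 'a) list"
        by (induction l) (auto simp: scaleC_def cf_def zero_prod_def)
      then show ?thesis by (cases x) (simp flip: ys(2))
    qed
    finally show ?thesis
      by (simp add: fam.T_def scaleC.diff_right algebra_simps)
  qed
  then show ?thesis using that[OF fam rho(2,3)] by blast
qed

lemma resolvent_equation:
  assumes "\<And>\<zeta> x. T \<zeta> x = x - scaleC \<zeta> (RC x) + SC x"
  shows "scaleC \<zeta> (RC x) - complexify A (RC x) = - T \<zeta> x"
  by (simp add: assms complexify_RC)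

lemma not_eigenvalue_kernel:
  assumes "\<And>\<zeta> x. T \<zeta> x = x - scaleC \<zeta> (RC x) + SC x" and "\<not> eigenvalue D A \<zeta>" and "T \<zeta> x = 0"
  shows "x = 0"
proof (rule ccontr)
  assume "x \<noteq> 0"
  interpret RC: bounded_linear RC by (rule RC_bounded_linear)
  have "RC x \<noteq> 0" using \<open>x \<noteq> 0\<close> inj_RC RC.zero by (metis injD)
  moreover have "scaleC \<zeta> (RC x) - complexify A (RC x) = 0"
    using resolvent_equation[of T \<zeta> x, OF assms(1)] by (simp only: assms(3) minus_zero)
  then have "complexify A (RC x) = scaleC \<zeta> (RC x)" by (metis right_minus_eq)
  moreover have "RC x \<in> D \<times> D" using range_RC by blast
  ultimately have "eigenvalue D A \<zeta>" unfolding eigenvalue_def by (intro bexI[of _ "RC x"] conjI)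
  then show False using assms(2) by contradiction
qed

text \<open>On a disc that contains $z$ and the point \<open>z0\<close> the spectrum is the zero set of the determinant
$d$, which does not vanish at \<open>z0\<close>.  So $d$ has isolated zeros, and each of them produces a kernel, that is,
an eigenvector.

Near a zero of order $p$ the resolvent is a holomorphic part plus $d^{-1}$ times a holomorphic combination
of the vectors $RG(\zeta)v_j$.  Let $q$ be orthogonal to the finitely many vectors $R(G(z)E)^kG(z)v_j$ and
$iR(G(z)E)^kG(z)v_j$ with $k<p$.  By \<open>G_vanishing_order\<close> the pole disappears from the complex functional
$\kappa$ with real part $\langle q,\cdot\rangle$, so Cauchy's theorem shows that $q$ is orthogonal to the
Riesz projection of every vector.  Hence its range lies in the span of these vectors.\<close>

theorem spectrum_discrete:
  fixes z :: complex
  shows not_eigenvalue_resolvent_set: "\<not> eigenvalue D A z \<Longrightarrow> z \<in> resolvent_set D A"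
    and spectrum_isolated: "z \<in> spectrum D A \<Longrightarrow> z isolated_in spectrum D A"
    and spectrum_finite_multiplicity: "z \<in> spectrum D A \<Longrightarrow> finite_algebraic_multiplicity D A z"
proof -
  obtain E \<epsilon> \<rho> n \<phi> \<psi> v where fam: "fredholm_family E \<epsilon> \<rho> \<phi> \<psi>" and z: "z \<in> ball 0 \<rho>" and z0b: "z0 \<in> ball 0 \<rho>"
    and T: "\<And>\<zeta> x. fredholm_family.T E n \<phi> \<psi> v \<zeta> x = x - scaleC \<zeta> (RC x) + SC x"
    apply (rule reduce_to_fredholm_family[of z])
    subgoal premises prems by (rule prems(1)[OF prems(2-)])
    done
  interpret fam: fredholm_family E \<epsilon> \<rho> n \<phi> \<psi> v by (rule fam)
  interpret RC: clinear_opL RC by unfold_locales (rule RC_clinear)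
  obtain d :: "complex \<Rightarrow> complex" and b :: "complex \<Rightarrow> nat \<Rightarrow> nat \<Rightarrow> complex" where
    d: "d holomorphic_on ball 0 \<rho>"
    and b: "\<And>i j. i < n \<Longrightarrow> j < n \<Longrightarrow> (\<lambda>\<zeta>. b \<zeta> i j) holomorphic_on ball 0 \<rho>"
    and ker: "\<And>\<zeta>. \<zeta> \<in> ball 0 \<rho> \<Longrightarrow> d \<zeta> = 0 \<Longrightarrow> \<exists>x. x \<noteq> 0 \<and> fam.T \<zeta> x = 0"
    and inj: "\<And>\<zeta> x. \<zeta> \<in> ball 0 \<rho> \<Longrightarrow> d \<zeta> \<noteq> 0 \<Longrightarrow> fam.T \<zeta> x = 0 \<Longrightarrow> x = 0"
    and sol: "\<And>\<zeta> y. \<zeta> \<in> ball 0 \<rho> \<Longrightarrow> d \<zeta> \<noteq> 0 \<Longrightarrow>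
      fam.T \<zeta> (fam.G \<zeta> y + (\<Sum>j<n. scaleC ((\<Sum>i<n. b \<zeta> j i * fam.f \<zeta> i (fam.G \<zeta> y)) / d \<zeta>) (fam.G \<zeta> (v j)))) = y"
    apply (rule fam.fredholm_determinant)
    subgoal premises prems by (rule prems(1)[OF prems(2-)])
    done
  define U where "U = (\<lambda>\<zeta> y. fam.G \<zeta> y +
    (\<Sum>j<n. scaleC ((\<Sum>i<n. b \<zeta> j i * fam.f \<zeta> i (fam.G \<zeta> y)) / d \<zeta>) (fam.G \<zeta> (v j))))"
  have nonzero: "d \<zeta> \<noteq> 0" if "\<zeta> \<in> ball 0 \<rho>" "\<not> eigenvalue D A \<zeta>" for \<zeta>
    using ker[OF that(1)] not_eigenvalue_kernel[of fam.T, OF T that(2)] by blast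
  let ?L = "\<lambda>\<zeta> w. scaleC \<zeta> w - complexify A w"
  have L_RC: "?L \<zeta> (RC x) = - fam.T \<zeta> x" for \<zeta> x by (rule resolvent_equation[of fam.T, OF T])
  have res: "\<zeta> \<in> resolvent_set D A \<and> (\<forall>y. resolvent D A \<zeta> y = RC (U \<zeta> (- y)))"
    if \<zeta>: "\<zeta> \<in> ball 0 \<rho>" and nz: "d \<zeta> \<noteq> 0" for \<zeta> :: complex
  proof -
    have bij: "bij_betw (?L \<zeta>) (D \<times> D) UNIV"
      unfolding bij_betw_def
    proof
      show "inj_on (?L \<zeta>) (D \<times> D)"
        unfolding range_RC[symmetric]
      proof (rule inj_onI)
        fix w1 w2 assume w: "w1 \<in> range RC" "w2 \<in> range RC" and eq: "?L \<zeta> w1 = ?L \<zeta> w2"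
        obtain x where x: "w1 = RC x" using w(1) by (rule imageE)
        obtain y where y: "w2 = RC y" using w(2) by (rule imageE)
        note xy = x y
        have "fam.T \<zeta> (x - y) = 0" using eq unfolding xy L_RC fam.T_linear by simp
        then have "x - y = 0" by (rule inj[OF \<zeta> nz])
        then show "w1 = w2" by (simp add: xy)
      qed
      have "y \<in> ?L \<zeta> ` (D \<times> D)" for y
      proof
        show "y = ?L \<zeta> (RC (U \<zeta> (- y)))" unfolding L_RC U_def sol[OF \<zeta> nz] by simp
        show "RC (U \<zeta> (- y)) \<in> D \<times> D" using range_RC by blast
      qed
      then show "?L \<zeta> ` (D \<times> D) = UNIV" by blast
    qed
    have eq: "resolvent D A \<zeta> y = RC (U \<zeta> (- y))" for y
    proof -
      have "?L \<zeta> (RC (U \<zeta> (- y))) = y" unfolding L_RC U_def sol[OF \<zeta> nz] by simp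
      moreover have "RC (U \<zeta> (- y)) \<in> D \<times> D" using range_RC by blast
      ultimately show ?thesis
        unfolding resolvent_def using inv_into_f_f[OF bij_betw_imp_inj_on[OF bij]] by metis
    qed
    have G: "bounded_linear (fam.G \<zeta>)" using fam.G_clinear[OF \<zeta>] by (simp add: clinear_op_def)
    have f: "bounded_linear (fam.f \<zeta> i)" for i using fam.f_clinear[of \<zeta> i] by (simp add: clinear_functional_def)
    have sum: "bounded_linear (\<lambda>y. \<Sum>i<n. b \<zeta> j i * fam.f \<zeta> i (fam.G \<zeta> y))" for j
      by (intro bounded_linear_sum bounded_linear_const_mult bounded_linear_compose[OF f G])
    have "bounded_linear (\<lambda>y. (\<Sum>i<n. b \<zeta> j i * fam.f \<zeta> i (fam.G \<zeta> y)) / d \<zeta>)" for j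
      unfolding divide_inverse by (rule bounded_linear_mult_const[OF sum])
    then have U: "bounded_linear (U \<zeta>)"
      unfolding U_def
      by (intro bounded_linear_add[OF G] bounded_linear_sum
          bounded_linear_compose[OF scaleC.bounded_linear_left])
    have "bounded_linear (\<lambda>y. RC (U \<zeta> (- y)))"
      by (rule bounded_linear_compose[OF RC_bounded_linear
            bounded_linear_compose[OF U bounded_linear_minus[OF bounded_linear_ident]]])
    moreover have "resolvent D A \<zeta> = (\<lambda>y. RC (U \<zeta> (- y)))" using eq by auto
    ultimately show ?thesis using bij eq by (simp add: resolvent_set_def)
  qed
  show "\<not> eigenvalue D A z \<Longrightarrow> z \<in> resolvent_set D A"
    using res nonzero z by blast
  assume spectral: "z \<in> spectrum D A"
  have dz: "d z = 0" using res[OF z] spectral by (auto simp: spectrum_def)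
  have dz0: "d z0 \<noteq> 0" using nonzero[OF z0b z0] .
  have "\<not> d constant_on ball 0 \<rho>" using dz dz0 z z0b unfolding constant_on_def by metis
  then obtain g r p where p: "0 < p" and r: "0 < r" "ball z r \<subseteq> ball 0 \<rho>"
    and g: "g holomorphic_on ball z r" and dg: "\<And>w. w \<in> ball z r \<Longrightarrow> d w = (w - z) ^ p * g w"
    and g0: "\<And>w. w \<in> ball z r \<Longrightarrow> g w \<noteq> 0"
    using holomorphic_factor_zero_nonconstant[OF d open_ball connected_ball z dz] by metis
  have near: "d \<zeta> \<noteq> 0" if "\<zeta> \<in> ball z r" "\<zeta> \<noteq> z" for \<zeta>
    using dg[OF that(1)] g0[OF that(1)] that(2) by simp
  have "\<zeta> \<in> resolvent_set D A" if "\<zeta> \<in> ball z r" "\<zeta> \<noteq> z" for \<zeta>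
  proof -
    have "\<zeta> \<in> ball 0 \<rho>" using that(1) r(2) by (rule subsetD[rotated])
    then show ?thesis using res near[OF that] by blast
  qed
  then have only: "ball z r \<inter> spectrum D A = {z}"
    using spectral r(1) unfolding spectrum_def by (auto simp del: mem_ball)
  then show "z isolated_in spectrum D A"
    using spectral unfolding isolated_in_def by (intro conjI exI[of _ "ball z r"]) auto
  define B where "B = (\<lambda>(k, j). RC ((fam.GE z ^^ k) (fam.G z (v j)))) ` ({..<p} \<times> {..<n})"
  (* the real span of B and iB is the complex span of B *)
  define B' where "B' = B \<union> scaleC \<i> ` B"
  have fin: "finite B'" by (simp add: B'_def B_def)
  have "riesz_projection D A z (r/2) y \<in> span B'" for y
  proof (rule in_span_if_orthogonal[OF fin])
    fix q assume q: "\<And>w. w \<in> B' \<Longrightarrow> inner q w = 0"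
    (* the complex linear functional with real part inner q *)
    define \<kappa> where "\<kappa> = (\<lambda>w. Complex (inner q w) (- inner q (scaleC \<i> w)))"
    have kappa: "clinear_functional \<kappa>"
    proof -
      have "bounded_linear (\<lambda>w. of_real (inner q w) - \<i> * of_real (inner q (scaleC \<i> w)))"
        by (intro bounded_linear_sub bounded_linear_const_mult bounded_linear_compose[OF bounded_linear_of_real]
          bounded_linear_inner_right bounded_linear_compose[OF bounded_linear_inner_right] scaleC.bounded_linear_right)
      moreover have "(\<lambda>w. of_real (inner q w) - \<i> * of_real (inner q (scaleC \<i> w))) = \<kappa>"
        by (intro ext) (simp add: \<kappa>_def complex_eq_iff)
      moreover have "\<kappa> (scaleC c w) = c * \<kappa> w" for c w
      proof -
        have 1: "scaleC c w = Re c *\<^sub>R w + Im c *\<^sub>R scaleC \<i> w"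
          by (cases w) (simp add: scaleC_def)
        have 2: "scaleC \<i> (scaleC c w) = Re c *\<^sub>R scaleC \<i> w - Im c *\<^sub>R w"
          by (cases w) (simp add: scaleC_def algebra_simps)
        show ?thesis
          unfolding \<kappa>_def 2 by (simp add: 1 complex_eq_iff inner_add_right inner_diff_right)
      qed
      ultimately show ?thesis by (simp add: clinear_functional_def)
    qed
    have kappaR: "clinear_functional (\<lambda>w. \<kappa> (RC w))" by (rule clinear_functional_comp[OF kappa RC_clinear])
    interpret kR: clinear_functionalL "\<lambda>w. \<kappa> (RC w)" by unfold_locales (rule kappaR)
    interpret k: clinear_functionalL \<kappa> by unfold_locales (rule kappa)
    have vanish: "\<forall>k<p. \<kappa> (RC ((fam.GE z ^^ k) (fam.G z (v j)))) = 0" if "j < n" for j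
    proof (intro allI impI)
      fix k assume "k < p"
      then have "RC ((fam.GE z ^^ k) (fam.G z (v j))) \<in> B"
        unfolding B_def using that by (intro image_eqI[of _ _ "(k, j)"]) auto
      then show "\<kappa> (RC ((fam.GE z ^^ k) (fam.G z (v j)))) = 0"
        using q by (auto simp: \<kappa>_def B'_def complex_eq_iff)
    qed
    define c where "c = (\<lambda>\<zeta> j. \<Sum>i<n. b \<zeta> j i * fam.f \<zeta> i (fam.G \<zeta> (- y)))"
    define h where "h = (\<lambda>\<zeta>. \<kappa> (RC (fam.G \<zeta> (- y))) +
      (\<Sum>j<n. c \<zeta> j / g \<zeta> * \<kappa> (RC ((fam.GE z ^^ p) (fam.G \<zeta> (v j))))))"
    have kp: "clinear_functional (\<lambda>w. \<kappa> (RC ((fam.GE z ^^ p) w)))"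
      by (rule clinear_functional_comp[OF kappaR clinear_op_funpow[OF fam.GE_clinear[OF z]]])
    have h: "h holomorphic_on ball z r"
    proof -
      have sub: "F holomorphic_on ball z r" if "F holomorphic_on ball 0 \<rho>" for F :: "complex \<Rightarrow> complex"
        using holomorphic_on_subset[OF that r(2)] .
      have "(\<lambda>\<zeta>. c \<zeta> j) holomorphic_on ball z r" if "j < n" for j
        unfolding c_def
        by (intro holomorphic_on_sum holomorphic_on_mult sub b fam.f_G_holomorphic) (use that in auto)
      then show ?thesis
        unfolding h_def
        by (intro holomorphic_on_add holomorphic_on_sum holomorphic_on_mult holomorphic_on_divide g
          sub[OF fam.G_holomorphic[OF kappaR]] sub[OF fam.G_holomorphic[OF kp]]) (use g0 in auto)
    qed
    have h_eq: "\<kappa> (resolvent D A \<zeta> y) = h \<zeta>" if \<zeta>: "\<zeta> \<in> ball z r" "\<zeta> \<noteq> z" for \<zeta>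
    proof -
      have \<zeta>': "\<zeta> \<in> ball 0 \<rho>" using \<zeta> r by blast
      have "resolvent D A \<zeta> y = RC (U \<zeta> (- y))" using res[OF \<zeta>' near[OF \<zeta>]] by blast
      then have "\<kappa> (resolvent D A \<zeta> y) = \<kappa> (RC (U \<zeta> (- y)))" by (rule arg_cong)
      also have "\<dots> = \<kappa> (RC (fam.G \<zeta> (- y))) + (\<Sum>j<n. c \<zeta> j / d \<zeta> * \<kappa> (RC (fam.G \<zeta> (v j))))"
        unfolding U_def c_def by (simp only: kR.add kR.sum kR.scaleC)
      also have "(\<Sum>j<n. c \<zeta> j / d \<zeta> * \<kappa> (RC (fam.G \<zeta> (v j))))
        = (\<Sum>j<n. c \<zeta> j / g \<zeta> * \<kappa> (RC ((fam.GE z ^^ p) (fam.G \<zeta> (v j)))))"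
      proof (intro sum.cong refl)
        fix j assume "j \<in> {..<n}"
        then have e: "\<kappa> (RC (fam.G \<zeta> (v j))) = (\<zeta> - z) ^ p * \<kappa> (RC ((fam.GE z ^^ p) (fam.G \<zeta> (v j))))"
          using fam.G_vanishing_order[OF z \<zeta>' kappaR, of p "v j"] vanish[of j] by simp
        show "c \<zeta> j / d \<zeta> * \<kappa> (RC (fam.G \<zeta> (v j))) = c \<zeta> j / g \<zeta> * \<kappa> (RC ((fam.GE z ^^ p) (fam.G \<zeta> (v j))))"
          unfolding e dg[OF \<zeta>(1)] using \<zeta>(2) by simp
      qed
      finally show ?thesis by (simp only: h_def)
    qed
    let ?F = "\<lambda>\<theta>. scaleC (of_real (r/2) * cis \<theta>) (resolvent D A (z + of_real (r/2) * cis \<theta>) y)"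
    (* without integrability the integral is 0 by convention *)
    have "inner q (integral {0..2 * pi} ?F) = 0"
    proof (cases "?F integrable_on {0..2 * pi}")
      case True
      have kF: "\<kappa> (?F \<theta>) = of_real (r/2) * cis \<theta> * h (z + of_real (r/2) * cis \<theta>)" for \<theta>
      proof -
        have "z + of_real (r/2) * cis \<theta> \<in> ball z r" "z + of_real (r/2) * cis \<theta> \<noteq> z"
          using r(1) by (auto simp: dist_norm norm_mult)
        from h_eq[OF this] show ?thesis by (simp only: k.scaleC)
      qed
      have "((\<lambda>\<theta>. of_real (r/2) * cis \<theta> * h (z + of_real (r/2) * cis \<theta>)) has_integral 0) {0..2 * pi}"
        by (rule Cauchy_circle_integral[OF h]) (use r in auto)
      then have "((\<lambda>\<theta>. \<kappa> (?F \<theta>)) has_integral 0) {0..2 * pi}" by (simp only: kF)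
      from has_integral_linear[OF this bounded_linear_Re]
      have "((\<lambda>\<theta>. inner q (?F \<theta>)) has_integral 0) {0..2 * pi}" by (simp add: o_def \<kappa>_def)
      moreover have "((\<lambda>\<theta>. inner q (?F \<theta>)) has_integral inner q (integral {0..2 * pi} ?F)) {0..2 * pi}"
        using has_integral_linear[OF integrable_integral[OF True] bounded_linear_inner_right[of q]]
        by (simp add: o_def)
      ultimately show ?thesis by (rule has_integral_unique[rotated])
    qed (simp add: not_integrable_integral)
    then show "inner q (riesz_projection D A z (r/2) y) = 0"
      unfolding riesz_projection_def inner_scaleR_right by simp
  qed
  moreover have "cball z (r/2) \<inter> spectrum D A \<subseteq> {z}"
  proof -
    have "cball z (r/2) \<subseteq> ball z r" using r(1) by (simp add: cball_subset_ball_iff)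
    then show ?thesis using only by blast
  qed
  ultimately show "finite_algebraic_multiplicity D A z"
    unfolding finite_algebraic_multiplicity_def using r(1) fin
    by (intro exI[of _ "r/2"]) (auto intro!: exI[of _ B'])
qed

lemma spectrum_eigenvalue: "z \<in> spectrum D A \<Longrightarrow> eigenvalue D A z"
  using not_eigenvalue_resolvent_set by (auto simp: spectrum_def)

end

section \<open>Completeness of $L^2(0,1)$\<close>

interpretation I01: finite_measure I01
  by (rule finite_measureI) (simp add: emeasure_restrict_space)

lemma measure_I01: "measure I01 {0<..<1} = 1"
  by (simp add: measure_def emeasure_restrict_space)

lemma square_integrable_measurable: "square_integrable f \<Longrightarrow> f \<in> borel_measurable I01"
  by (simp add: square_integrable_def)

lemma square_integrable_bounded:
  assumes "f \<in> borel_measurable I01" "AE x in I01. \<bar>f x\<bar> \<le> B"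
  shows "square_integrable f"
  unfolding square_integrable_def
proof (intro conjI assms)
  have "AE x in I01. norm ((f x)\<^sup>2) \<le> B\<^sup>2"
    using assms(2) by eventually_elim (auto intro: power2_mono)
  then show "integrable I01 (\<lambda>x. (f x)\<^sup>2)"
    by (rule I01.integrable_const_bound) (use assms(1) in measurable)
qed

lemma measurable_I01_continuous:
  assumes "continuous_on {0..1::real} F"
  shows "F \<in> borel_measurable I01"
proof (rule continuous_imp_measurable_on_sets_lebesgue)
  show "continuous_on {0<..<1} F" using assms by (rule continuous_on_subset) auto
qed auto

lemma continuous_bounded_01:
  assumes "continuous_on {0..1::real} (F :: real \<Rightarrow> real)"
  obtains B where "B \<ge> 0" "\<And>x. x \<in> {0..1} \<Longrightarrow> \<bar>F x\<bar> \<le> B"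
proof -
  have "bounded (F ` {0..1})" by (intro compact_imp_bounded compact_continuous_image assms) simp
  then obtain B where "\<forall>x\<in>{0..1}. \<bar>F x\<bar> \<le> B" by (auto simp: bounded_iff)
  then have B: "\<And>x. x \<in> {0..1} \<Longrightarrow> \<bar>F x\<bar> \<le> B" by blast
  moreover have "B \<ge> 0" using B[of 0] by simp
  ultimately show ?thesis using that by blast
qed

lemma square_integrable_continuous:
  assumes "continuous_on {0..1::real} F"
  shows "square_integrable F"
proof -
  obtain B where "\<And>x. x \<in> {0..1} \<Longrightarrow> \<bar>F x\<bar> \<le> B" using continuous_bounded_01[OF assms] by blast
  then show ?thesis
    by (intro square_integrable_bounded[of _ B] measurable_I01_continuous assms AE_I2) auto
qed

lemma rep_abs_l2: "square_integrable f \<Longrightarrow> l2_rel (rep_l2 (abs_l2 f)) f"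
  using Quotient3_rep_abs[OF Quotient3_l2, of f] by (simp add: l2_rel_def)

lemma abs_rep_l2: "abs_l2 (rep_l2 f) = f"
  by (rule Quotient3_abs_rep[OF Quotient3_l2])

lemma square_integrable_rep: "square_integrable (rep_l2 f)"
  using Quotient3_rep_reflp[OF Quotient3_l2, of f] by (simp add: l2_rel_def)

lemma measurable_rep_l2 [measurable]: "rep_l2 f \<in> borel_measurable I01"
  using square_integrable_rep by (rule square_integrable_measurable)

lemma AE_rep_abs: "square_integrable f \<Longrightarrow> AE x in I01. rep_l2 (abs_l2 f) x = f x"
  using rep_abs_l2 by (simp add: l2_rel_def)

lemma abs_l2_eqI:
  assumes "square_integrable f" "square_integrable g" "AE x in I01. f x = g x"
  shows "abs_l2 f = abs_l2 g"
  using Quotient3_rel_abs[OF Quotient3_l2, of f g] assms by (simp add: l2_rel_def)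

lemma l2_cases:
  obtains F where "square_integrable F" "f = abs_l2 F"
  using that[OF square_integrable_rep, of f] abs_rep_l2 by metis

lemma l2_rel_refl: "square_integrable f \<Longrightarrow> l2_rel f f"
  by (simp add: l2_rel_def)

lemma abs_l2_add: "square_integrable f \<Longrightarrow> square_integrable g \<Longrightarrow> abs_l2 f + abs_l2 g = abs_l2 (\<lambda>x. f x + g x)"
  and abs_l2_diff: "square_integrable f \<Longrightarrow> square_integrable g \<Longrightarrow> abs_l2 f - abs_l2 g = abs_l2 (\<lambda>x. f x - g x)"
  and abs_l2_scale: "square_integrable f \<Longrightarrow> r *\<^sub>R abs_l2 f = abs_l2 (\<lambda>x. r * f x)"
  and inner_abs_l2: "square_integrable f \<Longrightarrow> square_integrable g \<Longrightarrow> inner (abs_l2 f) (abs_l2 g) = (LINT x|I01. f x * g x)"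
  by (auto simp: plus_l2.abs_eq minus_l2.abs_eq scaleR_l2.abs_eq inner_l2.abs_eq l2_rel_refl)

lemma inner_l2_rep: "inner f g = (LINT x|I01. rep_l2 f x * rep_l2 g x)"
  using inner_abs_l2[OF square_integrable_rep square_integrable_rep, of f g] by (simp add: abs_rep_l2)

lemma norm_abs_l2: "square_integrable f \<Longrightarrow> (norm (abs_l2 f))\<^sup>2 = (LINT x|I01. (f x)\<^sup>2)"
  unfolding power2_norm_eq_inner by (subst inner_abs_l2) (auto simp: power2_eq_square)

lemma norm_abs_l2_le:
  assumes "f \<in> borel_measurable I01" "AE x in I01. \<bar>f x\<bar> \<le> B" "B \<ge> 0"
  shows "norm (abs_l2 f) \<le> B"
proof (rule power2_le_imp_le)
  have sq: "square_integrable f" by (rule square_integrable_bounded[OF assms(1,2)])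
  have "(norm (abs_l2 f))\<^sup>2 = (LINT x|I01. (f x)\<^sup>2)" by (rule norm_abs_l2[OF sq])
  also have "\<dots> \<le> (LINT x|I01. B\<^sup>2)"
  proof (rule integral_mono_AE)
    show "AE x in I01. (f x)\<^sup>2 \<le> B\<^sup>2"
      using assms(2) by eventually_elim (use assms(3) in \<open>auto simp: abs_le_square_iff[symmetric]\<close>)
  qed (use sq in \<open>auto simp: square_integrable_def\<close>)
  also have "\<dots> = B\<^sup>2" by (simp add: measure_I01)
  finally show "(norm (abs_l2 f))\<^sup>2 \<le> B\<^sup>2" .
qed fact

lemma nn_integral_square:
  assumes "square_integrable f"
  shows "(\<integral>\<^sup>+x. ennreal ((f x)\<^sup>2) \<partial>I01) = ennreal ((norm (abs_l2 f))\<^sup>2)"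
  using assms unfolding norm_abs_l2[OF assms] square_integrable_def
  by (intro nn_integral_eq_integral) auto

text \<open>The $L^1$ norm is bounded by the $L^2$ norm because the interval has length one.\<close>

lemma nn_integral_abs_le:
  assumes "square_integrable f"
  shows "(\<integral>\<^sup>+x. ennreal \<bar>f x\<bar> \<partial>I01) \<le> ennreal (norm (abs_l2 f))"
proof -
  have sq: "square_integrable (\<lambda>x. \<bar>f x\<bar>)" "square_integrable (\<lambda>x. 1)"
    using assms square_integrable_bounded[of "\<lambda>x. 1" 1] by (auto simp: square_integrable_def)
  have int: "integrable I01 (\<lambda>x. \<bar>f x\<bar>)" using square_integrable_mult[OF sq] by simp
  have "norm (abs_l2 (\<lambda>x. \<bar>f x\<bar>)) = norm (abs_l2 f)"
    by (rule power2_eq_imp_eq) (use norm_abs_l2[OF assms] norm_abs_l2[OF sq(1)] in auto)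
  moreover have "norm (abs_l2 (\<lambda>x. 1)) \<le> 1" by (rule norm_abs_l2_le) auto
  moreover have "(LINT x|I01. \<bar>f x\<bar>) \<le> norm (abs_l2 (\<lambda>x. \<bar>f x\<bar>)) * norm (abs_l2 (\<lambda>x. 1))"
    using norm_cauchy_schwarz[of "abs_l2 (\<lambda>x. \<bar>f x\<bar>)" "abs_l2 (\<lambda>x. 1)"]
    by (simp add: inner_abs_l2[OF sq])
  ultimately have "(LINT x|I01. \<bar>f x\<bar>) \<le> norm (abs_l2 f)"
    by (smt (verit) mult_left_le norm_ge_zero)
  then show ?thesis using int by (simp add: nn_integral_eq_integral ennreal_leI)
qed

text \<open>The Riesz--Fischer argument: along a sequence with summable increments the representatives converge
  almost everywhere, because the sum of their absolute increments is integrable, and Fatou's lemma turns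
  this into convergence in the norm.\<close>

lemma l2_fast_Cauchy_converges:
  fixes X :: "nat \<Rightarrow> l2"
  assumes fast: "\<And>k. norm (X (Suc k) - X k) \<le> (1/2) ^ k"
  shows "\<exists>L. X \<longlonglongrightarrow> L"
proof -
  define r where "r = (\<lambda>k. rep_l2 (X k))"
  have sq: "square_integrable (r k)" and X: "X k = abs_l2 (r k)" for k
    by (auto simp: r_def square_integrable_rep abs_rep_l2)
  have meas [measurable]: "r k \<in> borel_measurable I01" for k by (simp add: r_def)
  have "(\<integral>\<^sup>+x. (\<Sum>k. ennreal \<bar>r (Suc k) x - r k x\<bar>) \<partial>I01)
      = (\<Sum>k. (\<integral>\<^sup>+x. ennreal \<bar>r (Suc k) x - r k x\<bar> \<partial>I01))"
    by (rule nn_integral_suminf) simp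
  also have "\<dots> \<le> (\<Sum>k. ennreal ((1/2) ^ k))"
  proof (intro suminf_le summableI)
    fix k
    have "(\<integral>\<^sup>+x. ennreal \<bar>r (Suc k) x - r k x\<bar> \<partial>I01) \<le> ennreal (norm (abs_l2 (\<lambda>x. r (Suc k) x - r k x)))"
      by (rule nn_integral_abs_le[OF square_integrable_diff[OF sq sq]])
    also have "\<dots> \<le> ennreal ((1/2) ^ k)"
      using fast[of k] by (intro ennreal_leI) (simp add: X abs_l2_diff[OF sq sq])
    finally show "(\<integral>\<^sup>+x. ennreal \<bar>r (Suc k) x - r k x\<bar> \<partial>I01) \<le> ennreal ((1/2) ^ k)" .
  qed
  also have "\<dots> < \<infinity>"
    by (subst suminf_ennreal2) (auto intro: summable_geometric)
  finally have fin: "(\<integral>\<^sup>+x. (\<Sum>k. ennreal \<bar>r (Suc k) x - r k x\<bar>) \<partial>I01) \<noteq> \<infinity>" by simp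
  have "AE x in I01. (\<Sum>k. ennreal \<bar>r (Suc k) x - r k x\<bar>) \<noteq> \<infinity>"
    by (rule nn_integral_PInf_AE[OF _ fin]) simp
  then have AEconv: "AE x in I01. convergent (\<lambda>k. r k x)"
  proof eventually_elim
    fix x assume "(\<Sum>k. ennreal \<bar>r (Suc k) x - r k x\<bar>) \<noteq> \<infinity>"
    then have "summable (\<lambda>k. \<bar>r (Suc k) x - r k x\<bar>)"
      by (intro summable_suminf_not_top) auto
    then have "summable (\<lambda>k. r (Suc k) x - r k x)" by (rule summable_rabs_cancel)
    then have "convergent (\<lambda>n. \<Sum>k<n. r (Suc k) x - r k x)" by (simp add: summable_iff_convergent)
    then have "convergent (\<lambda>n. r n x - r 0 x)" by (simp add: sum_lessThan_telescope[of "\<lambda>k. r k x"])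
    then have "convergent (\<lambda>n. (r n x - r 0 x) + r 0 x)"
      by (intro convergent_add convergent_const)
    then show "convergent (\<lambda>k. r k x)" by simp
  qed
  (* lim yields a measurable function also where the sequence diverges *)
  define F where "F = (\<lambda>x. lim (\<lambda>k. r k x))"
  have Fm [measurable]: "F \<in> borel_measurable I01" unfolding F_def by measurable
  have AElim: "AE x in I01. (\<lambda>k. r k x) \<longlonglongrightarrow> F x"
    using AEconv by eventually_elim (simp add: F_def convergent_LIMSEQ_iff)
  have step: "norm (X j - X k) \<le> 2 * (1/2) ^ k" if "k \<le> j" for j k
  proof -
    have "norm (X j - X k) \<le> 2 * (1/2) ^ k - 2 * (1/2) ^ j"
      using that
    proof (induction j rule: dec_induct)
      case (step j)
      have "norm (X (Suc j) - X k) \<le> norm (X (Suc j) - X j) + norm (X j - X k)"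
        using norm_triangle_ineq[of "X (Suc j) - X j" "X j - X k"] by simp
      then show ?case using step fast[of j] by simp
    qed simp
    then show ?thesis by (smt (verit) zero_le_power divide_nonneg_nonneg)
  qed
  have dist: "(\<integral>\<^sup>+x. ennreal ((F x - r k x)\<^sup>2) \<partial>I01) \<le> ennreal ((2 * (1/2) ^ k)\<^sup>2)" for k
  proof -
    have "(\<integral>\<^sup>+x. ennreal ((F x - r k x)\<^sup>2) \<partial>I01)
        = (\<integral>\<^sup>+x. liminf (\<lambda>j. ennreal ((r j x - r k x)\<^sup>2)) \<partial>I01)"
    proof (rule nn_integral_cong_AE)
      show "AE x in I01. ennreal ((F x - r k x)\<^sup>2) = liminf (\<lambda>j. ennreal ((r j x - r k x)\<^sup>2))"
        using AElim
      proof eventually_elim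
        fix x assume "(\<lambda>j. r j x) \<longlonglongrightarrow> F x"
        then have "(\<lambda>j. ennreal ((r j x - r k x)\<^sup>2)) \<longlonglongrightarrow> ennreal ((F x - r k x)\<^sup>2)"
          by (intro tendsto_intros)
        then show "ennreal ((F x - r k x)\<^sup>2) = liminf (\<lambda>j. ennreal ((r j x - r k x)\<^sup>2))"
          by (rule lim_imp_Liminf[symmetric, rotated]) simp
      qed
    qed
    also have "\<dots> \<le> liminf (\<lambda>j. (\<integral>\<^sup>+x. ennreal ((r j x - r k x)\<^sup>2) \<partial>I01))"
      by (rule nn_integral_liminf) simp
    also have "\<dots> \<le> ennreal ((2 * (1/2) ^ k)\<^sup>2)"
    proof (rule Liminf_le)
      show "\<forall>\<^sub>F j in sequentially. (\<integral>\<^sup>+x. ennreal ((r j x - r k x)\<^sup>2) \<partial>I01) \<le> ennreal ((2 * (1/2) ^ k)\<^sup>2)"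
        unfolding eventually_sequentially
      proof (intro exI[of _ k] allI impI)
        fix j assume "k \<le> j"
        have "(\<integral>\<^sup>+x. ennreal ((r j x - r k x)\<^sup>2) \<partial>I01) = ennreal ((norm (X j - X k))\<^sup>2)"
          by (simp add: nn_integral_square[OF square_integrable_diff[OF sq sq]] X abs_l2_diff[OF sq sq])
        also have "\<dots> \<le> ennreal ((2 * (1/2) ^ k)\<^sup>2)"
          by (intro ennreal_leI power_mono step \<open>k \<le> j\<close>) simp
        finally show "(\<integral>\<^sup>+x. ennreal ((r j x - r k x)\<^sup>2) \<partial>I01) \<le> ennreal ((2 * (1/2) ^ k)\<^sup>2)" .
      qed
    qed simp
    finally show ?thesis .
  qed
  have sqd: "square_integrable (\<lambda>x. F x - r k x)" for k
    unfolding square_integrable_def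
  proof
    show "integrable I01 (\<lambda>x. (F x - r k x)\<^sup>2)"
      using dist[of k] by (intro integrableI_nonneg) (auto intro: le_less_trans)
  qed simp
  have sqF: "square_integrable F"
    using square_integrable_add[OF sqd[of 0] sq[of 0]] by simp
  have "norm (abs_l2 F - X k) \<le> 2 * (1/2) ^ k" for k
  proof -
    have "ennreal ((norm (abs_l2 F - X k))\<^sup>2) \<le> ennreal ((2 * (1/2) ^ k)\<^sup>2)"
      using dist[of k] by (simp add: nn_integral_square[OF sqd] X abs_l2_diff[OF sqF sq])
    then have "(norm (abs_l2 F - X k))\<^sup>2 \<le> (2 * (1/2) ^ k)\<^sup>2"
      by (simp only: ennreal_le_iff zero_le_power2)
    then show ?thesis by (rule power2_le_imp_le) simp
  qed
  then have "\<forall>\<^sub>F k in sequentially. norm (X k - abs_l2 F) \<le> 2 * (1/2) ^ k"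
    by (simp add: norm_minus_commute)
  moreover have "(\<lambda>k. 2 * (1/2::real) ^ k) \<longlonglongrightarrow> 0"
    by (rule tendsto_mult_right_zero[OF LIMSEQ_realpow_zero]) auto
  ultimately have "(\<lambda>k. X k - abs_l2 F) \<longlonglongrightarrow> 0" by (rule Lim_null_comparison)
  then show ?thesis using LIM_zero_cancel by blast
qed

instance l2 :: banach
proof
  fix X :: "nat \<Rightarrow> l2" assume X: "Cauchy X"
  obtain s where s: "strict_mono s" "\<And>k. norm (X (s (Suc k)) - X (s k)) \<le> (1/2) ^ k"
  proof -
    have "\<exists>M. \<forall>m\<ge>M. \<forall>n\<ge>M. norm (X m - X n) < (1/2) ^ k" for k
      using X by (intro CauchyD) auto
    then obtain M where M: "\<And>k m n. m \<ge> M k \<Longrightarrow> n \<ge> M k \<Longrightarrow> norm (X m - X n) < (1/2) ^ k" by metis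
    (* increasing, and at least M k at the places k and k + 1 *)
    define s where "s = (\<lambda>k. (\<Sum>i\<le>k. M i) + k)"
    have "strict_mono s" by (auto simp: strict_mono_Suc_iff s_def)
    moreover have "M k \<le> s k" "M k \<le> s (Suc k)" for k
    proof -
      have "M k \<le> (\<Sum>i\<le>k. M i)" by (rule member_le_sum) auto
      then show "M k \<le> s k" "M k \<le> s (Suc k)" by (auto simp: s_def)
    qed
    ultimately show ?thesis using that M by (meson less_imp_le)
  qed
  obtain L where "(X \<circ> s) \<longlonglongrightarrow> L" using l2_fast_Cauchy_converges[of "X \<circ> s"] s(2) by auto
  then have "X \<longlonglongrightarrow> L" using Cauchy_converges_subseq[OF X s(1)] by blast
  then show "convergent X" by (auto simp: convergent_def)
qed

section \<open>Primitives, the Volterra operator and dense subspaces of $L^2(0,1)$\<close>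

text \<open>All point evaluations are inner products: the class \<open>below x\<close> of the indicator of $(0,x)$ represents
$g\mapsto\int_0^x g$.  Working with these vectors replaces most of the measure theory by Hilbert space
estimates.\<close>

definition below :: "real \<Rightarrow> l2" where
  "below x = abs_l2 (indicator {0<..<x})"

definition one_l2 :: l2 where "one_l2 = abs_l2 (\<lambda>x. 1)"

definition primitive :: "l2 \<Rightarrow> real \<Rightarrow> real" where
  "primitive g x = inner g (below x)"

definition volterra :: "l2 \<Rightarrow> l2" where
  "volterra g = abs_l2 (primitive g)"

lemma measurable_indicator_interval [measurable]:
  fixes x y :: real
  shows "(indicator {0<..<x} :: real \<Rightarrow> real) \<in> borel_measurable I01"
    and "(indicator {x..y} :: real \<Rightarrow> real) \<in> borel_measurable I01"
  by (intro measurable_restrict_space1 borel_measurable_indicator; simp)+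

lemma square_integrable_below: "square_integrable (indicator {0<..<x::real})"
  by (rule square_integrable_bounded[of _ 1]) (auto simp: indicator_def)

lemma square_integrable_const: "square_integrable (\<lambda>x. c)"
  by (rule square_integrable_bounded[of _ "\<bar>c\<bar>"]) auto

lemma below_1: "below 1 = one_l2"
  unfolding below_def one_l2_def
  by (rule abs_l2_eqI[OF square_integrable_below square_integrable_const]) (auto intro!: AE_I2)

lemma below_nonpos: "x \<le> 0 \<Longrightarrow> below x = 0"
  unfolding below_def zero_l2_def by (simp add: zero_l2.abs_eq indicator_def[abs_def]) 

lemma norm_one_l2: "norm one_l2 = 1"
  by (rule power2_eq_imp_eq)
    (use norm_abs_l2[OF square_integrable_const[of 1]] measure_I01 in \<open>simp_all add: one_l2_def\<close>)

lemma norm_below_diff: "norm (below y - below x) \<le> sqrt \<bar>y - x\<bar>"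
proof -
  have le: "norm (below y - below x) \<le> sqrt (y - x)" if "x \<le> y" for x y
  proof (rule real_le_rsqrt)
    have sq: "square_integrable (\<lambda>s. indicator {0<..<y} s - indicator {0<..<x} s)"
      by (intro square_integrable_diff square_integrable_below)
    have "(norm (below y - below x))\<^sup>2 = (LINT s|I01. (indicator {0<..<y} s - indicator {0<..<x} s)\<^sup>2)"
      unfolding below_def abs_l2_diff[OF square_integrable_below square_integrable_below]
      by (rule norm_abs_l2[OF sq])
    also have "\<dots> \<le> (LINT s|I01. indicator {x..y} s)"
    proof (rule integral_mono)
      show "integrable I01 (\<lambda>s. (indicator {0<..<y} s - indicator {0<..<x} s)\<^sup>2 :: real)"
        using sq by (simp add: square_integrable_def)
      show "integrable I01 (indicator {x..y} :: real \<Rightarrow> real)"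
        by (rule I01.integrable_const_bound[of _ 1]) (auto simp: indicator_def)
      show "(indicator {0<..<y} s - indicator {0<..<x} s)\<^sup>2 \<le> (indicator {x..y} s :: real)" for s
        using that by (auto simp: indicator_def)
    qed
    also have "\<dots> = measure lebesgue ({x..y} \<inter> {0<..<1})"
      by (subst integral_restrict_space) (auto simp: indicator_inter_arith[symmetric] Int_commute)
    also have "\<dots> \<le> measure lebesgue {x..y}"
      by (rule measure_mono_fmeasurable) auto
    also have "\<dots> = y - x" using that by simp
    finally show "(norm (below y - below x))\<^sup>2 \<le> y - x" .
  qed
  show ?thesis
    using le[of x y] le[of y x] by (cases "x \<le> y") (auto simp: norm_minus_commute)
qed

lemma norm_below: "norm (below x) \<le> 1"
  unfolding below_def by (rule norm_abs_l2_le) (auto simp: indicator_def)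

lemma primitive_add: "primitive (f + g) x = primitive f x + primitive g x"
  and primitive_diff: "primitive (f - g) x = primitive f x - primitive g x"
  and primitive_scale: "primitive (r *\<^sub>R f) x = r * primitive f x"
  by (auto simp: primitive_def inner_add_left inner_diff_left)

lemma primitive_0: "primitive g 0 = 0"
  by (simp add: primitive_def below_nonpos)

lemma primitive_1: "primitive g 1 = inner g one_l2"
  by (simp add: primitive_def below_1)

lemma primitive_bound: "\<bar>primitive g x\<bar> \<le> norm g"
proof -
  have "\<bar>primitive g x\<bar> \<le> norm g * norm (below x)"
    unfolding primitive_def by (rule Cauchy_Schwarz_ineq2)
  also have "\<dots> \<le> norm g * 1" by (intro mult_left_mono norm_below) simp
  finally show ?thesis by simp
qed

lemma primitive_Holder: "\<bar>primitive g y - primitive g x\<bar> \<le> norm g * sqrt \<bar>y - x\<bar>"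
proof -
  have "\<bar>primitive g y - primitive g x\<bar> \<le> norm g * norm (below y - below x)"
    unfolding primitive_def inner_diff_right[symmetric] by (rule Cauchy_Schwarz_ineq2)
  also have "\<dots> \<le> norm g * sqrt \<bar>y - x\<bar>" by (intro mult_left_mono norm_below_diff) simp
  finally show ?thesis .
qed

lemma primitive_continuous: "continuous_on S (primitive g)"
proof (rule continuous_on_subset[of UNIV])
  have "(primitive g \<longlongrightarrow> primitive g x) (at x)" for x
  proof -
    have "((\<lambda>y. norm g * sqrt \<bar>y - x\<bar>) \<longlongrightarrow> norm g * sqrt \<bar>x - x\<bar>) (at x)"
      by (intro tendsto_intros)
    then have "((\<lambda>y. primitive g y - primitive g x) \<longlongrightarrow> 0) (at x)"
      using primitive_Holder by (intro Lim_null_comparison[of "\<lambda>y. primitive g y - primitive g x"]) auto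
    then show ?thesis by (rule LIM_zero_cancel)
  qed
  then show "continuous_on UNIV (primitive g)" by (simp add: continuous_on)
qed simp

lemma square_integrable_primitive: "square_integrable (primitive g)"
  by (rule square_integrable_continuous[OF primitive_continuous])

lemma volterra_add: "volterra (f + g) = volterra f + volterra g"
  and volterra_scale: "volterra (r *\<^sub>R f) = r *\<^sub>R volterra f"
  unfolding volterra_def abs_l2_add[OF square_integrable_primitive square_integrable_primitive]
    abs_l2_scale[OF square_integrable_primitive]
  by (rule arg_cong[where f = abs_l2], rule ext, simp add: primitive_add primitive_scale)+

lemma norm_volterra: "norm (volterra g) \<le> norm g"
  unfolding volterra_def
  by (rule norm_abs_l2_le) (auto intro: square_integrable_measurable square_integrable_primitive primitive_bound)

lemma volterra_bounded_linear: "bounded_linear volterra"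
  by (rule bounded_linear_intro[of _ 1]) (auto simp: volterra_add volterra_scale norm_volterra)

lemma volterra_zero: "volterra 0 = 0" and volterra_diff: "volterra (f - g) = volterra f - volterra g"
  using bounded_linear.linear[OF volterra_bounded_linear] by (auto simp: linear_0 linear_diff)

lemma l2_dominated_convergence:
  fixes s :: "nat \<Rightarrow> real \<Rightarrow> real"
  assumes f: "square_integrable f" and s: "\<And>n. square_integrable (s n)" and w: "square_integrable w"
    and bound: "\<And>n. AE x in I01. \<bar>s n x - f x\<bar> \<le> w x"
    and lim: "AE x in I01. (\<lambda>n. s n x) \<longlonglongrightarrow> f x"
  shows "(\<lambda>n. abs_l2 (s n)) \<longlonglongrightarrow> abs_l2 f"
proof -
  note [measurable] = square_integrable_measurable[OF f] square_integrable_measurable[OF s]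
  have "(\<lambda>n. LINT x|I01. (s n x - f x)\<^sup>2) \<longlonglongrightarrow> (LINT x|I01. 0)"
  proof (rule integral_dominated_convergence[where w = "\<lambda>x. (w x)\<^sup>2"])
    show "integrable I01 (\<lambda>x. (w x)\<^sup>2)" using w by (simp add: square_integrable_def)
    show "AE x in I01. (\<lambda>n. (s n x - f x)\<^sup>2) \<longlonglongrightarrow> 0"
      using lim
    proof eventually_elim
      fix x assume "(\<lambda>n. s n x) \<longlonglongrightarrow> f x"
      then have "(\<lambda>n. (s n x - f x)\<^sup>2) \<longlonglongrightarrow> (f x - f x)\<^sup>2" by (intro tendsto_intros)
      then show "(\<lambda>n. (s n x - f x)\<^sup>2) \<longlonglongrightarrow> 0" by simp
    qed
    show "AE x in I01. norm ((s n x - f x)\<^sup>2) \<le> (w x)\<^sup>2" for n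
      using bound[of n] by eventually_elim (simp add: abs_le_square_iff[symmetric])
  qed simp_all
  moreover have "(LINT x|I01. (s n x - f x)\<^sup>2) = (norm (abs_l2 (s n) - abs_l2 f))\<^sup>2" for n
    unfolding abs_l2_diff[OF s f] by (rule norm_abs_l2[OF square_integrable_diff[OF s f], symmetric])
  ultimately have "(\<lambda>n. (norm (abs_l2 (s n) - abs_l2 f))\<^sup>2) \<longlonglongrightarrow> 0" by simp
  then have "(\<lambda>n. sqrt ((norm (abs_l2 (s n) - abs_l2 f))\<^sup>2)) \<longlonglongrightarrow> sqrt 0" by (rule tendsto_real_sqrt)
  then have "(\<lambda>n. norm (abs_l2 (s n) - abs_l2 f)) \<longlonglongrightarrow> 0" by simp
  then show ?thesis using LIM_zero_cancel tendsto_norm_zero_cancel by metis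
qed

definition clip :: "real \<Rightarrow> real \<Rightarrow> real" where "clip B t = max (- B) (min B t)"

lemma clip_bound: "B \<ge> 0 \<Longrightarrow> \<bar>clip B t\<bar> \<le> B"
  by (auto simp: clip_def)

lemma clip_continuous: "continuous_on S f \<Longrightarrow> continuous_on S (\<lambda>x. clip B (f x))"
  unfolding clip_def by (intro continuous_intros)

lemma clip_tendsto: "(f \<longlongrightarrow> l) F \<Longrightarrow> ((\<lambda>x. clip B (f x)) \<longlongrightarrow> clip B l) F"
  unfolding clip_def by (intro tendsto_intros)

lemma clip_id: "\<bar>t\<bar> \<le> B \<Longrightarrow> clip B t = t"
  by (auto simp: clip_def)

text \<open>A measurable function is almost everywhere a limit of continuous functions; after clipping, dominated
convergence applies.\<close>

lemma continuous_dense_l2: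
  obtains k :: "nat \<Rightarrow> real \<Rightarrow> real" where "\<And>n. continuous_on UNIV (k n)" "(\<lambda>n. abs_l2 (k n)) \<longlonglongrightarrow> f"
proof -
  let ?C = "abs_l2 ` {k. continuous_on UNIV k}"
  have bounded: "abs_l2 F \<in> closure ?C" if F: "F \<in> borel_measurable I01" "\<And>x. \<bar>F x\<bar> \<le> B" for F B
  proof -
    have B: "B \<ge> 0" using F(2)[of 0] by simp
    have "F measurable_on {0<..<1}" using F(1) by (simp add: measurable_on_iff_borel_measurable)
    then obtain Z g where Z: "negligible Z" and g: "\<And>n. continuous_on UNIV (g n)"
      and lim: "\<And>x. x \<notin> Z \<Longrightarrow> (\<lambda>n. g n x) \<longlonglongrightarrow> (if x \<in> {0<..<1} then F x else 0)"
      unfolding measurable_on_def by (metis (full_types))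
    have "(\<lambda>n. abs_l2 (\<lambda>x. clip B (g n x))) \<longlonglongrightarrow> abs_l2 F"
    proof (rule l2_dominated_convergence[where w = "\<lambda>x. 2 * B"])
      show "square_integrable F" by (rule square_integrable_bounded[of _ B]) (use F in auto)
      show "square_integrable (\<lambda>x. clip B (g n x))" for n
        by (intro square_integrable_continuous clip_continuous continuous_on_subset[OF g]) auto
      show "square_integrable (\<lambda>x. 2 * B)" by (rule square_integrable_const)
      show "AE x in I01. \<bar>clip B (g n x) - F x\<bar> \<le> 2 * B" for n
      proof (rule AE_I2)
        fix x show "\<bar>clip B (g n x) - F x\<bar> \<le> 2 * B"
          using F(2)[of x] clip_bound[OF B, of "g n x"] by linarith
      qed
      have "AE x in lebesgue. x \<notin> Z" using Z by (simp add: negligible_iff_null_sets AE_not_in)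
      then have "AE x in lebesgue. x \<in> {0<..<1} \<longrightarrow> x \<notin> Z" by eventually_elim simp
      then have "AE x in I01. x \<notin> Z" by (subst AE_restrict_space_iff) auto
      moreover have "AE x in I01. x \<in> {0<..<1}" by (rule AE_I2) simp
      ultimately show "AE x in I01. (\<lambda>n. clip B (g n x)) \<longlonglongrightarrow> F x"
      proof eventually_elim
        fix x assume "x \<notin> Z" "x \<in> {0<..<1::real}"
        then have "(\<lambda>n. g n x) \<longlonglongrightarrow> F x" using lim[of x] by simp
        then have "(\<lambda>n. clip B (g n x)) \<longlonglongrightarrow> clip B (F x)" by (rule clip_tendsto)
        then show "(\<lambda>n. clip B (g n x)) \<longlonglongrightarrow> F x" using F(2) by (simp add: clip_id)
      qed
    qed
    moreover have "abs_l2 (\<lambda>x. clip B (g n x)) \<in> ?C" for n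
      using clip_continuous[OF g[of n]] by blast
    ultimately show ?thesis unfolding closure_sequential by (intro exI[of _ "\<lambda>n. abs_l2 (\<lambda>x. clip B (g n x))"]) blast
  qed
  let ?F = "rep_l2 f"
  have "(\<lambda>n. abs_l2 (\<lambda>x. clip (real n) (?F x))) \<longlonglongrightarrow> abs_l2 ?F"
  proof (rule l2_dominated_convergence[where w = "\<lambda>x. \<bar>?F x\<bar>"])
    show "square_integrable (\<lambda>x. clip (real n) (?F x))" for n
      by (rule square_integrable_bounded[of _ "real n"])
        (auto simp: clip_bound intro: measurable_compose[OF measurable_rep_l2] simp: clip_def)
    show "square_integrable (\<lambda>x. \<bar>?F x\<bar>)" using square_integrable_rep[of f] by (simp add: square_integrable_def)
    show "AE x in I01. \<bar>clip (real n) (?F x) - ?F x\<bar> \<le> \<bar>?F x\<bar>" for n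
      by (rule AE_I2) (auto simp: clip_def)
    show "AE x in I01. (\<lambda>n. clip (real n) (?F x)) \<longlonglongrightarrow> ?F x"
    proof (rule AE_I2)
      fix x
      obtain n0 :: nat where "\<bar>?F x\<bar> \<le> real n0" using real_arch_simple by blast
      then have "\<forall>n\<ge>n0. clip (real n) (?F x) = ?F x" by (auto intro!: clip_id)
      then have "\<forall>\<^sub>F n in sequentially. clip (real n) (?F x) = ?F x" by (auto simp: eventually_sequentially)
      then show "(\<lambda>n. clip (real n) (?F x)) \<longlonglongrightarrow> ?F x" by (rule tendsto_eventually)
    qed
  qed (rule square_integrable_rep)
  moreover have "abs_l2 (\<lambda>x. clip (real n) (?F x)) \<in> closure ?C" for n
    by (rule bounded[of _ "real n"])
      (auto simp: clip_bound intro: measurable_compose[OF measurable_rep_l2] simp: clip_def)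
  ultimately have "abs_l2 ?F \<in> closure (closure ?C)"
    unfolding closure_sequential[of _ "closure ?C"]
    by (intro exI[of _ "\<lambda>n. abs_l2 (\<lambda>x. clip (real n) (?F x))"]) blast
  then have "f \<in> closure ?C" by (simp add: abs_rep_l2)
  then obtain c where c: "\<And>n. c n \<in> ?C" "c \<longlonglongrightarrow> f" unfolding closure_sequential by blast
  then obtain k where k: "\<And>n. continuous_on UNIV (k n)" "\<And>n. c n = abs_l2 (k n)"
    unfolding image_iff mem_Collect_eq Bex_def by metis
  have "c = (\<lambda>n. abs_l2 (k n))" using k(2) by auto
  then show ?thesis using that[of k] k(1) c(2) by simp
qed

lemma square_integrable_sum:
  "(\<And>i. i \<in> I \<Longrightarrow> square_integrable (F i)) \<Longrightarrow> square_integrable (\<lambda>x. \<Sum>i\<in>I. F i x)"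
  by (induction I rule: infinite_finite_induct) (auto simp: square_integrable_zero square_integrable_add)

lemma abs_l2_sum:
  "(\<And>i. i \<in> I \<Longrightarrow> square_integrable (F i)) \<Longrightarrow> (\<Sum>i\<in>I. abs_l2 (F i)) = abs_l2 (\<lambda>x. \<Sum>i\<in>I. F i x)"
  by (induction I rule: infinite_finite_induct)
    (auto simp: zero_l2_def abs_l2_add square_integrable_sum)

text \<open>The difference of two neighbouring vectors \<open>below\<close> is the indicator of one cell of the grid, so the sum
is the function that is constant on each cell.  Applied to a continuous function it shows that the vectors
\<open>below x\<close> span a dense subspace; applied to a primitive it approximates the Volterra operator by
operators of finite rank.\<close>

lemma norm_step_approximation:
  fixes H :: "real \<Rightarrow> real"
  assumes n: "n > 0" and H: "continuous_on UNIV H"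
    and close: "\<And>i x. i < n \<Longrightarrow> real i / n \<le> x \<Longrightarrow> x \<le> real (Suc i) / n \<Longrightarrow> \<bar>H x - H (real i / n)\<bar> \<le> \<delta>"
    and delta: "\<delta> \<ge> 0"
  shows "norm (abs_l2 H - (\<Sum>i<n. H (real i / n) *\<^sub>R (below (real (Suc i) / n) - below (real i / n)))) \<le> \<delta>"
proof -
  define st where "st = (\<lambda>i x. H (real i / n) * (indicator {0<..<real (Suc i) / n} x - indicator {0<..<real i / n} x))"
  have sqs: "square_integrable (st i)" for i
    unfolding st_def by (intro square_integrable_scale square_integrable_diff square_integrable_below)
  have sqH: "square_integrable H" by (rule square_integrable_continuous) (rule continuous_on_subset[OF H], simp)
  have "H (real i / n) *\<^sub>R (below (real (Suc i) / n) - below (real i / n)) = abs_l2 (st i)" for i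
    unfolding below_def st_def
    by (simp only: abs_l2_diff[OF square_integrable_below square_integrable_below]
      abs_l2_scale[OF square_integrable_diff[OF square_integrable_below square_integrable_below]])
  then have "abs_l2 H - (\<Sum>i<n. H (real i / n) *\<^sub>R (below (real (Suc i) / n) - below (real i / n)))
    = abs_l2 (\<lambda>x. H x - (\<Sum>i<n. st i x))"
    by (simp add: abs_l2_sum[OF sqs] abs_l2_diff[OF sqH square_integrable_sum[OF sqs]])
  also have "norm \<dots> \<le> \<delta>"
  proof (rule norm_abs_l2_le)
    show "(\<lambda>x. H x - (\<Sum>i<n. st i x)) \<in> borel_measurable I01"
      by (rule square_integrable_measurable[OF square_integrable_diff[OF sqH square_integrable_sum[OF sqs]]])
    show "AE x in I01. \<bar>H x - (\<Sum>i<n. st i x)\<bar> \<le> \<delta>"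
    proof (rule AE_I2)
      fix x assume "x \<in> space I01"
      then have x: "0 < x" "x < 1" by auto
      (* the cell that contains x *)
      define j where "j = nat \<lfloor>x * n\<rfloor>"
      have j1: "real j \<le> x * n" "x * n < real j + 1" using x by (auto simp: j_def)
      have "x * n < n" using x n by simp
      then have jn: "j < n" using j1 by linarith
      have j: "real j / n \<le> x" "x < real (Suc j) / n"
        using j1 n by (auto simp: field_simps)
      have "st i x = (if i = j then H (real j / n) else 0)" for i
      proof -
        consider "i < j" | "i = j" | "i > j" by linarith
        then show ?thesis
        proof cases
          case 1
          then have "real (Suc i) \<le> real j" by simp
          then have "real (Suc i) / n \<le> real j / n" by (rule divide_right_mono) simp
          moreover have "real i / n \<le> real (Suc i) / n" by (rule divide_right_mono) auto
          ultimately show ?thesis using 1 j unfolding st_def by (auto simp: indicator_def)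
        next
          case 2
          then show ?thesis using j x by (auto simp: st_def indicator_def)
        next
          case 3
          then have "real (Suc j) \<le> real i" by simp
          then have "real (Suc j) / n \<le> real i / n" by (rule divide_right_mono) simp
          moreover have "real i / n \<le> real (Suc i) / n" by (rule divide_right_mono) auto
          ultimately show ?thesis using 3 j x unfolding st_def by (auto simp: indicator_def)
        qed
      qed
      then have "(\<Sum>i<n. st i x) = H (real j / n)" using jn by simp
      then show "\<bar>H x - (\<Sum>i<n. st i x)\<bar> \<le> \<delta>" using close[OF jn j(1)] j(2) by simp
    qed
  qed (rule delta)
  finally show ?thesis .
qed

lemma orthogonal_to_below_imp_zero:
  assumes "\<And>x. x \<in> {0..1} \<Longrightarrow> inner h (below x) = 0"
  shows "h = 0"
proof -
  have cont: "inner h (abs_l2 k) = 0" if k: "continuous_on UNIV k" for k :: "real \<Rightarrow> real"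
  proof -
    have bound: "\<bar>inner h (abs_l2 k)\<bar> \<le> norm h * e" if e: "e > 0" for e
    proof -
      have "uniformly_continuous_on {0..1} k"
        by (rule compact_uniformly_continuous[OF continuous_on_subset[OF k]]) auto
      then obtain d where d: "d > 0" "\<And>x y. x \<in> {0..1} \<Longrightarrow> y \<in> {0..1} \<Longrightarrow> dist y x < d \<Longrightarrow> dist (k y) (k x) < e"
        unfolding uniformly_continuous_on_def using e by meson
      obtain n :: nat where n: "n > 0" "1 / n < d"
        using d(1) by (metis ex_inverse_of_nat_less inverse_eq_divide)
      let ?s = "\<Sum>i<n. k (real i / n) *\<^sub>R (below (real (Suc i) / n) - below (real i / n))"
      have "norm (abs_l2 k - ?s) \<le> e"
      proof (rule norm_step_approximation[OF n(1) k])
        fix i x assume i: "i < n" and x: "real i / n \<le> x" "x \<le> real (Suc i) / n"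
        have "real (Suc i) / n \<le> 1" using i n by (simp add: field_simps)
        moreover have "real (Suc i) / n = real i / n + 1 / n" by (simp add: add_divide_distrib)
        moreover have "0 \<le> real i / n" by simp
        moreover from this have "0 \<le> x" using x(1) by (rule order_trans)
        ultimately have "x \<in> {0..1}" "real i / n \<in> {0..1}" "dist x (real i / n) < d"
          using x n(2) by (auto simp: dist_real_def)
        then show "\<bar>k x - k (real i / n)\<bar> \<le> e" using d(2)[of "real i / n" x] by (simp add: dist_real_def)
      qed (use e in simp)
      moreover have "inner h ?s = 0"
        unfolding inner_sum_right
      proof (rule sum.neutral, rule ballI)
        fix i assume "i \<in> {..<n}"
        then have "real (Suc i) / n \<in> {0..1}" "real i / n \<in> {0..1}" by auto
        then show "inner h (k (real i / n) *\<^sub>R (below (real (Suc i) / n) - below (real i / n))) = 0"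
          by (simp add: assms inner_diff_right)
      qed
      ultimately have "\<bar>inner h (abs_l2 k)\<bar> = \<bar>inner h (abs_l2 k - ?s)\<bar>" by (simp add: inner_diff_right)
      also have "\<dots> \<le> norm h * norm (abs_l2 k - ?s)" by (rule Cauchy_Schwarz_ineq2)
      also have "\<dots> \<le> norm h * e" using \<open>norm (abs_l2 k - ?s) \<le> e\<close> by (rule mult_left_mono) simp
      finally show ?thesis .
    qed
    have "\<bar>inner h (abs_l2 k)\<bar> \<le> 0 + e" if "e > 0" for e
    proof -
      have "\<bar>inner h (abs_l2 k)\<bar> \<le> norm h * (e / (norm h + 1))"
        by (rule bound) (use that in \<open>simp add: add_nonneg_pos\<close>)
      also have "\<dots> \<le> (norm h + 1) * (e / (norm h + 1))"
        using that by (intro mult_right_mono) auto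
      also have "\<dots> = e"
        by (smt (verit) norm_ge_zero nonzero_mult_div_cancel_left times_divide_eq_right)
      finally show ?thesis by simp
    qed
    then have "\<bar>inner h (abs_l2 k)\<bar> \<le> 0" by (rule field_le_epsilon)
    then show ?thesis by simp
  qed
  obtain k where k: "\<And>n. continuous_on UNIV (k n)" "(\<lambda>n. abs_l2 (k n)) \<longlonglongrightarrow> h"
    using continuous_dense_l2[of h] by blast
  have "(\<lambda>n. inner h (abs_l2 (k n))) \<longlonglongrightarrow> inner h h" by (intro tendsto_intros k)
  then have "inner h h = 0" using cont[OF k(1)] by (simp add: LIMSEQ_const_iff)
  then show ?thesis by simp
qed

lemma volterra_step_error:
  assumes n: "n > 0"
  shows "norm (volterra g - (\<Sum>i<n. primitive g (real i / n) *\<^sub>R (below (real (Suc i) / n) - below (real i / n))))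
     \<le> norm g * sqrt (1 / n)"
  unfolding volterra_def
proof (rule norm_step_approximation[OF n primitive_continuous])
  fix i x assume x: "real i / n \<le> x" "x \<le> real (Suc i) / n"
  have "real (Suc i) / n = real i / n + 1 / n" by (simp add: add_divide_distrib)
  then have "sqrt \<bar>x - real i / n\<bar> \<le> sqrt (1 / n)" using x by simp
  then have "norm g * sqrt \<bar>x - real i / n\<bar> \<le> norm g * sqrt (1 / n)" by (rule mult_left_mono) simp
  then show "\<bar>primitive g x - primitive g (real i / n)\<bar> \<le> norm g * sqrt (1 / n)"
    using primitive_Holder[of g x "real i / n"] by linarith
qed simp

section \<open>Weak derivatives\<close>

lemma inner_one_abs_l2:
  assumes "continuous_on {0..1} s"
  shows "inner one_l2 (abs_l2 s) = integral {0..1} s"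
proof -
  have sq: "square_integrable s" by (rule square_integrable_continuous[OF assms])
  have "integrable I01 (\<lambda>x. 1 * s x)" by (rule square_integrable_mult[OF square_integrable_const sq])
  then have "(LINT x|I01. s x) = integral {0<..<1} s"
    by (intro lebesgue_integral_eq_integral) auto
  then show ?thesis
    by (simp add: one_l2_def inner_abs_l2[OF square_integrable_const sq] integral_open_interval_real)
qed

lemma inner_abs_l2_continuous:
  assumes "continuous_on {0..1} f" "continuous_on {0..1} s"
  shows "inner (abs_l2 f) (abs_l2 s) = integral {0..1} (\<lambda>x. f x * s x)"
proof -
  have "inner (abs_l2 f) (abs_l2 s) = inner one_l2 (abs_l2 (\<lambda>x. f x * s x))"
    unfolding one_l2_def
    by (subst (1 2) inner_abs_l2)
      (auto intro!: square_integrable_continuous square_integrable_const continuous_intros assms)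
  then show ?thesis using inner_one_abs_l2[of "\<lambda>x. f x * s x"] assms by (simp add: continuous_on_mult)
qed

lemma primitive_abs_l2:
  assumes k: "continuous_on {0..1} k" and x: "x \<in> {0..1}"
  shows "primitive (abs_l2 k) x = integral {0..x} k"
proof -
  have sq: "square_integrable k" by (rule square_integrable_continuous[OF k])
  have "integrable (lebesgue_on {0<..<x}) k"
  proof -
    have "k absolutely_integrable_on {0..x}"
      by (rule absolutely_integrable_continuous_real, rule continuous_on_subset[OF k]) (use x in auto)
    then have "k absolutely_integrable_on {0<..<x}"
      by (rule set_integrable_subset) auto
    then show ?thesis by (simp add: integrable_restrict_space set_integrable_def)
  qed
  then have "integral\<^sup>L (lebesgue_on {0<..<x}) k = integral {0<..<x} k"
    by (rule lebesgue_integral_eq_integral) simp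
  moreover have "(LINT s|I01. k s * indicator {0<..<x} s) = integral\<^sup>L (lebesgue_on {0<..<x}) k"
  proof -
    have "indicator {0<..<1} s *\<^sub>R (k s * indicator {0<..<x} s) = indicator {0<..<x} s *\<^sub>R k s" for s
      using x by (auto simp: indicator_def)
    note eq = this
    have "(LINT s|I01. k s * indicator {0<..<x} s) = (LINT s|lebesgue. indicator {0<..<1} s *\<^sub>R (k s * indicator {0<..<x} s))"
      by (rule integral_restrict_space) simp
    also have "\<dots> = (LINT s|lebesgue. indicator {0<..<x} s *\<^sub>R k s)" by (simp only: eq)
    also have "\<dots> = integral\<^sup>L (lebesgue_on {0<..<x}) k"
      by (rule integral_restrict_space[symmetric]) simp
    finally show ?thesis .
  qed
  ultimately show ?thesis
    by (simp add: primitive_def below_def inner_abs_l2[OF sq square_integrable_below] integral_open_interval_real)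
qed

text \<open>The functions $p(1/x)e^{-1/x}$, extended by zero, are closed under differentiation, so each of them is
smooth.\<close>

definition flat :: "real poly \<Rightarrow> real \<Rightarrow> real" where
  "flat p x = (if x \<le> 0 then 0 else poly p (1 / x) * exp (- (1 / x)))"

definition flat_deriv :: "real poly \<Rightarrow> real poly" where
  "flat_deriv p = [:0, 0, 1:] * (p - pderiv p)"

lemma poly_times_exp_tendsto_0: "((\<lambda>y::real. poly p y * exp (- y)) \<longlongrightarrow> 0) at_top"
proof -
  have "((\<lambda>y::real. \<Sum>i\<le>degree p. coeff p i * (y ^ i / exp y)) \<longlongrightarrow> 0) at_top"
    by (intro tendsto_null_sum tendsto_mult_right_zero tendsto_power_div_exp_0)
  then show ?thesis
    by (simp add: poly_altdef sum_distrib_right exp_minus divide_inverse mult.assoc)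
qed

lemma flat_has_derivative: "(flat p has_real_derivative flat (flat_deriv p) x) (at x)"
proof -
  consider "x < 0" | "x = 0" | "x > 0" by linarith
  then show ?thesis
  proof cases
    case 1
    have "((\<lambda>x. 0) has_real_derivative 0) (at x)" by simp
    then have "(flat p has_real_derivative 0) (at x)"
      by (rule DERIV_cong_ev[THEN iffD1, rotated 3])
        (use 1 in \<open>auto simp: flat_def intro!: eventually_nhds_in_open[of "{..<0}", THEN eventually_mono]\<close>)
    then show ?thesis using 1 by (simp add: flat_def)
  next
    case 3
    have "((\<lambda>x. poly p (1 / x) * exp (- (1 / x))) has_real_derivative
        (poly (pderiv p) (1 / x) * (- (1 / x\<^sup>2)) * exp (- (1 / x)) + poly p (1 / x) * (exp (- (1 / x)) * (1 / x\<^sup>2)))) (at x)"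
      using 3 by (auto intro!: derivative_eq_intros DERIV_chain2[OF poly_DERIV] simp: power2_eq_square)
    also have "(poly (pderiv p) (1 / x) * (- (1 / x\<^sup>2)) * exp (- (1 / x)) + poly p (1 / x) * (exp (- (1 / x)) * (1 / x\<^sup>2)))
       = flat (flat_deriv p) x"
      using 3 by (simp add: flat_def flat_deriv_def power2_eq_square algebra_simps)
    finally show ?thesis
      by (rule DERIV_cong_ev[THEN iffD1, rotated 3])
        (use 3 in \<open>auto simp: flat_def intro!: eventually_nhds_in_open[of "{0<..}", THEN eventually_mono]\<close>)
  next
    case 2
    have "((\<lambda>h. (flat p (0 + h) - flat p 0) / h) \<longlongrightarrow> 0) (at 0)"
    proof (rule filterlim_split_at)
      show "((\<lambda>h. (flat p (0 + h) - flat p 0) / h) \<longlongrightarrow> 0) (at_left 0)"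
        by (rule tendsto_eventually) (auto simp: flat_def eventually_at_left_field intro!: exI[of _ "-1"])
      have "((\<lambda>h. poly (pCons 0 p) (inverse h) * exp (- inverse h)) \<longlongrightarrow> 0) (at_right (0::real))"
        by (rule filterlim_compose[OF poly_times_exp_tendsto_0 filterlim_inverse_at_top_right])
      then show "((\<lambda>h. (flat p (0 + h) - flat p 0) / h) \<longlongrightarrow> 0) (at_right 0)"
        by (rule Lim_transform_eventually)
          (auto simp: flat_def eventually_at_right_field divide_inverse intro!: exI[of _ 1])
    qed
    then show ?thesis using 2 by (simp add: DERIV_def flat_def)
  qed
qed

text \<open>A class of functions that is closed under differentiation and rich enough to contain all the test
functions that are needed.\<close>

inductive_set bumps :: "(real \<Rightarrow> real) set" where
  product: "(\<lambda>x. r * (flat p (a * x + b) * flat q (a' * x + b'))) \<in> bumps"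
| sum: "f \<in> bumps \<Longrightarrow> g \<in> bumps \<Longrightarrow> (\<lambda>x. f x + g x) \<in> bumps"

lemma bumps_scale: "f \<in> bumps \<Longrightarrow> (\<lambda>x. s * f x) \<in> bumps"
proof (induction rule: bumps.induct)
  case (product r p a b q a' b')
  have "(\<lambda>x. (s * r) * (flat p (a * x + b) * flat q (a' * x + b'))) \<in> bumps" by (rule bumps.product)
  then show ?case by (simp add: mult.assoc)
next
  case (sum f g)
  show ?case unfolding distrib_left by (rule bumps.sum[OF sum.IH])
qed

lemma bumps_derivative: "f \<in> bumps \<Longrightarrow> \<exists>f'\<in>bumps. \<forall>x. (f has_real_derivative f' x) (at x)"
proof (induction rule: bumps.induct)
  case (product r p a b q a' b')
  define f' where "f' = (\<lambda>x. (r * a) * (flat (flat_deriv p) (a * x + b) * flat q (a' * x + b'))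
    + (r * a') * (flat p (a * x + b) * flat (flat_deriv q) (a' * x + b')))"
  have "f' \<in> bumps" unfolding f'_def by (intro bumps.sum bumps.product)
  moreover have "((\<lambda>x. r * (flat p (a * x + b) * flat q (a' * x + b'))) has_real_derivative f' x) (at x)" for x
    unfolding f'_def
    by (auto intro!: derivative_eq_intros DERIV_chain2[OF flat_has_derivative] simp: algebra_simps)
  ultimately show ?case by blast
next
  case (sum f g)
  then obtain f' g' where "f' \<in> bumps" "g' \<in> bumps" "\<And>x. (f has_real_derivative f' x) (at x)"
    "\<And>x. (g has_real_derivative g' x) (at x)" by blast
  then show ?case by (intro bexI[of _ "\<lambda>x. f' x + g' x"]) (auto intro!: DERIV_add bumps.sum)
qed

lemma bumps_deriv:
  assumes "f \<in> bumps"
  shows "deriv f \<in> bumps" "f field_differentiable at x"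
proof -
  obtain f' where f': "f' \<in> bumps" "\<And>x. (f has_real_derivative f' x) (at x)"
    using bumps_derivative[OF assms] by blast
  then have "deriv f = f'" by (intro ext DERIV_imp_deriv)
  then show "deriv f \<in> bumps" using f' by simp
  show "f field_differentiable at x" using f'(2) field_differentiable_def by blast
qed

lemma bumps_continuous: "f \<in> bumps \<Longrightarrow> continuous_on S f"
  using bumps_derivative by (metis DERIV_continuous_on has_field_derivative_at_within)

lemma bumps_smooth: "f \<in> bumps \<Longrightarrow> (deriv ^^ n) f \<in> bumps"
  by (induction n) (auto simp: bumps_deriv)

text \<open>A smooth function supported in $[c,d]$; as $k\to\infty$ it tends to the indicator of $(c,d)$ because
$e^{-1/(ky)}\to 1$ for every $y>0$.\<close>

definition bump :: "real \<Rightarrow> real \<Rightarrow> real \<Rightarrow> real \<Rightarrow> real" where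
  "bump c d k x = flat 1 (k * (x - c)) * flat 1 (k * (d - x))"

lemma bump_in_bumps: "bump c d k \<in> bumps"
proof -
  have "(\<lambda>x. 1 * (flat 1 (k * x + (- k * c)) * flat 1 ((- k) * x + k * d))) \<in> bumps" by (rule bumps.product)
  moreover have "(\<lambda>x. 1 * (flat 1 (k * x + (- k * c)) * flat 1 ((- k) * x + k * d))) = bump c d k"
    by (intro ext) (simp add: bump_def algebra_simps)
  ultimately show ?thesis by simp
qed

lemma flat_1_bounds: "0 \<le> flat 1 x" "flat 1 x \<le> 1"
  by (auto simp: flat_def)

lemma bump_bounds: "\<bar>bump c d k x\<bar> \<le> 1"
  using flat_1_bounds mult_le_one[of "flat 1 (k * (x - c))" "flat 1 (k * (d - x))"]
  by (simp add: bump_def)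

lemma bump_outside: "k > 0 \<Longrightarrow> x \<notin> {c..d} \<Longrightarrow> bump c d k x = 0"
  by (auto simp: bump_def flat_def mult_le_0_iff)

lemma bump_tendsto:
  "(\<lambda>n. bump c d (real (Suc n)) x) \<longlonglongrightarrow> indicator {c<..<d} x"
proof -
  have step: "(\<lambda>n. flat 1 (real (Suc n) * y)) \<longlonglongrightarrow> (if y > 0 then 1 else 0)" for y
  proof (cases "y > 0")
    case True
    have "(\<lambda>n. exp (- (inverse (real (Suc n)) * inverse y))) \<longlonglongrightarrow> exp (- (0 * inverse y))"
      by (intro tendsto_intros LIMSEQ_inverse_real_of_nat)
    moreover have "flat 1 (real (Suc n) * y) = exp (- (inverse (real (Suc n)) * inverse y))" for n
    proof -
      have "real (Suc n) * y > 0" using True by simp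
      then show ?thesis by (simp add: flat_def divide_inverse del: of_nat_Suc)
    qed
    ultimately show ?thesis using True by simp
  next
    case False
    then have "flat 1 (real (Suc n) * y) = 0" for n by (auto simp: flat_def mult_nonneg_nonpos)
    then show ?thesis using False by simp
  qed
  have "(\<lambda>n. bump c d (real (Suc n)) x) \<longlonglongrightarrow> (if x - c > 0 then 1 else 0) * (if d - x > 0 then 1 else 0)"
    unfolding bump_def by (intro tendsto_mult step)
  also have "(if x - c > 0 then 1 else 0) * (if d - x > 0 then 1 else 0) = (indicator {c<..<d} x :: real)"
    by (auto simp: indicator_def)
  finally show ?thesis .
qed

lemma square_integrable_indicator: "square_integrable (indicator {c<..<d::real})"
proof (rule square_integrable_bounded[of _ 1])
  show "(indicator {c<..<d} :: real \<Rightarrow> real) \<in> borel_measurable I01"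
    by (rule measurable_restrict_space1, rule borel_measurable_indicator) simp
qed (auto simp: indicator_def)

text \<open>In the limit the bumps become indicators, so the primitive of \<open>h\<close> is constant on $(0,1)$; as it is continuous
and vanishes at $0$, it is zero.\<close>

lemma orthogonal_to_bumps_imp_zero:
  assumes orth: "\<And>c d k. 0 < c \<Longrightarrow> c < d \<Longrightarrow> d < 1 \<Longrightarrow> k > 0 \<Longrightarrow> inner h (abs_l2 (bump c d k)) = 0"
  shows "h = 0"
proof (rule orthogonal_to_below_imp_zero)
  have const: "primitive h d = primitive h c" if cd: "0 < c" "c < d" "d < 1" for c d
  proof -
    have "(\<lambda>n. abs_l2 (bump c d (real (Suc n)))) \<longlonglongrightarrow> abs_l2 (indicator {c<..<d})"
    proof (rule l2_dominated_convergence[where w = "\<lambda>x. 2"])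
      show "square_integrable (indicator {c<..<d} :: real \<Rightarrow> real)"
        by (rule square_integrable_indicator)
      show "square_integrable (bump c d (real (Suc n)))" for n
        by (rule square_integrable_continuous[OF bumps_continuous[OF bump_in_bumps]])
      show "AE x in I01. \<bar>bump c d (real (Suc n)) x - indicator {c<..<d} x\<bar> \<le> 2" for n
      proof (rule AE_I2)
        fix x show "\<bar>bump c d (real (Suc n)) x - indicator {c<..<d} x\<bar> \<le> 2"
          using bump_bounds[of c d "real (Suc n)" x] by (auto simp: indicator_def)
      qed
      show "AE x in I01. (\<lambda>n. bump c d (real (Suc n)) x) \<longlonglongrightarrow> indicator {c<..<d} x"
        by (rule AE_I2) (rule bump_tendsto)
    qed (rule square_integrable_const)
    then have "(\<lambda>n. inner h (abs_l2 (bump c d (real (Suc n))))) \<longlonglongrightarrow> inner h (abs_l2 (indicator {c<..<d}))"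
      by (intro tendsto_intros)
    moreover have "inner h (abs_l2 (bump c d (real (Suc n)))) = 0" for n by (rule orth) (use cd in auto)
    ultimately have "inner h (abs_l2 (indicator {c<..<d})) = 0" by (simp add: LIMSEQ_const_iff)
    moreover have "abs_l2 (indicator {c<..<d}) = below d - below c"
      unfolding below_def abs_l2_diff[OF square_integrable_below square_integrable_below]
    proof (rule abs_l2_eqI)
      show "square_integrable (indicator {c<..<d} :: real \<Rightarrow> real)"
        by (rule square_integrable_indicator)
      show "square_integrable (\<lambda>x. indicator {0<..<d} x - indicator {0<..<c} x)"
        by (intro square_integrable_diff square_integrable_below)
      have "AE x in lebesgue. x \<noteq> c" by (rule AE_lborel_singleton[THEN AE_completion])
      then have "AE x in lebesgue. x \<in> {0<..<1} \<longrightarrow> x \<noteq> c" by eventually_elim simp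
      then have "AE x in I01. x \<noteq> c" by (subst AE_restrict_space_iff) auto
      moreover have "AE x in I01. 0 < x" by (rule AE_I2) simp
      ultimately show "AE x in I01. indicator {c<..<d} x = (indicator {0<..<d} x - indicator {0<..<c} x :: real)"
        by eventually_elim (use cd in \<open>auto simp: indicator_def\<close>)
    qed
    ultimately show ?thesis by (simp add: primitive_def inner_diff_right)
  qed
  have zero: "primitive h x = 0" if x: "0 < x" "x < 1" for x
  proof -
    have "\<bar>primitive h x\<bar> \<le> norm h * sqrt t" if t: "0 < t" "t < x" for t
      using const[of t x] primitive_Holder[of h t 0] t x by (simp add: primitive_0)
    then have "\<forall>\<^sub>F t in at_right 0. \<bar>primitive h x\<bar> \<le> norm h * sqrt t"
      unfolding eventually_at_right_field using x by blast
    moreover have "((\<lambda>t. norm h * sqrt t) \<longlongrightarrow> norm h * sqrt 0) (at_right 0)" by (intro tendsto_intros)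
    ultimately have "\<bar>primitive h x\<bar> \<le> norm h * sqrt 0" by (intro tendsto_lowerbound) auto
    then show ?thesis by simp
  qed
  have "primitive h 1 = 0"
  proof -
    have "\<bar>primitive h 1\<bar> \<le> norm h * sqrt t" if t: "0 < t" "t < 1" for t
      using zero[of "1 - t"] primitive_Holder[of h 1 "1 - t"] t by simp
    then have "\<forall>\<^sub>F t in at_right 0. \<bar>primitive h 1\<bar> \<le> norm h * sqrt t"
      unfolding eventually_at_right_field by (intro exI[of _ "1 :: real"]) auto
    moreover have "((\<lambda>t. norm h * sqrt t) \<longlongrightarrow> norm h * sqrt 0) (at_right 0)" by (intro tendsto_intros)
    ultimately have "\<bar>primitive h 1\<bar> \<le> norm h * sqrt 0" by (intro tendsto_lowerbound) auto
    then show ?thesis by simp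
  qed
  then show "inner h (below x) = 0" if "x \<in> {0..1}" for x
    using zero[of x] that primitive_0[of h] unfolding primitive_def
    by (cases "x = 0 \<or> x = 1") auto
qed

lemma test_functionD:
  assumes "test_function \<phi>"
  shows "(\<phi> has_real_derivative deriv \<phi> x) (at x)" "continuous_on S \<phi>" "continuous_on S (deriv \<phi>)"
    "\<phi> 0 = 0" "\<phi> 1 = 0"
proof -
  have d: "((deriv ^^ n) \<phi>) field_differentiable at x" for n x
    using assms by (simp add: test_function_def)
  show D: "(\<phi> has_real_derivative deriv \<phi> x) (at x)" for x
    using d[of 0 x] by (simp add: DERIV_deriv_iff_field_differentiable)
  show "continuous_on S \<phi>"
    by (intro continuous_at_imp_continuous_on ballI field_differentiable_imp_continuous_at) (use d[of 0] in simp)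
  show "continuous_on S (deriv \<phi>)"
    by (intro continuous_at_imp_continuous_on ballI field_differentiable_imp_continuous_at) (use d[of 1] in simp)
  obtain c d where "0 < c" "d < 1" "\<And>x. x \<notin> {c..d} \<Longrightarrow> \<phi> x = 0"
    using assms unfolding test_function_def by blast
  then show "\<phi> 0 = 0" "\<phi> 1 = 0" by auto
qed

lemma test_function_primitive:
  assumes s: "s \<in> bumps" and cd: "0 < c" "c \<le> d" "d < 1" and out: "\<And>x. x \<notin> {c..d} \<Longrightarrow> s x = 0"
    and int: "integral {0..1} s = 0"
  obtains \<phi> where "test_function \<phi>" "deriv \<phi> = s"
proof -
  have "continuous_on UNIV s" by (rule bumps_continuous[OF s])
  then have "\<exists>F. \<forall>x. -\<infinity> < ereal x \<longrightarrow> ereal x < \<infinity> \<longrightarrow> (F has_vector_derivative s x) (at x)"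
    by (intro einterval_antiderivative) (auto simp: continuous_on_eq_continuous_at)
  then obtain F where F: "\<And>x. (F has_vector_derivative s x) (at x)" by auto
  have diff: "(s has_integral (F y - F x)) {x..y}" if "x \<le> y" for x y
    by (rule fundamental_theorem_of_calculus[OF that]) (rule has_vector_derivative_at_within[OF F])
  have zero: "F y = F x" if "x \<le> y" "\<And>t. x < t \<Longrightarrow> t < y \<Longrightarrow> s t = 0" for x y
  proof -
    have "(s has_integral 0) {x..y}"
      by (rule has_integral_spike_finite[of "{x, y}" _ _ "\<lambda>x. 0"]) (use that in auto)
    from has_integral_unique[OF diff[OF that(1)] this] show ?thesis by simp
  qed
  (* constant outside the support of s, with the same constant on both sides since s has integral 0 *)
  define \<phi> where "\<phi> = (\<lambda>x. F x - F c)"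
  have D: "(\<phi> has_real_derivative s x) (at x)" for x
    unfolding \<phi>_def using F[of x]
    by (auto intro!: derivative_eq_intros simp: has_real_derivative_iff_has_vector_derivative[symmetric])
  have ds: "deriv \<phi> = s" by (intro ext DERIV_imp_deriv D)
  have "F 1 = F 0"
    using integral_unique[OF diff[of 0 1]] int by simp
  moreover have "F 0 = F c" using zero[of 0 c] cd out by fastforce
  moreover have "F d = F 1" using zero[of d 1] cd out by fastforce
  ultimately have "F d = F c" by simp
  have "\<phi> x = 0" if "x \<notin> {c..d}" for x
  proof (cases "x < c")
    case True
    then have "F c = F x" by (intro zero) (use out in auto)
    then show ?thesis by (simp add: \<phi>_def)
  next
    case False
    then have "F x = F d" by (intro zero) (use out that in auto)
    then show ?thesis using \<open>F d = F c\<close> by (simp add: \<phi>_def)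
  qed
  moreover have "(deriv ^^ n) \<phi> field_differentiable at x" for n x
  proof (cases n)
    case 0
    then show ?thesis using D[of x] by (auto simp: field_differentiable_def)
  next
    case (Suc m)
    have "(deriv ^^ Suc m) \<phi> = (deriv ^^ m) s" by (simp only: funpow_Suc_right o_apply ds)
    then show ?thesis using Suc bumps_deriv(2)[OF bumps_smooth[OF s]] by simp
  qed
  ultimately have "test_function \<phi>" unfolding test_function_def using cd by blast
  then show ?thesis using that ds by blast
qed

text \<open>The du Bois-Reymond lemma.  A combination of two bumps with integral zero is the derivative of a test
function, so $h$ acts on bumps as a multiple of the integral.\<close>

lemma orthogonal_to_derivatives_imp_constant:
  assumes orth: "\<And>\<phi>. test_function \<phi> \<Longrightarrow> inner h (abs_l2 (deriv \<phi>)) = 0"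
  obtains c where "h = c *\<^sub>R one_l2"
proof -
  (* some bump has nonzero integral, because the constant 1 is not orthogonal to all of them *)
  have "one_l2 \<noteq> 0" using norm_one_l2 by auto
  then obtain c0 d0 k0 where th: "0 < c0" "c0 < d0" "d0 < 1" "k0 > 0" and I: "inner one_l2 (abs_l2 (bump c0 d0 k0)) \<noteq> 0"
    using orthogonal_to_bumps_imp_zero[of one_l2] by blast
  define I0 where "I0 = inner one_l2 (abs_l2 (bump c0 d0 k0))"
  define r where "r = inner h (abs_l2 (bump c0 d0 k0)) / I0"
  have "h - r *\<^sub>R one_l2 = 0"
  proof (rule orthogonal_to_bumps_imp_zero)
    fix c d k :: real assume cd: "0 < c" "c < d" "d < 1" "k > 0"
    define s where "s = (\<lambda>x. bump c d k x + (- (inner one_l2 (abs_l2 (bump c d k)) / I0)) * bump c0 d0 k0 x)"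
    have s: "s \<in> bumps" unfolding s_def by (intro bumps.sum bumps_scale bump_in_bumps)
    have sqb: "square_integrable (bump c d k)" for c d k
      by (rule square_integrable_continuous[OF bumps_continuous[OF bump_in_bumps]])
    have abs_s: "abs_l2 s = abs_l2 (bump c d k) - (inner one_l2 (abs_l2 (bump c d k)) / I0) *\<^sub>R abs_l2 (bump c0 d0 k0)"
    proof -
      have "s = (\<lambda>x. bump c d k x - (inner one_l2 (abs_l2 (bump c d k)) / I0) * bump c0 d0 k0 x)"
        by (simp add: s_def fun_eq_iff)
      then show ?thesis
        by (simp only: abs_l2_scale[OF sqb] abs_l2_diff[OF sqb square_integrable_scale[OF sqb]])
    qed
    have "integral {0..1} s = inner one_l2 (abs_l2 s)"
      by (rule inner_one_abs_l2[OF bumps_continuous[OF s], symmetric])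
    also have "\<dots> = 0" unfolding abs_s using I by (simp add: inner_diff_right I0_def)
    finally have int: "integral {0..1} s = 0" .
    have out: "s x = 0" if "x \<notin> {min c c0..max d d0}" for x
    proof -
      have "x \<notin> {c..d}" "x \<notin> {c0..d0}" using that by (auto simp: min_def max_def split: if_splits)
      then have "bump c d k x = 0" "bump c0 d0 k0 x = 0"
        using bump_outside[OF cd(4)] bump_outside[OF th(4)] by blast+
      then show ?thesis by (simp add: s_def)
    qed
    have "0 < min c c0" "min c c0 \<le> max d d0" "max d d0 < 1" using th cd by auto
    from test_function_primitive[OF s this out int]
    obtain \<phi> where "test_function \<phi>" "deriv \<phi> = s" by blast
    then have "inner h (abs_l2 s) = 0" using orth by blast
    then show "inner (h - r *\<^sub>R one_l2) (abs_l2 (bump c d k)) = 0"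
      unfolding abs_s by (simp add: inner_diff_right inner_diff_left r_def mult_ac)
  qed
  then show ?thesis using that[of r] by simp
qed

text \<open>For a continuous density this is integration by parts; both sides are continuous in \<open>g\<close>.\<close>

lemma integral_by_parts_volterra:
  assumes phi: "test_function \<phi>"
  shows "inner (volterra g) (abs_l2 (deriv \<phi>)) = - inner g (abs_l2 \<phi>)"
proof -
  note T = test_functionD[OF phi]
  have cont: "inner (volterra (abs_l2 k)) (abs_l2 (deriv \<phi>)) = - inner (abs_l2 k) (abs_l2 \<phi>)"
    if k: "continuous_on UNIV k" for k :: "real \<Rightarrow> real"
  proof -
    have k01: "continuous_on {0..1} k" by (rule continuous_on_subset[OF k]) simp
    define K where "K = primitive (abs_l2 k)"
    have K: "continuous_on S K" for S unfolding K_def by (rule primitive_continuous)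
    have DK: "(K has_real_derivative k x) (at x within {0..1})" if "x \<in> {0..1}" for x
    proof -
      have "((\<lambda>x. integral {0..x} k) has_real_derivative k x) (at x within {0..1})"
        by (rule integral_has_real_derivative[OF k01 that])
      then show ?thesis
        by (rule has_field_derivative_transform_within[where d = 1])
          (use that in \<open>auto simp: K_def primitive_abs_l2[OF k01]\<close>)
    qed
    have "((\<lambda>x. K x * \<phi> x) has_real_derivative (k x * \<phi> x + K x * deriv \<phi> x)) (at x within {0..1})"
      if "x \<in> {0..1}" for x
      using DERIV_mult[OF DK[OF that] has_field_derivative_at_within[OF T(1)]] by (simp add: algebra_simps)
    then have "((\<lambda>x. k x * \<phi> x + K x * deriv \<phi> x) has_integral (K 1 * \<phi> 1 - K 0 * \<phi> 0)) {0..1}"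
      by (intro fundamental_theorem_of_calculus)
        (auto simp: has_real_derivative_iff_has_vector_derivative[symmetric])
    then have "integral {0..1} (\<lambda>x. k x * \<phi> x + K x * deriv \<phi> x) = 0"
      by (simp add: T integral_unique)
    moreover have "integral {0..1} (\<lambda>x. k x * \<phi> x + K x * deriv \<phi> x)
       = integral {0..1} (\<lambda>x. k x * \<phi> x) + integral {0..1} (\<lambda>x. K x * deriv \<phi> x)"
      by (intro Henstock_Kurzweil_Integration.integral_add integrable_continuous_real continuous_intros k01 K T)
    ultimately have "integral {0..1} (\<lambda>x. K x * deriv \<phi> x) = - integral {0..1} (\<lambda>x. k x * \<phi> x)" by simp
    then show ?thesis
      unfolding volterra_def K_def[symmetric]
      by (simp add: inner_abs_l2_continuous K T k01)
  qed
  obtain k where k: "\<And>n. continuous_on UNIV (k n)" "(\<lambda>n. abs_l2 (k n)) \<longlonglongrightarrow> g"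
    using continuous_dense_l2[of g] by blast
  have "(\<lambda>n. inner (volterra (abs_l2 (k n))) (abs_l2 (deriv \<phi>))) \<longlonglongrightarrow> inner (volterra g) (abs_l2 (deriv \<phi>))"
    by (intro tendsto_inner bounded_linear.tendsto[OF volterra_bounded_linear] k tendsto_const)
  moreover have "(\<lambda>n. - inner (abs_l2 (k n)) (abs_l2 \<phi>)) \<longlonglongrightarrow> - inner g (abs_l2 \<phi>)"
    by (intro tendsto_inner tendsto_minus k tendsto_const)
  ultimately show ?thesis using LIMSEQ_unique unfolding cont[OF k(1)] by blast
qed

text \<open>The description of $H^1$ on which everything else rests: its elements are the functions
$c+\int_0^x g$.\<close>

lemma has_weak_deriv_iff: "has_weak_deriv f g \<longleftrightarrow> (\<exists>c. f = c *\<^sub>R one_l2 + volterra g)"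
proof
  assume w: "has_weak_deriv f g"
  have "inner (f - volterra g) (abs_l2 (deriv \<phi>)) = 0" if "test_function \<phi>" for \<phi>
    using w that integral_by_parts_volterra[OF that, of g]
    by (simp add: has_weak_deriv_def inner_diff_left)
  then obtain c where "f - volterra g = c *\<^sub>R one_l2"
    by (rule orthogonal_to_derivatives_imp_constant)
  then show "\<exists>c. f = c *\<^sub>R one_l2 + volterra g" by (metis diff_add_cancel)
next
  assume "\<exists>c. f = c *\<^sub>R one_l2 + volterra g"
  then obtain c where f: "f = c *\<^sub>R one_l2 + volterra g" by blast
  show "has_weak_deriv f g"
    unfolding has_weak_deriv_def
  proof (intro allI impI)
    fix \<phi> assume phi: "test_function \<phi>"
    note T = test_functionD[OF phi]
    have "(deriv \<phi> has_integral (\<phi> 1 - \<phi> 0)) {0..1}"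
      by (rule fundamental_theorem_of_calculus)
        (auto simp: has_real_derivative_iff_has_vector_derivative[symmetric] intro!: has_field_derivative_at_within T)
    then have "inner one_l2 (abs_l2 (deriv \<phi>)) = 0"
      by (simp add: inner_one_abs_l2[OF T(3)] integral_unique T)
    then show "inner f (abs_l2 (deriv \<phi>)) = - inner g (abs_l2 \<phi>)"
      using integral_by_parts_volterra[OF phi, of g] by (simp add: f inner_add_left)
  qed
qed

section \<open>Calculus in $H^1(0,1)$\<close>

lemma affine_l2: "c *\<^sub>R one_l2 + volterra g = abs_l2 (\<lambda>x. c + primitive g x)"
  unfolding one_l2_def volterra_def
  by (simp add: abs_l2_scale[OF square_integrable_const] abs_l2_add[OF square_integrable_const square_integrable_primitive])

lemma affine_continuous: "continuous_on S (\<lambda>x. c + primitive g x)"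
  by (intro continuous_intros primitive_continuous)

lemma continuous_AE_unique:
  fixes F G :: "real \<Rightarrow> real"
  assumes F: "continuous_on {0..1} F" and G: "continuous_on {0..1} G"
    and eq: "AE x in I01. F x = G x" and x: "x \<in> {0..1}"
  shows "F x = G x"
proof -
  let ?h = "\<lambda>x. (F x - G x)\<^sup>2"
  have h: "continuous_on {0..1} ?h" by (intro continuous_intros F G)
  have "abs_l2 ?h = abs_l2 (\<lambda>x. 0)"
  proof (rule abs_l2_eqI[OF square_integrable_continuous[OF h] square_integrable_zero])
    show "AE x in I01. ?h x = 0" using eq by eventually_elim simp
  qed
  then have "abs_l2 ?h = 0" by (simp add: zero_l2_def)
  then have "integral {0..1} ?h = 0" using inner_one_abs_l2[OF h] by simp
  then have "(?h has_integral 0) (cbox 0 1)"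
    using integrable_integral[OF integrable_continuous_real[OF h]] by simp
  then have "?h x = 0"
    by (rule has_integral_0_cbox_imp_0[rotated 2]) (use h x in auto)
  then show ?thesis by simp
qed

lemma point_value_affine:
  assumes x: "x \<in> {0..1}"
  shows "point_value (c *\<^sub>R one_l2 + volterra g) x = c + primitive g x"
  unfolding point_value_def
proof (rule the_equality)
  have AE: "AE s in I01. rep_l2 (c *\<^sub>R one_l2 + volterra g) s = c + primitive g s"
    unfolding affine_l2 by (rule AE_rep_abs[OF square_integrable_continuous[OF affine_continuous]])
  show "\<exists>F. continuous_on {0..1} F \<and> (AE s in I01. F s = rep_l2 (c *\<^sub>R one_l2 + volterra g) s) \<and> F x = c + primitive g x"
    using AE by (intro exI[of _ "\<lambda>x. c + primitive g x"]) (auto simp: affine_continuous)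
  fix d assume "\<exists>F. continuous_on {0..1} F \<and> (AE s in I01. F s = rep_l2 (c *\<^sub>R one_l2 + volterra g) s) \<and> F x = d"
  then obtain F where F: "continuous_on {0..1} F" "AE s in I01. F s = rep_l2 (c *\<^sub>R one_l2 + volterra g) s" "F x = d"
    by blast
  have "AE s in I01. F s = c + primitive g s" using F(2) AE by eventually_elim simp
  then show "d = c + primitive g x" using continuous_AE_unique[OF F(1) affine_continuous _ x] F(3) by blast
qed

lemma affine_inject:
  assumes "c *\<^sub>R one_l2 + volterra g = d *\<^sub>R one_l2 + volterra k"
  shows "c = d" "g = k"
proof -
  have eq: "c + primitive g x = d + primitive k x" if "x \<in> {0..1}" for x
    using point_value_affine[OF that] assms by metis
  from eq[of 0] show cd: "c = d" by (simp add: primitive_0)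
  have "g - k = 0"
    by (rule orthogonal_to_below_imp_zero) (use eq cd in \<open>simp add: primitive_def inner_diff_left\<close>)
  then show "g = k" by simp
qed

lemma weak_deriv_eq: "has_weak_deriv f g \<Longrightarrow> weak_deriv f = g"
  unfolding weak_deriv_def
  by (rule the_equality) (auto simp: has_weak_deriv_iff dest: affine_inject)

lemma affine_in_H1: "c *\<^sub>R one_l2 + volterra g \<in> H1"
  and weak_deriv_affine: "weak_deriv (c *\<^sub>R one_l2 + volterra g) = g"
  using weak_deriv_eq[of "c *\<^sub>R one_l2 + volterra g" g] by (auto simp: H1_def has_weak_deriv_iff)

lemma H1_expand: "f \<in> H1 \<Longrightarrow> f = point_value f 0 *\<^sub>R one_l2 + volterra (weak_deriv f)"
  by (auto simp: H1_def has_weak_deriv_iff weak_deriv_affine point_value_affine primitive_0)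

lemma point_value_H1:
  "f \<in> H1 \<Longrightarrow> x \<in> {0..1} \<Longrightarrow> point_value f x = point_value f 0 + primitive (weak_deriv f) x"
  by (subst H1_expand) (simp_all add: point_value_affine)

text \<open>The isomorphism between $\mathbb{R}\times L^2$ and $H^1$ given by the value at $0$ and the derivative.\<close>

definition make_h1 :: "real \<times> l2 \<Rightarrow> h1" where
  "make_h1 p = Abs_h1 (fst p *\<^sub>R one_l2 + volterra (snd p), snd p)"

lemma h1_fun_make [simp]: "h1_fun (make_h1 (c, g)) = c *\<^sub>R one_l2 + volterra g"
  and h1_deriv_make [simp]: "h1_deriv (make_h1 (c, g)) = g"
  unfolding make_h1_def
  by (simp_all add: h1_fun.rep_eq h1_deriv.rep_eq Abs_h1_inverse has_weak_deriv_iff exI[of _ c])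

lemma h1_weak_deriv: "has_weak_deriv (h1_fun y) (h1_deriv y)"
  using Rep_h1[of y] by (auto simp: h1_fun.rep_eq h1_deriv.rep_eq split: prod.splits)

lemma h1_fun_in_H1: "h1_fun y \<in> H1" and weak_deriv_h1_fun: "weak_deriv (h1_fun y) = h1_deriv y"
  using h1_weak_deriv[of y] weak_deriv_eq by (auto simp: H1_def)

lemma h1_fun_expand: "h1_fun y = h1_value y 0 *\<^sub>R one_l2 + volterra (h1_deriv y)"
  using H1_expand[OF h1_fun_in_H1, of y] by (simp add: weak_deriv_h1_fun)

lemma h1_value_expand: "x \<in> {0..1} \<Longrightarrow> h1_value y x = h1_value y 0 + primitive (h1_deriv y) x"
  using point_value_H1[OF h1_fun_in_H1, of x y] by (simp add: weak_deriv_h1_fun)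

lemma h1_value_make [simp]: "x \<in> {0..1} \<Longrightarrow> h1_value (make_h1 (c, g)) x = c + primitive g x"
  by (simp add: point_value_affine)

lemma Rep_h1_eq: "Rep_h1 y = (h1_fun y, h1_deriv y)"
  by (simp add: h1_fun.rep_eq h1_deriv.rep_eq)

lemma h1_eqI: "h1_fun y = h1_fun w \<Longrightarrow> y = w"
  by (metis Rep_h1_eq Rep_h1_inject weak_deriv_h1_fun)

lemma h1_eqI2: "h1_value y 0 = h1_value w 0 \<Longrightarrow> h1_deriv y = h1_deriv w \<Longrightarrow> y = w"
  by (rule h1_eqI, subst h1_fun_expand[of y], subst h1_fun_expand[of w]) simp

lemma to_h1_h1_fun: "to_h1 (h1_fun y) = y"
  unfolding to_h1_def by (rule the_equality) (auto intro: h1_eqI)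

lemma to_h1_affine: "to_h1 (c *\<^sub>R one_l2 + volterra g) = make_h1 (c, g)"
  using to_h1_h1_fun[of "make_h1 (c, g)"] by simp

lemma h1_fun_to_h1: "f \<in> H1 \<Longrightarrow> h1_fun (to_h1 f) = f"
  by (metis H1_expand h1_fun_make to_h1_h1_fun)

lemma h1_deriv_to_h1: "f \<in> H1 \<Longrightarrow> h1_deriv (to_h1 f) = weak_deriv f"
  using weak_deriv_h1_fun[of "to_h1 f"] by (simp add: h1_fun_to_h1)

lemma h1_fun_add: "h1_fun (y + w) = h1_fun y + h1_fun w"
  and h1_fun_scale: "h1_fun (r *\<^sub>R y) = r *\<^sub>R h1_fun y"
  and h1_deriv_add: "h1_deriv (y + w) = h1_deriv y + h1_deriv w"
  and h1_deriv_scale: "h1_deriv (r *\<^sub>R y) = r *\<^sub>R h1_deriv y"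
  by (simp_all add: h1_fun.rep_eq h1_deriv.rep_eq plus_h1.rep_eq scaleR_h1.rep_eq)

lemma norm_h1_eq: "norm y = norm (h1_fun y, h1_deriv y)" for y :: h1
  by (simp add: norm_eq_sqrt_inner inner_h1.rep_eq Rep_h1_eq)

lemma norm_h1_fun: "norm (h1_fun y) \<le> norm y" and norm_h1_deriv: "norm (h1_deriv y) \<le> norm y"
  unfolding norm_h1_eq[of y] by (simp_all add: norm_fst_le norm_snd_le del: norm_Pair)

lemma h1_fun_bounded_linear: "bounded_linear h1_fun"
  by (rule bounded_linear_intro[of _ 1]) (auto simp: h1_fun_add h1_fun_scale norm_h1_fun)

lemma h1_deriv_bounded_linear: "bounded_linear h1_deriv"
  by (rule bounded_linear_intro[of _ 1]) (auto simp: h1_deriv_add h1_deriv_scale norm_h1_deriv)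

lemma h1_value_add_0: "h1_value (y + w) 0 = h1_value y 0 + h1_value w 0"
  and h1_value_scale_0: "h1_value (r *\<^sub>R y) 0 = r * h1_value y 0"
proof -
  have "h1_fun (y + w) = (h1_value y 0 + h1_value w 0) *\<^sub>R one_l2 + volterra (h1_deriv (y + w))"
    by (subst h1_fun_add, subst (1 2) h1_fun_expand) (simp add: h1_deriv_add volterra_add algebra_simps)
  then show "h1_value (y + w) 0 = h1_value y 0 + h1_value w 0"
    by (simp add: point_value_affine primitive_0)
  have "h1_fun (r *\<^sub>R y) = (r * h1_value y 0) *\<^sub>R one_l2 + volterra (h1_deriv (r *\<^sub>R y))"
    by (subst h1_fun_scale, subst h1_fun_expand) (simp add: h1_deriv_scale volterra_scale algebra_simps)
  then show "h1_value (r *\<^sub>R y) 0 = r * h1_value y 0"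
    by (simp add: point_value_affine primitive_0)
qed

lemma h1_value_bounded_linear:
  assumes x: "x \<in> {0..1}"
  shows "bounded_linear (\<lambda>y. h1_value y x)"
proof (rule bounded_linear_intro[of _ 3])
  show "h1_value (y + w) x = h1_value y x + h1_value w x" for y w
    by (simp add: h1_value_expand[OF x] h1_value_add_0 h1_deriv_add primitive_add)
  show "h1_value (r *\<^sub>R y) x = r *\<^sub>R h1_value y x" for r y
    by (simp add: h1_value_expand[OF x] h1_value_scale_0 h1_deriv_scale primitive_scale algebra_simps)
  show "norm (h1_value y x) \<le> norm y * 3" for y
  proof -
    have "\<bar>h1_value y 0\<bar> = norm (h1_value y 0 *\<^sub>R one_l2)" by (simp add: norm_one_l2)
    also have "\<dots> = norm (h1_fun y - volterra (h1_deriv y))" by (subst (2) h1_fun_expand) simp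
    also have "\<dots> \<le> norm (h1_fun y) + norm (volterra (h1_deriv y))" by (rule norm_triangle_ineq4)
    also have "\<dots> \<le> norm y + norm y"
      using norm_h1_fun[of y] norm_h1_deriv[of y] norm_volterra[of "h1_deriv y"] by linarith
    finally show ?thesis
      using h1_value_expand[OF x, of y] primitive_bound[of "h1_deriv y" x] norm_h1_deriv[of y] by simp
  qed
qed

lemma make_h1_bounded_linear: "bounded_linear make_h1"
proof (rule bounded_linear_intro[of _ 3])
  show "make_h1 (p + q) = make_h1 p + make_h1 q" for p q
    by (rule h1_eqI, cases p, cases q) (simp add: h1_fun_add volterra_add algebra_simps)
  show "make_h1 (r *\<^sub>R p) = r *\<^sub>R make_h1 p" for r p
    by (rule h1_eqI, cases p) (simp add: h1_fun_scale volterra_scale algebra_simps)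
  show "norm (make_h1 p) \<le> norm p * 3" for p
  proof -
    obtain c g where p: "p = (c, g)" by fastforce
    have "norm (make_h1 p) \<le> norm (c *\<^sub>R one_l2 + volterra g) + norm g"
      unfolding norm_h1_eq p by (simp add: norm_Pair_le del: norm_Pair)
    also have "norm (c *\<^sub>R one_l2 + volterra g) \<le> \<bar>c\<bar> + norm g"
      using norm_triangle_ineq[of "c *\<^sub>R one_l2" "volterra g"] norm_volterra[of g] by (simp add: norm_one_l2)
    finally show ?thesis
      using norm_fst_le[of c g] norm_snd_le[of g c] by (simp add: p)
  qed
qed

instance h1 :: banach
proof
  fix X :: "nat \<Rightarrow> h1" assume X: "Cauchy X"
  have "Cauchy (\<lambda>n. h1_fun (X n))" "Cauchy (\<lambda>n. h1_deriv (X n))"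
    using X by (auto intro: bounded_linear.Cauchy h1_fun_bounded_linear h1_deriv_bounded_linear)
  then obtain f g where f: "(\<lambda>n. h1_fun (X n)) \<longlonglongrightarrow> f" and g: "(\<lambda>n. h1_deriv (X n)) \<longlonglongrightarrow> g"
    by (meson Cauchy_convergent convergent_def)
  have "has_weak_deriv f g"
    unfolding has_weak_deriv_def
  proof (intro allI impI)
    fix \<phi> assume phi: "test_function \<phi>"
    have "(\<lambda>n. inner (h1_fun (X n)) (abs_l2 (deriv \<phi>))) \<longlonglongrightarrow> inner f (abs_l2 (deriv \<phi>))"
      by (intro tendsto_inner f tendsto_const)
    moreover have "(\<lambda>n. - inner (h1_deriv (X n)) (abs_l2 \<phi>)) \<longlonglongrightarrow> - inner g (abs_l2 \<phi>)"
      by (intro tendsto_inner tendsto_minus g tendsto_const)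
    moreover have "inner (h1_fun (X n)) (abs_l2 (deriv \<phi>)) = - inner (h1_deriv (X n)) (abs_l2 \<phi>)" for n
      using h1_weak_deriv[of "X n"] phi by (simp add: has_weak_deriv_def)
    ultimately show "inner f (abs_l2 (deriv \<phi>)) = - inner g (abs_l2 \<phi>)" using LIMSEQ_unique by simp
  qed
  then have fg: "h1_fun (Abs_h1 (f, g)) = f" "h1_deriv (Abs_h1 (f, g)) = g"
    by (simp_all add: h1_fun.rep_eq h1_deriv.rep_eq Abs_h1_inverse)
  have "(\<lambda>n. norm (X n - Abs_h1 (f, g))) \<longlonglongrightarrow> 0"
  proof -
    have diff: "h1_fun (X n - Abs_h1 (f, g)) = h1_fun (X n) - f" "h1_deriv (X n - Abs_h1 (f, g)) = h1_deriv (X n) - g" for n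
      using bounded_linear.linear[OF h1_fun_bounded_linear] bounded_linear.linear[OF h1_deriv_bounded_linear] fg
      by (simp_all add: linear_diff)
    have "(\<lambda>n. norm (h1_fun (X n) - f, h1_deriv (X n) - g)) \<longlonglongrightarrow> norm (f - f, g - g)"
      by (intro tendsto_norm tendsto_Pair tendsto_diff f g tendsto_const)
    then show ?thesis unfolding norm_h1_eq diff by (simp add: norm_Pair)
  qed
  then have "X \<longlonglongrightarrow> Abs_h1 (f, g)" by (rule LIM_zero_cancel[OF tendsto_norm_zero_cancel])
  then show "convergent X" by (auto simp: convergent_def)
qed

definition mulc :: "(real \<Rightarrow> real) \<Rightarrow> l2 \<Rightarrow> l2" where
  "mulc b f = abs_l2 (\<lambda>x. b x * rep_l2 f x)"

lemma square_integrable_mul: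
  assumes b: "continuous_on {0..1} b" and f: "square_integrable f"
  shows "square_integrable (\<lambda>x. b x * f x)"
proof -
  obtain B where B: "B \<ge> 0" "\<And>x. x \<in> {0..1} \<Longrightarrow> \<bar>b x\<bar> \<le> B" using continuous_bounded_01[OF b] by blast
  note [measurable] = measurable_I01_continuous[OF b] square_integrable_measurable[OF f]
  show ?thesis
    unfolding square_integrable_def
  proof
    show "integrable I01 (\<lambda>x. (b x * f x)\<^sup>2)"
    proof (rule Bochner_Integration.integrable_bound)
      show "integrable I01 (\<lambda>x. B\<^sup>2 * (f x)\<^sup>2)" using f by (simp add: square_integrable_def)
      show "AE x in I01. norm ((b x * f x)\<^sup>2) \<le> norm (B\<^sup>2 * (f x)\<^sup>2)"
      proof (rule AE_I2)
        fix x assume "x \<in> space I01"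
        then have "\<bar>b x\<bar> \<le> B" using B(2)[of x] by simp
        then have "(b x)\<^sup>2 \<le> B\<^sup>2" using B(1) by (simp add: abs_le_square_iff[symmetric])
        then show "norm ((b x * f x)\<^sup>2) \<le> norm (B\<^sup>2 * (f x)\<^sup>2)"
          by (simp add: power_mult_distrib mult_right_mono)
      qed
    qed simp
  qed simp
qed

lemma mulc_abs_l2:
  assumes b: "continuous_on {0..1} b" and f: "square_integrable f"
  shows "mulc b (abs_l2 f) = abs_l2 (\<lambda>x. b x * f x)"
  unfolding mulc_def
  by (rule abs_l2_eqI[OF square_integrable_mul[OF b square_integrable_rep] square_integrable_mul[OF b f]])
    (use AE_rep_abs[OF f] in eventually_elim, simp)

lemma mulc_cong:
  assumes "\<And>x. x \<in> {0..1} \<Longrightarrow> b x = c x" and b: "continuous_on {0..1} b"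
  shows "mulc b f = mulc c f"
proof -
  have c: "continuous_on {0..1} c" using b assms(1) by (rule continuous_on_eq)
  show ?thesis
    unfolding mulc_def
    by (rule abs_l2_eqI[OF square_integrable_mul[OF b square_integrable_rep] square_integrable_mul[OF c square_integrable_rep]])
      (rule AE_I2, simp add: assms(1))
qed

lemma mulc_add:
  assumes b: "continuous_on {0..1} b"
  shows "mulc b (f + g) = mulc b f + mulc b g"
proof (cases f rule: l2_cases, cases g rule: l2_cases)
  fix F H assume F: "square_integrable F" "f = abs_l2 F" and H: "square_integrable H" "g = abs_l2 H"
  show ?thesis
    unfolding F(2) H(2) abs_l2_add[OF F(1) H(1)] mulc_abs_l2[OF b F(1)] mulc_abs_l2[OF b H(1)]
      mulc_abs_l2[OF b square_integrable_add[OF F(1) H(1)]]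
      abs_l2_add[OF square_integrable_mul[OF b F(1)] square_integrable_mul[OF b H(1)]]
    by (simp add: distrib_left)
qed

lemma mulc_scale:
  assumes b: "continuous_on {0..1} b"
  shows "mulc b (r *\<^sub>R f) = r *\<^sub>R mulc b f"
proof (cases f rule: l2_cases)
  fix F assume F: "square_integrable F" "f = abs_l2 F"
  show ?thesis
    unfolding F(2) abs_l2_scale[OF F(1)] mulc_abs_l2[OF b F(1)] mulc_abs_l2[OF b square_integrable_scale[OF F(1)]]
      abs_l2_scale[OF square_integrable_mul[OF b F(1)]]
    by (simp add: mult.left_commute)
qed

lemma mulc_diff_left:
  assumes b: "continuous_on {0..1} b" and c: "continuous_on {0..1} c"
  shows "mulc (\<lambda>x. b x - c x) f = mulc b f - mulc c f"
  unfolding mulc_def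
    abs_l2_diff[OF square_integrable_mul[OF b square_integrable_rep] square_integrable_mul[OF c square_integrable_rep]]
  by (simp add: left_diff_distrib)

lemma mulc_mulc:
  assumes b: "continuous_on {0..1} b" and c: "continuous_on {0..1} c"
  shows "mulc b (mulc c f) = mulc (\<lambda>x. b x * c x) f"
proof -
  have "mulc b (mulc c f) = abs_l2 (\<lambda>x. b x * (c x * rep_l2 f x))"
    unfolding mulc_def[of c] by (rule mulc_abs_l2[OF b square_integrable_mul[OF c square_integrable_rep]])
  then show ?thesis by (simp add: mulc_def mult.assoc)
qed

lemma mulc_1: "mulc (\<lambda>x. 1) f = f"
  by (simp add: mulc_def abs_rep_l2)

lemma mulc_one_l2: "continuous_on {0..1} b \<Longrightarrow> mulc b one_l2 = abs_l2 b"
  unfolding one_l2_def by (subst mulc_abs_l2) (auto simp: square_integrable_const)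

lemma inner_mulc:
  assumes b: "continuous_on {0..1} b"
  shows "inner (mulc b f) g = inner f (mulc b g)"
proof (cases f rule: l2_cases, cases g rule: l2_cases)
  fix F H assume F: "square_integrable F" "f = abs_l2 F" and H: "square_integrable H" "g = abs_l2 H"
  show ?thesis
    unfolding F(2) H(2) mulc_abs_l2[OF b F(1)] mulc_abs_l2[OF b H(1)]
      inner_abs_l2[OF square_integrable_mul[OF b F(1)] H(1)] inner_abs_l2[OF F(1) square_integrable_mul[OF b H(1)]]
    by (simp add: mult_ac)
qed

lemma norm_mulc:
  assumes b: "continuous_on {0..1} b" and B: "\<And>x. x \<in> {0..1} \<Longrightarrow> \<bar>b x\<bar> \<le> B" "B \<ge> 0"
  shows "norm (mulc b f) \<le> B * norm f"
proof (rule power2_le_imp_le)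
  have sqf: "square_integrable (rep_l2 f)" by (rule square_integrable_rep)
  have sq: "square_integrable (\<lambda>x. b x * rep_l2 f x)" by (rule square_integrable_mul[OF b sqf])
  have "(norm (mulc b f))\<^sup>2 = (LINT x|I01. (b x * rep_l2 f x)\<^sup>2)"
    unfolding mulc_def by (rule norm_abs_l2[OF sq])
  also have "\<dots> \<le> (LINT x|I01. B\<^sup>2 * (rep_l2 f x)\<^sup>2)"
  proof (rule integral_mono)
    fix x assume "x \<in> space I01"
    then have "\<bar>b x\<bar> \<le> B" using B(1)[of x] by simp
    then have "(b x)\<^sup>2 \<le> B\<^sup>2" using B(2) by (simp add: abs_le_square_iff[symmetric])
    then show "(b x * rep_l2 f x)\<^sup>2 \<le> B\<^sup>2 * (rep_l2 f x)\<^sup>2"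
      by (simp add: power_mult_distrib mult_right_mono)
  qed (use sq sqf in \<open>auto simp: square_integrable_def\<close>)
  also have "\<dots> = B\<^sup>2 * (norm f)\<^sup>2"
    using norm_abs_l2[OF sqf] by (simp add: abs_rep_l2)
  finally show "(norm (mulc b f))\<^sup>2 \<le> (B * norm f)\<^sup>2" by (simp add: power_mult_distrib)
qed (simp add: B)

lemma mulc_bounded_linear:
  assumes b: "continuous_on {0..1} b"
  shows "bounded_linear (mulc b)"
proof -
  obtain B where B: "B \<ge> 0" "\<And>x. x \<in> {0..1} \<Longrightarrow> \<bar>b x\<bar> \<le> B" using continuous_bounded_01[OF b] by blast
  show ?thesis
    by (rule bounded_linear_intro[of _ B])
      (use norm_mulc[OF b B(2,1)] in \<open>auto simp: mulc_add[OF b] mulc_scale[OF b] mult.commute\<close>)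
qed

lemma mulc_tendsto:
  fixes b :: "nat \<Rightarrow> real \<Rightarrow> real"
  assumes bn: "\<And>n. continuous_on {0..1} (b n)" and b: "continuous_on {0..1} b0"
    and close: "\<And>n x. x \<in> {0..1} \<Longrightarrow> \<bar>b n x - b0 x\<bar> \<le> \<delta> n" and delta: "\<delta> \<longlonglongrightarrow> 0" and f: "f \<longlonglongrightarrow> f0"
  shows "(\<lambda>n. mulc (b n) (f n)) \<longlonglongrightarrow> mulc b0 f0"
proof -
  obtain B where B: "B \<ge> 0" "\<And>x. x \<in> {0..1} \<Longrightarrow> \<bar>b0 x\<bar> \<le> B" using continuous_bounded_01[OF b] by blast
  have dpos: "\<delta> n \<ge> 0" for n using close[of 0 n] by simp
  have "norm (mulc (b n) (f n) - mulc b0 f0) \<le> \<delta> n * norm (f n) + B * norm (f n - f0)" for n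
  proof -
    have "mulc (b n) (f n) - mulc b0 f0 = mulc (\<lambda>x. b n x - b0 x) (f n) + mulc b0 (f n - f0)"
      using mulc_diff_left[OF bn b, of n "f n"] mulc_add[OF b, of "f n - f0" f0] by (simp add: algebra_simps)
    also have "norm \<dots> \<le> norm (mulc (\<lambda>x. b n x - b0 x) (f n)) + norm (mulc b0 (f n - f0))"
      by (rule norm_triangle_ineq)
    also have "norm (mulc (\<lambda>x. b n x - b0 x) (f n)) \<le> \<delta> n * norm (f n)"
      by (rule norm_mulc) (auto intro!: continuous_intros bn b close dpos)
    also have "norm (mulc b0 (f n - f0)) \<le> B * norm (f n - f0)"
      by (rule norm_mulc[OF b B(2,1)])
    finally show ?thesis by simp
  qed
  then have "\<forall>\<^sub>F n in sequentially. norm (mulc (b n) (f n) - mulc b0 f0) \<le> \<delta> n * norm (f n) + B * norm (f n - f0)"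
    by simp
  moreover have "(\<lambda>n. \<delta> n * norm (f n) + B * norm (f n - f0)) \<longlonglongrightarrow> 0 * norm f0 + B * norm (f0 - f0)"
    by (intro tendsto_intros delta f)
  ultimately have "(\<lambda>n. mulc (b n) (f n) - mulc b0 f0) \<longlonglongrightarrow> 0"
    by (intro Lim_null_comparison[of "\<lambda>n. mulc (b n) (f n) - mulc b0 f0"]) simp_all
  then show ?thesis by (rule LIM_zero_cancel)
qed

lemma affine_has_derivative:
  assumes k: "continuous_on {0..1} k" and x: "x \<in> {0..1}"
  shows "((\<lambda>x. c + primitive (abs_l2 k) x) has_real_derivative k x) (at x within {0..1})"
proof -
  have "((\<lambda>x. c + integral {0..x} k) has_real_derivative (0 + k x)) (at x within {0..1})"
    by (intro DERIV_add DERIV_const integral_has_real_derivative[OF k x])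
  then have "((\<lambda>x. c + integral {0..x} k) has_real_derivative k x) (at x within {0..1})" by simp
  then show ?thesis
    by (rule has_field_derivative_transform_within[where d = 1])
      (use x in \<open>auto simp: primitive_abs_l2[OF k]\<close>)
qed

lemma primitive_of_derivative:
  assumes p': "continuous_on {0..1} p'" and p: "\<And>x. x \<in> {0..1} \<Longrightarrow> (p has_real_derivative p' x) (at x within {0..1})"
    and x: "x \<in> {0..1}"
  shows "primitive (abs_l2 p') x = p x - p 0"
proof -
  have "(p' has_integral (p x - p 0)) {0..x}"
  proof (rule fundamental_theorem_of_calculus)
    fix t assume t: "t \<in> {0..x}"
    then have "(p has_real_derivative p' t) (at t within {0..x})"
      using x by (intro has_field_derivative_subset[OF p]) auto
    then show "(p has_vector_derivative p' t) (at t within {0..x})"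
      by (simp add: has_real_derivative_iff_has_vector_derivative)
  qed (use x in simp)
  then show ?thesis using primitive_abs_l2[OF p' x] by (simp add: integral_unique)
qed

lemma primitive_tendsto: "f \<longlonglongrightarrow> g \<Longrightarrow> (\<lambda>n. primitive (f n) x) \<longlonglongrightarrow> primitive g x"
  unfolding primitive_def by (intro tendsto_inner tendsto_const)

lemma primitive_close: "\<bar>(c + primitive f x) - (c + primitive g x)\<bar> \<le> norm (f - g)"
  using primitive_bound[of "f - g" x] by (simp add: primitive_diff)

text \<open>Both sides are continuous in $g$ and $k$, and for continuous $g$ and $k$ the identity is the classical
product rule.\<close>

lemma product_rule:
  assumes x: "x \<in> {0..1}"
  shows "(c + primitive g x) * (d + primitive k x) =
    c * d + primitive (mulc (\<lambda>x. c + primitive g x) k + mulc (\<lambda>x. d + primitive k x) g) x"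
proof -
  have smooth: "(c + primitive (abs_l2 g) x) * (d + primitive (abs_l2 k) x) =
    c * d + primitive (mulc (\<lambda>x. c + primitive (abs_l2 g) x) (abs_l2 k) + mulc (\<lambda>x. d + primitive (abs_l2 k) x) (abs_l2 g)) x"
    if "continuous_on UNIV g" "continuous_on UNIV k" for g k :: "real \<Rightarrow> real"
  proof -
    have g: "continuous_on {0..1} g" and k: "continuous_on {0..1} k"
      using that continuous_on_subset by blast+
    let ?F = "\<lambda>x. c + primitive (abs_l2 g) x" and ?K = "\<lambda>x. d + primitive (abs_l2 k) x"
    have "mulc ?F (abs_l2 k) + mulc ?K (abs_l2 g) = abs_l2 (\<lambda>x. ?F x * k x + ?K x * g x)"
      by (simp add: mulc_abs_l2 affine_continuous square_integrable_continuous g k abs_l2_add square_integrable_mul)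
    moreover have "primitive (abs_l2 (\<lambda>x. ?F x * k x + ?K x * g x)) x = ?F x * ?K x - ?F 0 * ?K 0"
    proof (rule primitive_of_derivative[OF _ _ x])
      show "continuous_on {0..1} (\<lambda>x. ?F x * k x + ?K x * g x)"
        by (intro continuous_intros primitive_continuous g k)
      show "((\<lambda>x. ?F x * ?K x) has_real_derivative ?F x * k x + ?K x * g x) (at x within {0..1})" if "x \<in> {0..1}" for x
        using DERIV_mult[OF affine_has_derivative[OF g that, of c] affine_has_derivative[OF k that, of d]]
        by (simp add: algebra_simps)
    qed
    ultimately show ?thesis by (simp add: primitive_0)
  qed
  obtain gn where gn: "\<And>n. continuous_on UNIV (gn n)" "(\<lambda>n. abs_l2 (gn n)) \<longlonglongrightarrow> g"
    using continuous_dense_l2[of g] by blast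
  obtain kn where kn: "\<And>n. continuous_on UNIV (kn n)" "(\<lambda>n. abs_l2 (kn n)) \<longlonglongrightarrow> k"
    using continuous_dense_l2[of k] by blast
  have to0: "(\<lambda>n. norm (abs_l2 (gn n) - g)) \<longlonglongrightarrow> 0" "(\<lambda>n. norm (abs_l2 (kn n) - k)) \<longlonglongrightarrow> 0"
    using gn(2) kn(2) by (simp_all add: LIM_zero tendsto_norm_zero)
  have "(\<lambda>n. (c + primitive (abs_l2 (gn n)) x) * (d + primitive (abs_l2 (kn n)) x)) \<longlonglongrightarrow> (c + primitive g x) * (d + primitive k x)"
    by (intro tendsto_intros primitive_tendsto gn kn)
  moreover have "(\<lambda>n. c * d + primitive (mulc (\<lambda>x. c + primitive (abs_l2 (gn n)) x) (abs_l2 (kn n))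
      + mulc (\<lambda>x. d + primitive (abs_l2 (kn n)) x) (abs_l2 (gn n))) x)
    \<longlonglongrightarrow> c * d + primitive (mulc (\<lambda>x. c + primitive g x) k + mulc (\<lambda>x. d + primitive k x) g) x"
    by (intro tendsto_add tendsto_const primitive_tendsto mulc_tendsto[OF affine_continuous affine_continuous primitive_close] to0 gn kn)
  ultimately show ?thesis unfolding smooth[OF gn(1) kn(1)] by (rule LIMSEQ_unique)
qed

text \<open>Approximate $g$ by continuous functions; the corresponding functions $F_n$ converge uniformly and are
eventually bounded below by $a_0/2$, so the classical formula $(1/F_n)'=-F_n'/F_n^2$ passes to the
limit.\<close>

lemma reciprocal_rule:
  assumes x: "x \<in> {0..1}" and a0: "a0 > 0" and pos: "\<And>x. x \<in> {0..1} \<Longrightarrow> c + primitive g x \<ge> a0"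
  defines "r \<equiv> \<lambda>x. 1 / (c + primitive g x)"
  shows "1 / (c + primitive g x) = 1 / c + primitive (- mulc r (mulc r g)) x"
proof -
  obtain k where k: "\<And>n. continuous_on UNIV (k n)" "(\<lambda>n. abs_l2 (k n)) \<longlonglongrightarrow> g"
    using continuous_dense_l2[of g] by blast
  have to0: "(\<lambda>n. norm (abs_l2 (k n) - g)) \<longlonglongrightarrow> 0" using k(2) by (simp add: LIM_zero tendsto_norm_zero)
  then have "\<forall>\<^sub>F n in sequentially. norm (abs_l2 (k n) - g) < a0 / 2" by (rule order_tendstoD) (use a0 in simp)
  then obtain n0 where n0: "\<And>n. n \<ge> n0 \<Longrightarrow> norm (abs_l2 (k n) - g) < a0 / 2" by (auto simp: eventually_sequentially)
  (* drop the initial members, for which the lower bound may fail *)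
  define kn where "kn = (\<lambda>n. k (n + n0))"
  have kn: "\<And>n. continuous_on UNIV (kn n)" "(\<lambda>n. abs_l2 (kn n)) \<longlonglongrightarrow> g" and small: "\<And>n. norm (abs_l2 (kn n) - g) < a0 / 2"
    using k n0 LIMSEQ_ignore_initial_segment[OF k(2), of n0] by (auto simp: kn_def)
  have kn01: "continuous_on {0..1} (kn n)" for n by (rule continuous_on_subset[OF kn(1)]) simp
  have to0: "(\<lambda>n. norm (abs_l2 (kn n) - g)) \<longlonglongrightarrow> 0" using kn(2) by (simp add: LIM_zero tendsto_norm_zero)
  define F where "F = (\<lambda>n x. c + primitive (abs_l2 (kn n)) x)"
  define rn where "rn = (\<lambda>n x. 1 / F n x)"
  have F: "F n x \<ge> a0 / 2" if "x \<in> {0..1}" for n x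
    using primitive_close[of c "abs_l2 (kn n)" x g] small[of n] pos[OF that] by (simp add: F_def)
  have rcont: "continuous_on {0..1} r" unfolding r_def
    by (intro continuous_intros primitive_continuous) (use pos a0 in force)
  have rncont: "continuous_on {0..1} (rn n)" for n unfolding rn_def F_def
    by (intro continuous_intros primitive_continuous) (use F[of _ n] a0 in \<open>force simp: F_def\<close>)
  have rclose: "\<bar>rn n x - r x\<bar> \<le> norm (abs_l2 (kn n) - g) * (2 / a0\<^sup>2)" if "x \<in> {0..1}" for n x
  proof -
    let ?f = "c + primitive g x"
    have p: "?f \<ge> a0" "F n x \<ge> a0 / 2" using pos[OF that] F[OF that] by auto
    have nz: "?f > 0" "F n x > 0" using p a0 by linarith+
    have "rn n x - r x = (?f - F n x) / (F n x * ?f)"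
      using nz unfolding rn_def r_def by (simp add: divide_simps)
    then have "\<bar>rn n x - r x\<bar> = \<bar>?f - F n x\<bar> / (F n x * ?f)"
      using nz by (simp add: abs_mult)
    also have "\<dots> \<le> norm (abs_l2 (kn n) - g) / (a0 / 2 * a0)"
    proof (rule frac_le)
      show "\<bar>?f - F n x\<bar> \<le> norm (abs_l2 (kn n) - g)"
        using primitive_close[of c "abs_l2 (kn n)" x g] by (simp add: F_def abs_minus_commute)
      show "a0 / 2 * a0 \<le> F n x * ?f" using p a0 by (intro mult_mono) auto
    qed (use a0 in auto)
    also have "\<dots> = norm (abs_l2 (kn n) - g) * (2 / a0\<^sup>2)" by (simp add: power2_eq_square)
    finally show ?thesis .
  qed
  have smooth: "rn n x = 1 / c + primitive (- mulc (rn n) (mulc (rn n) (abs_l2 (kn n)))) x" for n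
  proof -
    let ?p' = "\<lambda>x. - (rn n x * (rn n x * kn n x))"
    have sq: "square_integrable (\<lambda>x. rn n x * (rn n x * kn n x))"
      by (intro square_integrable_mul square_integrable_continuous rncont kn01)
    have "- mulc (rn n) (mulc (rn n) (abs_l2 (kn n))) = (-1) *\<^sub>R abs_l2 (\<lambda>x. rn n x * (rn n x * kn n x))"
      by (simp add: mulc_abs_l2 rncont square_integrable_mul square_integrable_continuous kn01)
    also have "\<dots> = abs_l2 ?p'" unfolding abs_l2_scale[OF sq] by simp
    finally have eq: "- mulc (rn n) (mulc (rn n) (abs_l2 (kn n))) = abs_l2 ?p'" .
    have "primitive (abs_l2 ?p') x = rn n x - rn n 0"
    proof (rule primitive_of_derivative[OF _ _ x])
      show "continuous_on {0..1} ?p'" by (intro continuous_intros rncont kn01)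
      fix t :: real assume t: "t \<in> {0..1}"
      have nz: "F n t \<noteq> 0" using F[OF t, of n] a0 by auto
      have "(F n has_real_derivative kn n t) (at t within {0..1})"
        unfolding F_def by (rule affine_has_derivative[OF kn01 t])
      then have "((\<lambda>x. inverse (F n x)) has_real_derivative - (inverse (F n t) * kn n t * inverse (F n t))) (at t within {0..1})"
        using nz by (rule DERIV_inverse')
      then show "(rn n has_real_derivative ?p' t) (at t within {0..1})"
        unfolding rn_def by (simp add: divide_inverse mult_ac)
    qed
    then show ?thesis unfolding eq by (simp add: rn_def F_def primitive_0)
  qed
  have dto: "(\<lambda>n. norm (abs_l2 (kn n) - g) * (2 / a0\<^sup>2)) \<longlonglongrightarrow> 0" by (rule tendsto_mult_left_zero[OF to0])
  have "(\<lambda>n. mulc (rn n) (mulc (rn n) (abs_l2 (kn n)))) \<longlonglongrightarrow> mulc r (mulc r g)"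
    by (intro mulc_tendsto[OF rncont rcont rclose dto] kn)
  then have "(\<lambda>n. 1 / c + primitive (- mulc (rn n) (mulc (rn n) (abs_l2 (kn n)))) x) \<longlonglongrightarrow> 1 / c + primitive (- mulc r (mulc r g)) x"
    by (intro tendsto_intros primitive_tendsto)
  moreover have "(\<lambda>n. rn n x) \<longlonglongrightarrow> 1 / (c + primitive g x)"
    unfolding rn_def F_def using pos[OF x] a0 by (intro tendsto_intros primitive_tendsto kn) auto
  ultimately show ?thesis unfolding smooth by (rule LIMSEQ_unique[rotated])
qed

section \<open>Integration by parts and the domain of the operator\<close>

lemma mulc_affine:
  "mulc (\<lambda>x. c + primitive g x) (d *\<^sub>R one_l2 + volterra k) =
    (c * d) *\<^sub>R one_l2 + volterra (mulc (\<lambda>x. c + primitive g x) k + mulc (\<lambda>x. d + primitive k x) g)"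
  (is "_ = _ + volterra ?h")
proof -
  have sq: "square_integrable (\<lambda>x. c + primitive g x)" for c g
    by (rule square_integrable_continuous[OF affine_continuous])
  show ?thesis
    unfolding affine_l2 mulc_abs_l2[OF affine_continuous sq]
    by (rule abs_l2_eqI[OF square_integrable_mul[OF affine_continuous sq] sq])
      (rule AE_I2, simp add: product_rule[of _ c g d k])
qed

lemma by_parts_affine:
  "inner (c *\<^sub>R one_l2 + volterra g) k + inner (d *\<^sub>R one_l2 + volterra k) g =
    (c + primitive g 1) * (d + primitive k 1) - c * d"
proof -
  have *: "inner (mulc (\<lambda>x. c + primitive g x) k) one_l2 = inner (c *\<^sub>R one_l2 + volterra g) k" for c g k
    unfolding inner_mulc[OF affine_continuous] mulc_one_l2[OF affine_continuous] affine_l2[symmetric]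
    by (rule inner_commute)
  then show ?thesis
    using product_rule[of 1 c g d k] by (simp add: primitive_1 inner_add_left *)
qed

lemma by_parts:
  assumes "f \<in> H1" "q \<in> H1"
  shows "inner f (weak_deriv q) + inner q (weak_deriv f) =
    point_value f 1 * point_value q 1 - point_value f 0 * point_value q 0"
  using by_parts_affine[of "point_value f 0" "weak_deriv f" "weak_deriv q" "point_value q 0"]
  by (simp add: H1_expand[OF assms(1), symmetric] H1_expand[OF assms(2), symmetric]
    point_value_H1[OF assms(1), of 1] point_value_H1[OF assms(2), of 1])

lemma inner_weak_deriv_one: "f \<in> H1 \<Longrightarrow> inner (weak_deriv f) one_l2 = point_value f 1 - point_value f 0"
  by (simp add: point_value_H1[of f 1] primitive_1)

lemma H1_add: "f \<in> H1 \<Longrightarrow> g \<in> H1 \<Longrightarrow> f + g \<in> H1"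
  and weak_deriv_add: "f \<in> H1 \<Longrightarrow> g \<in> H1 \<Longrightarrow> weak_deriv (f + g) = weak_deriv f + weak_deriv g"
  and to_h1_add: "f \<in> H1 \<Longrightarrow> g \<in> H1 \<Longrightarrow> to_h1 (f + g) = to_h1 f + to_h1 g"
  and point_value_add: "f \<in> H1 \<Longrightarrow> g \<in> H1 \<Longrightarrow> x \<in> {0..1} \<Longrightarrow> point_value (f + g) x = point_value f x + point_value g x"
proof -
  assume "f \<in> H1" "g \<in> H1"
  then obtain c k d l where f: "f = c *\<^sub>R one_l2 + volterra k" and g: "g = d *\<^sub>R one_l2 + volterra l"
    by (metis H1_expand)
  have fg: "f + g = (c + d) *\<^sub>R one_l2 + volterra (k + l)"
    by (simp add: f g volterra_add algebra_simps)
  show "f + g \<in> H1" unfolding fg by (rule affine_in_H1)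
  show "weak_deriv (f + g) = weak_deriv f + weak_deriv g"
    unfolding fg unfolding f g weak_deriv_affine ..
  show "to_h1 (f + g) = to_h1 f + to_h1 g"
    unfolding fg unfolding f g to_h1_affine
    using linear_add[OF bounded_linear.linear[OF make_h1_bounded_linear], of "(c, k)" "(d, l)"] by simp
  show "point_value (f + g) x = point_value f x + point_value g x" if "x \<in> {0..1}"
    unfolding fg unfolding f g by (simp add: point_value_affine[OF that] primitive_add)
qed

lemma H1_scale: "f \<in> H1 \<Longrightarrow> r *\<^sub>R f \<in> H1"
  and weak_deriv_scale: "f \<in> H1 \<Longrightarrow> weak_deriv (r *\<^sub>R f) = r *\<^sub>R weak_deriv f"
  and to_h1_scale: "f \<in> H1 \<Longrightarrow> to_h1 (r *\<^sub>R f) = r *\<^sub>R to_h1 f"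
  and point_value_scale: "f \<in> H1 \<Longrightarrow> x \<in> {0..1} \<Longrightarrow> point_value (r *\<^sub>R f) x = r * point_value f x"
proof -
  assume "f \<in> H1"
  then obtain c k where f: "f = c *\<^sub>R one_l2 + volterra k" by (metis H1_expand)
  have rf: "r *\<^sub>R f = (r * c) *\<^sub>R one_l2 + volterra (r *\<^sub>R k)"
    by (simp add: f volterra_scale algebra_simps)
  show "r *\<^sub>R f \<in> H1" unfolding rf by (rule affine_in_H1)
  show "weak_deriv (r *\<^sub>R f) = r *\<^sub>R weak_deriv f"
    unfolding rf unfolding f weak_deriv_affine ..
  show "to_h1 (r *\<^sub>R f) = r *\<^sub>R to_h1 f"
    unfolding rf unfolding f to_h1_affine
    using linear_scale[OF bounded_linear.linear[OF make_h1_bounded_linear], of r "(c, k)"] by simp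
  show "point_value (r *\<^sub>R f) x = r * point_value f x" if "x \<in> {0..1}"
    unfolding rf unfolding f by (simp only: point_value_affine[OF that] primitive_scale distrib_left)
qed

lemma H1_zero: "0 \<in> H1" and point_value_zero: "x \<in> {0..1} \<Longrightarrow> point_value 0 x = 0"
  using affine_in_H1[of 0 0] point_value_affine[of x 0 0]
  by (simp_all add: volterra_zero primitive_def)

text \<open>The only compactness that enters the proof: primitives are Hoelder continuous of order $1/2$, so
replacing them by step functions costs $O(n^{-1/2})$ in the operator norm.\<close>

lemma volterra_finite_rank_approx:
  assumes "e > 0"
  obtains V where "finite_rank V" "bounded_linear V" "\<And>g. norm (volterra g - V g) \<le> e * norm g"
proof -
  obtain n :: nat where n: "n > 0" "1 / n < e\<^sup>2"
    using assms ex_inverse_of_nat_less[of "e\<^sup>2"] by (auto simp: inverse_eq_divide)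
  define V where "V = (\<lambda>g. \<Sum>i<n. primitive g (real i / n) *\<^sub>R (below (real (Suc i) / n) - below (real i / n)))"
  have bl: "bounded_linear (\<lambda>g. primitive g x)" for x
    unfolding primitive_def by (rule bounded_linear_inner_left)
  have "finite_rank V"
    unfolding V_def by (intro finite_rank_sum finite_rank_one bl) simp
  moreover have "bounded_linear V"
    unfolding V_def by (intro bounded_linear_sum bounded_linear_compose[OF bounded_linear_scaleR_left bl])
  moreover have "norm (volterra g - V g) \<le> e * norm g" for g
  proof -
    have "sqrt (1 / n) \<le> e" using n(2) assms by (intro real_le_lsqrt) auto
    then have "norm g * sqrt (1 / n) \<le> norm g * e" by (rule mult_left_mono) simp
    then show ?thesis using volterra_step_error[OF n(1), of g] by (simp add: V_def mult.commute)
  qed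
  ultimately show ?thesis using that by blast
qed

lemma smooth_in_H1:
  assumes "continuous_on {0..1} p'" "\<And>x. x \<in> {0..1} \<Longrightarrow> (p has_real_derivative p' x) (at x within {0..1})"
  shows "abs_l2 p = p 0 *\<^sub>R one_l2 + volterra (abs_l2 p')"
  unfolding affine_l2
proof (rule abs_l2_eqI)
  have "continuous_on {0..1} p" using assms(2) by (rule DERIV_continuous_on)
  then show "square_integrable p" by (rule square_integrable_continuous)
  show "square_integrable (\<lambda>x. p 0 + primitive (abs_l2 p') x)"
    by (rule square_integrable_continuous[OF affine_continuous])
  show "AE x in I01. p x = p 0 + primitive (abs_l2 p') x"
  proof (rule AE_I2)
    fix x assume "x \<in> space I01"
    then have x: "x \<in> {0..1}" by simp
    have "primitive (abs_l2 p') x = p x - p 0"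
      by (rule primitive_of_derivative[OF assms(1) assms(2) x])
    then show "p x = p 0 + primitive (abs_l2 p') x" by simp
  qed
qed

lemma power_tendsto_0_l2: "(\<lambda>n. abs_l2 (\<lambda>x. x ^ Suc n)) \<longlonglongrightarrow> 0"
  "(\<lambda>n. abs_l2 (\<lambda>x. (1 - x) ^ Suc n)) \<longlonglongrightarrow> 0"
proof -
  have *: "(\<lambda>n. abs_l2 (\<lambda>x. b x ^ Suc n)) \<longlonglongrightarrow> abs_l2 (\<lambda>x. 0)"
    if b: "continuous_on {0..1} b" "\<And>x. 0 < x \<Longrightarrow> x < 1 \<Longrightarrow> 0 < b x \<and> b x < 1" for b :: "real \<Rightarrow> real"
  proof (rule l2_dominated_convergence[where w = "\<lambda>x. 1"])
    show "square_integrable (\<lambda>x. b x ^ Suc n)" for n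
      by (intro square_integrable_continuous continuous_on_power b)
    show "AE x in I01. \<bar>b x ^ Suc n - 0\<bar> \<le> 1" for n
    proof (rule AE_I2)
      fix x assume "x \<in> space I01"
      then have "0 < b x" "b x < 1" using b(2)[of x] by auto
      then show "\<bar>b x ^ Suc n - 0\<bar> \<le> 1" by (simp add: power_le_one abs_mult mult_le_one)
    qed
    show "AE x in I01. (\<lambda>n. b x ^ Suc n) \<longlonglongrightarrow> 0"
    proof (rule AE_I2)
      fix x assume "x \<in> space I01"
      then have "0 < b x" "b x < 1" using b(2)[of x] by auto
      then have "(\<lambda>n. b x ^ n) \<longlonglongrightarrow> 0" by (intro LIMSEQ_realpow_zero) auto
      then show "(\<lambda>n. b x ^ Suc n) \<longlonglongrightarrow> 0" by (rule LIMSEQ_Suc)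
    qed
  qed (rule square_integrable_zero square_integrable_const)+
  show "(\<lambda>n. abs_l2 (\<lambda>x. x ^ Suc n)) \<longlonglongrightarrow> 0"
    using *[of "\<lambda>x. x"] by (simp add: zero_l2_def)
  show "(\<lambda>n. abs_l2 (\<lambda>x. (1 - x) ^ Suc n)) \<longlonglongrightarrow> 0"
    using *[of "\<lambda>x. 1 - x"] by (simp add: zero_l2_def continuous_on_diff)
qed

text \<open>Approximate by a polynomial and correct its boundary values with $(1-x)^n$ and $x^n$, whose norms in $L^2$
are small.\<close>

lemma H1_boundary_dense: "closure {f \<in> H1. point_value f 0 = \<xi> \<and> point_value f 1 = \<eta>} = UNIV"
proof -
  let ?S = "{f \<in> H1. point_value f 0 = \<xi> \<and> point_value f 1 = \<eta>}"
  have "z \<in> closure ?S" for z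
  proof (subst closure_approachable, intro allI impI)
    fix e :: real assume e: "e > 0"
    obtain k where k: "continuous_on UNIV k" "dist (abs_l2 k) z < e / 3"
    proof -
      obtain kn where kn: "\<And>n. continuous_on UNIV (kn n)" "(\<lambda>n. abs_l2 (kn n)) \<longlonglongrightarrow> z"
        using continuous_dense_l2[of z] by blast
      then have "\<forall>\<^sub>F n in sequentially. dist (abs_l2 (kn n)) z < e / 3"
        using e by (intro tendstoD) auto
      then obtain n where "dist (abs_l2 (kn n)) z < e / 3" by (auto simp: eventually_sequentially)
      then show ?thesis using that kn(1) by blast
    qed
    have k01: "continuous_on {0..1} k" by (rule continuous_on_subset[OF k(1)]) simp
    obtain p where p: "real_polynomial_function p" "\<And>x. x \<in> {0..1} \<Longrightarrow> \<bar>k x - p x\<bar> < e / 4"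
      using Stone_Weierstrass_real_polynomial_function[OF compact_Icc k01, of "e / 4"] e by auto
    obtain p' where p': "real_polynomial_function p'" "\<And>x. (p has_real_derivative p' x) (at x)"
      using has_real_derivative_polynomial_function[OF p(1)] by blast
    have pc: "continuous_on S p" "continuous_on S p'" for S
      using p(1) p'(1) by (auto simp: continuous_on_polymonial_function real_polynomial_function_eq)
    have pk: "dist (abs_l2 p) (abs_l2 k) < e / 3"
    proof -
      have "norm (abs_l2 k - abs_l2 p) \<le> e / 4"
        unfolding abs_l2_diff[OF square_integrable_continuous[OF k01] square_integrable_continuous[OF pc(1)]]
      proof (rule norm_abs_l2_le)
        show "(\<lambda>x. k x - p x) \<in> borel_measurable I01"
          by (intro measurable_I01_continuous continuous_on_diff k01 pc)
        show "AE x in I01. \<bar>k x - p x\<bar> \<le> e / 4"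
          by (rule AE_I2) (use p(2) in \<open>simp add: less_imp_le\<close>)
      qed (use e in simp)
      then show ?thesis using e by (simp add: dist_norm norm_minus_commute)
    qed
    have "(\<lambda>n. (\<xi> - p 0) *\<^sub>R abs_l2 (\<lambda>x. (1 - x) ^ Suc n) + (\<eta> - p 1) *\<^sub>R abs_l2 (\<lambda>x. x ^ Suc n))
        \<longlonglongrightarrow> (\<xi> - p 0) *\<^sub>R 0 + (\<eta> - p 1) *\<^sub>R 0"
      by (intro tendsto_intros power_tendsto_0_l2)
    then have "(\<lambda>n. (\<xi> - p 0) *\<^sub>R abs_l2 (\<lambda>x. (1 - x) ^ Suc n) + (\<eta> - p 1) *\<^sub>R abs_l2 (\<lambda>x. x ^ Suc n)) \<longlonglongrightarrow> 0"
      by simp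
    then have "\<forall>\<^sub>F n in sequentially. dist ((\<xi> - p 0) *\<^sub>R abs_l2 (\<lambda>x. (1 - x) ^ Suc n) + (\<eta> - p 1) *\<^sub>R abs_l2 (\<lambda>x. x ^ Suc n)) 0 < e / 3"
      using e by (intro tendstoD) auto
    then obtain n where n: "norm ((\<xi> - p 0) *\<^sub>R abs_l2 (\<lambda>x. (1 - x) ^ Suc n) + (\<eta> - p 1) *\<^sub>R abs_l2 (\<lambda>x. x ^ Suc n)) < e / 3"
      by (auto simp: eventually_sequentially)
    define f where "f = (\<lambda>x. p x + ((\<xi> - p 0) * (1 - x) ^ Suc n + (\<eta> - p 1) * x ^ Suc n))"
    define f' where "f' = (\<lambda>x. p' x + ((\<xi> - p 0) * (- (real (Suc n) * (1 - x) ^ n)) + (\<eta> - p 1) * (real (Suc n) * x ^ n)))"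
    have Df: "(f has_real_derivative f' x) (at x within {0..1})" for x
      unfolding f_def f'_def
      by (rule has_field_derivative_at_within) (auto intro!: derivative_eq_intros p'(2) simp del: power_Suc)
    have f'c: "continuous_on {0..1} f'" unfolding f'_def by (intro continuous_intros pc)
    have aff: "abs_l2 f = f 0 *\<^sub>R one_l2 + volterra (abs_l2 f')" by (rule smooth_in_H1[OF f'c Df])
    have "f 0 = \<xi>" "f 1 = \<eta>" by (auto simp: f_def)
    moreover have "primitive (abs_l2 f') 1 = f 1 - f 0" by (rule primitive_of_derivative[OF f'c Df]) simp
    ultimately have "abs_l2 f \<in> ?S"
      unfolding aff by (simp add: affine_in_H1 point_value_affine primitive_0)
    moreover have "dist (abs_l2 f) z < e"
    proof -
      have sq: "square_integrable (\<lambda>x. (1 - x) ^ Suc n)" "square_integrable (\<lambda>x::real. x ^ Suc n)" "square_integrable p"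
        by (intro square_integrable_continuous continuous_intros pc)+
      have "abs_l2 f = abs_l2 p + ((\<xi> - p 0) *\<^sub>R abs_l2 (\<lambda>x. (1 - x) ^ Suc n) + (\<eta> - p 1) *\<^sub>R abs_l2 (\<lambda>x. x ^ Suc n))"
        unfolding f_def abs_l2_scale[OF sq(1)] abs_l2_scale[OF sq(2)]
          abs_l2_add[OF square_integrable_scale[OF sq(1)] square_integrable_scale[OF sq(2)]]
          abs_l2_add[OF sq(3) square_integrable_add[OF square_integrable_scale[OF sq(1)] square_integrable_scale[OF sq(2)]]] ..
      then have "dist (abs_l2 f) (abs_l2 p) < e / 3" using n by (simp add: dist_norm)
      then show ?thesis
        using pk k(2) dist_triangle[of "abs_l2 f" z "abs_l2 p"] dist_triangle[of "abs_l2 p" z "abs_l2 k"] by linarith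
    qed
    ultimately show "\<exists>f\<in>?S. dist f z < e" by blast
  qed
  then show ?thesis by blast
qed

lemma H1_dense_sequence:
  obtains f where "\<And>n. f n \<in> H1" "\<And>n. point_value (f n) 0 = \<xi>" "\<And>n. point_value (f n) 1 = \<eta>" "f \<longlonglongrightarrow> z"
proof -
  have "z \<in> closure {f \<in> H1. point_value f 0 = \<xi> \<and> point_value f 1 = \<eta>}" by (simp add: H1_boundary_dense)
  then obtain f where "\<And>n. f n \<in> {f \<in> H1. point_value f 0 = \<xi> \<and> point_value f 1 = \<eta>}" "f \<longlonglongrightarrow> z"
    unfolding closure_sequential by blast
  then show ?thesis using that by blast
qed

lemma dom_A_dense: "closure dom_A = UNIV"
proof -
  have "\<Phi> \<in> closure dom_A" for \<Phi> :: state
  proof -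
    obtain y z u \<xi> \<eta> where P: "\<Phi> = (y, z, u, \<xi>, \<eta>)" by (metis surj_pair)
    obtain q where q: "\<And>n. q n \<in> H1" "\<And>n. point_value (q n) 0 = 0" "\<And>n. point_value (q n) 1 = 0" "q \<longlonglongrightarrow> h1_deriv y"
      using H1_dense_sequence[of 0 0 "h1_deriv y"] by blast
    obtain zn where zn: "\<And>n. zn n \<in> H1" "\<And>n. point_value (zn n) 0 = \<xi>" "\<And>n. point_value (zn n) 1 = \<eta>" "zn \<longlonglongrightarrow> z"
      using H1_dense_sequence[of \<xi> \<eta> z] by blast
    obtain un where un: "\<And>n. un n \<in> H1" "\<And>n. point_value (un n) 0 = \<xi>" "\<And>n. point_value (un n) 1 = 0" "un \<longlonglongrightarrow> u"
      using H1_dense_sequence[of \<xi> 0 u] by blast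
    have "(\<lambda>n. make_h1 (h1_value y 0, q n)) \<longlonglongrightarrow> make_h1 (h1_value y 0, h1_deriv y)"
      by (intro bounded_linear.tendsto[OF make_h1_bounded_linear] tendsto_Pair tendsto_const q)
    moreover have "make_h1 (h1_value y 0, h1_deriv y) = y"
      by (rule h1_eqI2) (simp_all add: point_value_affine primitive_0)
    ultimately have "(\<lambda>n. (make_h1 (h1_value y 0, q n), zn n, un n, \<xi>, \<eta>)) \<longlonglongrightarrow> \<Phi>"
      unfolding P by (intro tendsto_Pair tendsto_const zn un) simp
    moreover have "(make_h1 (h1_value y 0, q n), zn n, un n, \<xi>, \<eta>) \<in> dom_A" for n
      by (simp add: dom_A_def q zn un)
    ultimately show ?thesis
      unfolding closure_sequential by (intro exI[of _ "\<lambda>n. (make_h1 (h1_value y 0, q n), zn n, un n, \<xi>, \<eta>)"]) blast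
  qed
  then show ?thesis by blast
qed

lemma dom_A_subspace: "subspace dom_A"
  unfolding subspace_def
proof (intro conjI ballI allI)
  have "h1_deriv 0 = 0" using linear_0[OF bounded_linear.linear[OF h1_deriv_bounded_linear]] .
  then show "0 \<in> dom_A" by (simp add: dom_A_def zero_prod_def H1_zero point_value_zero)
  show "\<Phi> + \<Psi> \<in> dom_A" if "\<Phi> \<in> dom_A" "\<Psi> \<in> dom_A" for \<Phi> \<Psi>
    using that by (auto simp: dom_A_def h1_deriv_add H1_add point_value_add)
  show "r *\<^sub>R \<Phi> \<in> dom_A" if "\<Phi> \<in> dom_A" for r \<Phi>
    using that by (auto simp: dom_A_def h1_deriv_scale H1_scale point_value_scale)
qed

section \<open>The string with delayed boundary damping\<close>

text \<open>The functional \<open>\<Lambda>\<close> is conserved: it vanishes on the range of $A$ (\<open>ell_A\<close>).  The kernel of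
$A$ is spanned by the rigid displacement, on which \<open>\<Lambda>\<close> does not vanish.\<close>

locale damped_string =
  fixes a :: h1 and a0 m M \<tau> \<beta> K \<alpha> \<omega> :: real
  assumes m: "m > 0" and M: "M > 0" and tau: "\<tau> > 0" and K: "K > 0"
    and a0: "a0 > 0" and a_lower: "\<And>x. x \<in> {0..1} \<Longrightarrow> h1_value a x \<ge> a0"
    and alpha_beta: "\<bar>\<alpha>\<bar> < \<beta>" and alpha_K: "\<bar>\<alpha>\<bar> \<le> K" and K_beta: "K \<le> 2 * \<beta> - \<bar>\<alpha>\<bar>"
begin

abbreviation A :: "state \<Rightarrow> state" where "A \<equiv> op_A a m M \<tau> \<alpha> \<beta>"
abbreviation \<Lambda> :: "state \<Rightarrow> real" where "\<Lambda> \<equiv> ell m M \<tau> \<alpha> \<beta>"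
abbreviation ip :: "state \<Rightarrow> state \<Rightarrow> real" where "ip \<equiv> inner_X a m M \<tau> \<alpha> \<beta> K \<omega>"

definition \<mu> :: real where "\<mu> = \<beta> - \<alpha>"

lemma mu: "\<mu> > 0" using alpha_beta by (simp add: \<mu>_def)

definition coef :: "real \<Rightarrow> real" where "coef x = h1_value a x"
definition recip :: "real \<Rightarrow> real" where "recip x = 1 / coef x"

lemma coef_affine: "x \<in> {0..1} \<Longrightarrow> coef x = h1_value a 0 + primitive (h1_deriv a) x"
  unfolding coef_def by (rule h1_value_expand)

lemma coef_continuous: "continuous_on {0..1} coef"
  using affine_continuous by (rule continuous_on_eq) (simp add: coef_affine)

lemma coef_pos: "x \<in> {0..1} \<Longrightarrow> coef x \<ge> a0"
  unfolding coef_def by (rule a_lower)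

lemma recip_continuous: "continuous_on {0..1} recip"
  unfolding recip_def by (intro continuous_intros coef_continuous) (use coef_pos a0 in force)

lemma flux_eq: "flux a y = mulc coef (h1_deriv y)"
  by (simp add: flux_def mulc_def coef_def)

lemma mulc_coef_H1:
  assumes "f \<in> H1"
  shows "mulc coef f \<in> H1"
proof -
  obtain c k where f: "f = c *\<^sub>R one_l2 + volterra k" using H1_expand[OF assms] by blast
  have "mulc coef f = mulc (\<lambda>x. h1_value a 0 + primitive (h1_deriv a) x) f"
    by (rule mulc_cong[OF coef_affine coef_continuous])
  then show ?thesis unfolding f mulc_affine by (simp add: affine_in_H1)
qed

lemma mulc_recip_H1:
  assumes "f \<in> H1"
  shows "mulc recip f \<in> H1"
proof -
  obtain c k where f: "f = c *\<^sub>R one_l2 + volterra k" using H1_expand[OF assms] by blast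
  define r where "r = (\<lambda>x. 1 / (h1_value a 0 + primitive (h1_deriv a) x))"
  have "recip x = 1 / h1_value a 0 + primitive (- mulc r (mulc r (h1_deriv a))) x" if "x \<in> {0..1}" for x
    unfolding recip_def coef_affine[OF that] r_def
    by (rule reciprocal_rule[OF that a0]) (use coef_pos in \<open>simp add: coef_affine\<close>)
  then have "mulc recip f = mulc (\<lambda>x. 1 / h1_value a 0 + primitive (- mulc r (mulc r (h1_deriv a))) x) f"
    by (rule mulc_cong[OF _ recip_continuous])
  then show ?thesis unfolding f mulc_affine by (simp add: affine_in_H1)
qed

lemma mulc_coef_recip: "mulc coef (mulc recip f) = f" and mulc_recip_coef: "mulc recip (mulc coef f) = f"
proof -
  have 1: "coef x * recip x = 1" if "x \<in> {0..1}" for x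
    using coef_pos[OF that] a0 by (simp add: recip_def)
  have "mulc (\<lambda>x. coef x * recip x) f = mulc (\<lambda>x. 1) f"
    by (rule mulc_cong[OF 1]) (auto intro!: continuous_intros coef_continuous recip_continuous)
  then show "mulc coef (mulc recip f) = f" "mulc recip (mulc coef f) = f"
    using mulc_mulc[OF coef_continuous recip_continuous, of f] mulc_mulc[OF recip_continuous coef_continuous, of f]
    by (simp_all add: mulc_1 mult.commute)
qed

lemma LINT_rep_l2: "(LINT x|I01. rep_l2 f x) = inner f one_l2"
  using inner_abs_l2[OF square_integrable_rep[of f] square_integrable_const[of 1]]
  by (simp add: one_l2_def abs_rep_l2)

lemma ell_eq: "\<Lambda> (y, z, u, \<xi>, \<eta>) = inner z one_l2 + m * \<xi> + M * \<eta> + \<mu> * h1_value y 0 + \<tau> * \<alpha> * inner u one_l2"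
  by (simp add: ell_def LINT_rep_l2 \<mu>_def)

lemma ell_add: "\<Lambda> (\<Phi> + \<Psi>) = \<Lambda> \<Phi> + \<Lambda> \<Psi>"
  by (cases \<Phi>, cases \<Psi>) (simp add: ell_eq inner_add_left h1_value_add_0 algebra_simps)

lemma ell_scale: "\<Lambda> (r *\<^sub>R \<Phi>) = r * \<Lambda> \<Phi>"
  by (cases \<Phi>) (simp add: ell_eq h1_value_scale_0 algebra_simps)

lemma inner_X_eq:
  "ip (y, z, u, \<xi>, \<eta>) (y', z', u', \<xi>', \<eta>') =
    inner (flux a y) (h1_deriv y') + inner z z' + K * \<tau> * inner u u' + m * \<xi> * \<xi>' + M * \<eta> * \<eta>'
    + \<omega> * \<Lambda> (y, z, u, \<xi>, \<eta>) * \<Lambda> (y', z', u', \<xi>', \<eta>')"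
proof -
  let ?f = "\<lambda>x. coef x * rep_l2 (h1_deriv y) x"
  have sq: "square_integrable ?f" by (rule square_integrable_mul[OF coef_continuous square_integrable_rep])
  have "(LINT x|I01. ?f x * rep_l2 (h1_deriv y') x + rep_l2 z x * rep_l2 z' x)
    = (LINT x|I01. ?f x * rep_l2 (h1_deriv y') x) + (LINT x|I01. rep_l2 z x * rep_l2 z' x)"
    by (intro Bochner_Integration.integral_add square_integrable_mult sq square_integrable_rep)
  moreover have "(LINT x|I01. ?f x * rep_l2 (h1_deriv y') x) = inner (flux a y) (h1_deriv y')"
    using inner_abs_l2[OF sq square_integrable_rep[of "h1_deriv y'"]] by (simp add: flux_def coef_def abs_rep_l2)
  ultimately show ?thesis by (simp add: inner_X_def coef_def inner_l2_rep)
qed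

lemma flux_add: "flux a (y + w) = flux a y + flux a w"
  and flux_scale: "flux a (r *\<^sub>R y) = r *\<^sub>R flux a y"
  by (simp_all add: flux_eq h1_deriv_add h1_deriv_scale mulc_add[OF coef_continuous] mulc_scale[OF coef_continuous])

lemma ip_sym: "ip \<Phi> \<Psi> = ip \<Psi> \<Phi>"
proof -
  obtain y z u \<xi> \<eta> y' z' u' \<xi>' \<eta>' where P: "\<Phi> = (y, z, u, \<xi>, \<eta>)" "\<Psi> = (y', z', u', \<xi>', \<eta>')" by (metis surj_pair)
  have "inner (flux a y) (h1_deriv y') = inner (flux a y') (h1_deriv y)"
    unfolding flux_eq by (rule trans[OF inner_mulc[OF coef_continuous] inner_commute])
  then show ?thesis unfolding P inner_X_eq by (simp add: inner_commute mult_ac)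
qed

lemma ip_add: "ip (\<Phi> + \<Phi>') \<Psi> = ip \<Phi> \<Psi> + ip \<Phi>' \<Psi>"
proof -
  obtain y z u \<xi> \<eta> where P: "\<Phi> = (y, z, u, \<xi>, \<eta>)" by (metis surj_pair)
  obtain y' z' u' \<xi>' \<eta>' where P': "\<Phi>' = (y', z', u', \<xi>', \<eta>')" by (metis surj_pair)
  obtain y2 z2 u2 \<xi>2 \<eta>2 where Q: "\<Psi> = (y2, z2, u2, \<xi>2, \<eta>2)" by (metis surj_pair)
  show ?thesis
    using ell_add[of \<Phi> \<Phi>'] unfolding P P' Q add_Pair inner_X_eq
    by (simp add: flux_add inner_add_left algebra_simps)
qed

lemma ip_scale: "ip (r *\<^sub>R \<Phi>) \<Psi> = r * ip \<Phi> \<Psi>"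
proof -
  obtain y z u \<xi> \<eta> where P: "\<Phi> = (y, z, u, \<xi>, \<eta>)" by (metis surj_pair)
  obtain y2 z2 u2 \<xi>2 \<eta>2 where Q: "\<Psi> = (y2, z2, u2, \<xi>2, \<eta>2)" by (metis surj_pair)
  show ?thesis
    using ell_scale[of r \<Phi>] unfolding P Q scaleR_Pair inner_X_eq
    by (simp add: flux_scale algebra_simps)
qed

lemma dom_A_cases:
  assumes "\<Phi> \<in> dom_A"
  obtains y z u where "\<Phi> = (y, z, u, point_value z 0, point_value z 1)" "h1_deriv y \<in> H1" "z \<in> H1" "u \<in> H1"
    "point_value u 0 = point_value z 0" "flux a y \<in> H1"
  using assms that by (auto simp: dom_A_def flux_eq mulc_coef_H1)

lemma op_A_eq: "A (y, z, u, \<xi>, \<eta>) = (to_h1 z, weak_deriv (flux a y), - (1 / \<tau>) *\<^sub>R weak_deriv u,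
     (1 / m) * (point_value (flux a y) 0 - \<beta> * \<xi> + \<alpha> * point_value u 1), - point_value (flux a y) 1 / M)"
  by (simp add: op_A_def)

lemma A_add:
  assumes "\<Phi> \<in> dom_A" "\<Psi> \<in> dom_A"
  shows "A (\<Phi> + \<Psi>) = A \<Phi> + A \<Psi>"
proof -
  obtain y z u where P: "\<Phi> = (y, z, u, point_value z 0, point_value z 1)" "z \<in> H1" "u \<in> H1" "flux a y \<in> H1"
    using dom_A_cases[OF assms(1)] by metis
  obtain y' z' u' where Q: "\<Psi> = (y', z', u', point_value z' 0, point_value z' 1)" "z' \<in> H1" "u' \<in> H1" "flux a y' \<in> H1"
    using dom_A_cases[OF assms(2)] by metis
  show ?thesis
    using P(2-) Q(2-) unfolding P(1) Q(1) add_Pair op_A_eq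
    by (simp add: to_h1_add flux_add weak_deriv_add point_value_add scaleR_add_right algebra_simps add_divide_distrib diff_divide_distrib)
qed

lemma A_scale:
  assumes "\<Phi> \<in> dom_A"
  shows "A (r *\<^sub>R \<Phi>) = r *\<^sub>R A \<Phi>"
proof -
  obtain y z u where P: "\<Phi> = (y, z, u, point_value z 0, point_value z 1)" "z \<in> H1" "u \<in> H1" "flux a y \<in> H1"
    using dom_A_cases[OF assms(1)] by metis
  show ?thesis
    using P(2-) unfolding P(1) scaleR_Pair op_A_eq
    by (simp add: to_h1_scale flux_scale weak_deriv_scale point_value_scale algebra_simps add_divide_distrib diff_divide_distrib)
qed

lemma ell_A:
  assumes "\<Phi> \<in> dom_A"
  shows "\<Lambda> (A \<Phi>) = 0"
proof -
  obtain y z u where P: "\<Phi> = (y, z, u, point_value z 0, point_value z 1)" "z \<in> H1" "u \<in> H1" "flux a y \<in> H1"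
    "point_value u 0 = point_value z 0"
    using dom_A_cases[OF assms(1)] by metis
  show ?thesis
    unfolding P(1) op_A_eq ell_eq
    using m M tau P(5)
    by (simp add: h1_fun_to_h1[OF P(2)] inner_weak_deriv_one[OF P(3)] inner_weak_deriv_one[OF P(4)] \<mu>_def algebra_simps)
qed

text \<open>Since \<open>\<Lambda>\<close> vanishes on $A\Phi$, the last term of the inner product drops out.  Integration by parts leaves
the quadratic form $-\frac K2u(1)^2+(\frac K2-\beta)\xi^2+\alpha\,u(1)\,\xi$, which the conditions on $K$ make
nonpositive.\<close>

lemma A_dissipative:
  assumes "\<Phi> \<in> dom_A"
  shows "ip (A \<Phi>) \<Phi> \<le> 0"
proof -
  obtain y z u where P: "\<Phi> = (y, z, u, point_value z 0, point_value z 1)" "z \<in> H1" "u \<in> H1" "flux a y \<in> H1"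
    "point_value u 0 = point_value z 0"
    using dom_A_cases[OF assms(1)] by metis
  define q where "q = flux a y"
  define u1 \<xi> \<eta> where "u1 = point_value u 1" and "\<xi> = point_value z 0" and "\<eta> = point_value z 1"
  have z: "inner (flux a (to_h1 z)) (h1_deriv y) = inner q (weak_deriv z)"
    unfolding q_def flux_eq h1_deriv_to_h1[OF P(2)] by (rule trans[OF inner_mulc[OF coef_continuous] inner_commute])
  have zq: "inner q (weak_deriv z) + inner (weak_deriv q) z = \<eta> * point_value q 1 - \<xi> * point_value q 0"
    using by_parts[OF P(2) P(4)] by (simp add: q_def \<xi>_def \<eta>_def inner_commute)
  have uu: "inner (weak_deriv u) u = (u1\<^sup>2 - \<xi>\<^sup>2) / 2"
    using by_parts[OF P(3) P(3)] P(5) by (simp add: u1_def \<xi>_def inner_commute power2_eq_square)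
  have "ip (A \<Phi>) \<Phi> = inner q (weak_deriv z) + inner (weak_deriv q) z
      + K * \<tau> * inner (- (1 / \<tau>) *\<^sub>R weak_deriv u) u
      + m * ((1 / m) * (point_value q 0 - \<beta> * \<xi> + \<alpha> * u1)) * \<xi> + M * (- point_value q 1 / M) * \<eta>"
    using ell_A[OF assms] unfolding P(1) op_A_eq inner_X_eq z
    by (simp add: q_def u1_def \<xi>_def \<eta>_def)
  also have "\<dots> = \<eta> * point_value q 1 - \<xi> * point_value q 0 - K * ((u1\<^sup>2 - \<xi>\<^sup>2) / 2)
      + (point_value q 0 - \<beta> * \<xi> + \<alpha> * u1) * \<xi> - point_value q 1 * \<eta>"
    unfolding zq using m M tau uu by simp
  also have "\<dots> = - K / 2 * u1\<^sup>2 + (K / 2 - \<beta>) * \<xi>\<^sup>2 + \<alpha> * u1 * \<xi>"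
    by (simp add: power2_eq_square field_simps)
  also have "\<dots> \<le> - K / 2 * u1\<^sup>2 + (K / 2 - \<beta>) * \<xi>\<^sup>2 + \<bar>\<alpha>\<bar> * ((u1\<^sup>2 + \<xi>\<^sup>2) / 2)"
  proof -
    have "0 \<le> (\<bar>u1\<bar> - \<bar>\<xi>\<bar>)\<^sup>2" by simp
    then have "\<bar>u1\<bar> * \<bar>\<xi>\<bar> \<le> (u1\<^sup>2 + \<xi>\<^sup>2) / 2" by (simp add: power2_diff)
    then have "\<bar>\<alpha>\<bar> * (\<bar>u1\<bar> * \<bar>\<xi>\<bar>) \<le> \<bar>\<alpha>\<bar> * ((u1\<^sup>2 + \<xi>\<^sup>2) / 2)" by (rule mult_left_mono) simp
    moreover have "\<alpha> * u1 * \<xi> \<le> \<bar>\<alpha>\<bar> * (\<bar>u1\<bar> * \<bar>\<xi>\<bar>)" by (metis abs_ge_self abs_mult mult.assoc)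
    ultimately show ?thesis by simp
  qed
  also have "\<dots> = - ((K - \<bar>\<alpha>\<bar>) / 2 * u1\<^sup>2) - (2 * \<beta> - \<bar>\<alpha>\<bar> - K) / 2 * \<xi>\<^sup>2"
    by (simp add: field_simps)
  also have "\<dots> \<le> 0"
  proof -
    have "0 \<le> (K - \<bar>\<alpha>\<bar>) / 2 * u1\<^sup>2" using alpha_K by simp
    moreover have "0 \<le> (2 * \<beta> - \<bar>\<alpha>\<bar> - K) / 2 * \<xi>\<^sup>2" using K_beta by simp
    ultimately show ?thesis by linarith
  qed
  finally show ?thesis .
qed

text \<open>Since $0$ is an eigenvalue, $A$ itself has no inverse.  The operator $\Phi\mapsto A\Phi-y(0)e$ with the
rigid displacement $e=(1,0,0,0,0)$ has an explicit one: applying \<open>\<Lambda>\<close> to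
$A\Phi-y(0)e=F$ gives $y(0)=-\Lambda(F)/\mu$, which is \<open>shift F\<close>, and the remaining equations
$z=f+y(0)$, $u'=-\tau h$, $(ay')'=g$, $(ay')(1)=-Mq$ are integrated one after the other.\<close>

definition shift :: "state \<Rightarrow> real" where "shift F = - \<Lambda> F / \<mu>"

definition rigid :: state where "rigid = (make_h1 (1, 0), 0, 0, 0, 0)"

definition R :: "state \<Rightarrow> state" where
  "R = (\<lambda>(f, g, h, p, q).
    (make_h1 (shift (f, g, h, p, q), mulc recip (volterra g - (M * q + inner g one_l2) *\<^sub>R one_l2)),
     h1_fun f + shift (f, g, h, p, q) *\<^sub>R one_l2,
     (h1_value f 0 + shift (f, g, h, p, q)) *\<^sub>R one_l2 - \<tau> *\<^sub>R volterra h,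
     h1_value f 0 + shift (f, g, h, p, q),
     h1_value f 1 + shift (f, g, h, p, q)))"

lemma point_value_one: "x \<in> {0..1} \<Longrightarrow> point_value one_l2 x = 1"
  using point_value_affine[of x 1 0] by (simp add: volterra_zero primitive_def)

lemma ell_rigid: "\<Lambda> rigid = \<mu>"
  by (simp add: rigid_def ell_eq volterra_zero point_value_one)

lemma R_in_dom_A: "R F \<in> dom_A"
proof -
  obtain f g h p q where F: "F = (f, g, h, p, q)" by (metis surj_pair)
  let ?c = "shift F"
  have "volterra g - b *\<^sub>R one_l2 \<in> H1" for b
    using affine_in_H1[of "- b" g] by simp
  then have 1: "mulc recip (volterra g - (M * q + inner g one_l2) *\<^sub>R one_l2) \<in> H1"
    by (rule mulc_recip_H1)
  have 2: "h1_fun f + ?c *\<^sub>R one_l2 = (h1_value f 0 + ?c) *\<^sub>R one_l2 + volterra (h1_deriv f)"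
    by (subst h1_fun_expand) (simp add: algebra_simps)
  have 3: "(h1_value f 0 + ?c) *\<^sub>R one_l2 - \<tau> *\<^sub>R volterra h = (h1_value f 0 + ?c) *\<^sub>R one_l2 + volterra (- \<tau> *\<^sub>R h)"
    by (simp only: volterra_scale) simp
  have 4: "h1_value f 1 = h1_value f 0 + primitive (h1_deriv f) 1" by (rule h1_value_expand) simp
  show ?thesis
    unfolding F R_def dom_A_def
    using 1 by (simp add: 2[unfolded F] 3[unfolded F] 4 affine_in_H1 point_value_affine primitive_0)
qed

lemma A_R: "A (R F) = F + shift F *\<^sub>R rigid"
proof -
  obtain f g h p q where F: "F = (f, g, h, p, q)" by (metis surj_pair)
  define c where "c = shift F"
  (* -b is the flux at 0, prescribed by the flux -Mq at 1 and its derivative g *)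
  define b where "b = M * q + inner g one_l2"
  let ?y = "make_h1 (c, mulc recip (volterra g - b *\<^sub>R one_l2))"
  have fl: "flux a (make_h1 (c, mulc recip (volterra g - b *\<^sub>R one_l2))) = (- b) *\<^sub>R one_l2 + volterra g"
    by (simp add: flux_eq mulc_coef_recip)
  have fl': "weak_deriv (flux a ?y) = g" "point_value (flux a ?y) 0 = - b"
      "point_value (flux a ?y) 1 = - b + inner g one_l2"
    unfolding fl by (rule weak_deriv_affine, (subst point_value_affine; simp add: primitive_0 primitive_1)+)
  have 2: "h1_fun f + c *\<^sub>R one_l2 = (h1_value f 0 + c) *\<^sub>R one_l2 + volterra (h1_deriv f)"
    by (subst h1_fun_expand) (simp add: algebra_simps)
  have 3: "(h1_value f 0 + c) *\<^sub>R one_l2 - \<tau> *\<^sub>R volterra h = (h1_value f 0 + c) *\<^sub>R one_l2 + volterra (- \<tau> *\<^sub>R h)"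
    by (simp only: volterra_scale) simp
  have y: "to_h1 ((h1_value f 0 + c) *\<^sub>R one_l2 + volterra (h1_deriv f)) = f + c *\<^sub>R make_h1 (1, 0)"
    unfolding to_h1_affine
    by (rule h1_eqI2)
      (simp_all add: point_value_affine primitive_0 h1_value_add_0 h1_value_scale_0 h1_deriv_add h1_deriv_scale
        volterra_zero point_value_one)
  have ell: "inner g one_l2 + m * p + M * q + \<mu> * h1_value f 0 + \<tau> * \<alpha> * inner h one_l2 = - \<mu> * c"
    using mu by (simp add: c_def shift_def F ell_eq)
  have b4: "- b - \<beta> * (h1_value f 0 + c) + \<alpha> * (h1_value f 0 + c - \<tau> * inner h one_l2) = m * p"
    using ell by (simp add: b_def \<mu>_def algebra_simps)
  have "R F = (make_h1 (c, mulc recip (volterra g - b *\<^sub>R one_l2)), (h1_value f 0 + c) *\<^sub>R one_l2 + volterra (h1_deriv f),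
      (h1_value f 0 + c) *\<^sub>R one_l2 + volterra (- \<tau> *\<^sub>R h), h1_value f 0 + c, h1_value f 1 + c)"
    by (simp only: F R_def prod.case c_def[unfolded F, symmetric] b_def[symmetric] 2 3)
  then have "A (R F) = (f + c *\<^sub>R make_h1 (1, 0), g, h,
      (1 / m) * (- b - \<beta> * (h1_value f 0 + c) + \<alpha> * (h1_value f 0 + c - \<tau> * inner h one_l2)), - (- b + inner g one_l2) / M)"
  proof -
    have u1: "point_value ((h1_value f 0 + c) *\<^sub>R one_l2 + volterra (- \<tau> *\<^sub>R h)) 1
        = h1_value f 0 + c + primitive (- \<tau> *\<^sub>R h) 1" by (rule point_value_affine) simp
    assume "R F = (?y, (h1_value f 0 + c) *\<^sub>R one_l2 + volterra (h1_deriv f),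
      (h1_value f 0 + c) *\<^sub>R one_l2 + volterra (- \<tau> *\<^sub>R h), h1_value f 0 + c, h1_value f 1 + c)"
    then show ?thesis
      using tau by (simp only: op_A_eq fl' y weak_deriv_affine u1 primitive_scale primitive_1) simp
  qed
  then show ?thesis
    unfolding b4 using m M by (simp add: F rigid_def b_def c_def[symmetric, unfolded F])
qed

text \<open>The preimage is $F=A\Phi-y(0)e$; that \<open>R\<close> recovers $\Phi$ from it uses $y(0)=-\Lambda(F)/\mu$.\<close>

lemma R_A:
  assumes "\<Phi> \<in> dom_A"
  shows "\<exists>F. R F = \<Phi>"
proof -
  obtain y z u where P: "\<Phi> = (y, z, u, point_value z 0, point_value z 1)" "z \<in> H1" "u \<in> H1" "flux a y \<in> H1"
    "point_value u 0 = point_value z 0"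
    using dom_A_cases[OF assms(1)] by metis
  define F where "F = A \<Phi> + (- h1_value y 0) *\<^sub>R rigid"
  have c: "shift F = h1_value y 0"
  proof -
    have "\<Lambda> F = - h1_value y 0 * \<mu>" unfolding F_def ell_add ell_scale ell_A[OF assms] ell_rigid by simp
    then show ?thesis using mu by (simp add: shift_def)
  qed
  define f where "f = to_h1 z + (- h1_value y 0) *\<^sub>R make_h1 (1, 0)"
  have F: "F = (f, weak_deriv (flux a y), - (1 / \<tau>) *\<^sub>R weak_deriv u,
     (1 / m) * (point_value (flux a y) 0 - \<beta> * point_value z 0 + \<alpha> * point_value u 1), - point_value (flux a y) 1 / M)"
    by (simp add: F_def P(1) op_A_eq rigid_def f_def)
  have f0: "h1_value f 0 = point_value z 0 - h1_value y 0"
    by (simp add: f_def h1_value_add_0 h1_value_scale_0 h1_fun_to_h1[OF P(2)] volterra_zero point_value_one del: scaleR_minus_left)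
  have ff: "h1_fun f = z - h1_value y 0 *\<^sub>R one_l2"
    unfolding f_def h1_fun_add h1_fun_scale h1_fun_to_h1[OF P(2)] h1_fun_make by (simp add: volterra_zero)
  have f1: "h1_value f 1 = point_value z 1 - h1_value y 0"
  proof -
    define d where "d = - h1_value y 0"
    have one: "d *\<^sub>R one_l2 \<in> H1" using affine_in_H1[of d 0] by (simp add: volterra_zero)
    have "h1_value f 1 = point_value (z + d *\<^sub>R one_l2) 1" by (simp add: ff d_def)
    also have "\<dots> = point_value z 1 + point_value (d *\<^sub>R one_l2) 1"
      by (rule point_value_add[OF P(2) one]) simp
    also have "point_value (d *\<^sub>R one_l2) 1 = d"
      using point_value_affine[of 1 d 0] by (simp add: volterra_zero primitive_def)
    finally show ?thesis by (simp add: d_def)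
  qed
  have q: "volterra (weak_deriv (flux a y)) - (M * (- point_value (flux a y) 1 / M) + inner (weak_deriv (flux a y)) one_l2) *\<^sub>R one_l2 = flux a y"
    using M by (subst (4) H1_expand[OF P(4)]) (simp add: inner_weak_deriv_one[OF P(4)])
  have u: "point_value z 0 *\<^sub>R one_l2 - \<tau> *\<^sub>R volterra (- (1 / \<tau>) *\<^sub>R weak_deriv u) = u"
    using tau by (subst (2) H1_expand[OF P(3)]) (simp add: volterra_scale P(5) del: scaleR_minus_left)
  have y: "make_h1 (h1_value y 0, mulc recip (flux a y)) = y"
    by (rule h1_eqI2) (simp_all add: point_value_affine primitive_0 flux_eq mulc_recip_coef)
  have "R F = \<Phi>"
    using u by (simp only: F R_def prod.case c[unfolded F] q y f0 f1) (simp add: P(1) ff)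
  then show ?thesis ..
qed

lemma dom_A_eq: "dom_A = range R"
  using R_in_dom_A R_A by blast

lemma component_bounded_linear:
  "bounded_linear (\<lambda>F::state. fst F)" "bounded_linear (\<lambda>F::state. fst (snd F))"
  "bounded_linear (\<lambda>F::state. fst (snd (snd F)))" "bounded_linear (\<lambda>F::state. fst (snd (snd (snd F))))"
  "bounded_linear (\<lambda>F::state. snd (snd (snd (snd F))))"
  by (intro bounded_linear_fst bounded_linear_snd bounded_linear_compose[OF bounded_linear_fst]
      bounded_linear_compose[OF bounded_linear_snd])+

lemma value_bounded_linear:
  "x \<in> {0..1} \<Longrightarrow> bounded_linear (\<lambda>F::state. h1_value (fst F) x)"
  by (rule bounded_linear_compose[OF h1_value_bounded_linear component_bounded_linear(1)])

lemma mean_bounded_linear: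
  "bounded_linear (\<lambda>F::state. inner (fst (snd F)) one_l2)" "bounded_linear (\<lambda>F::state. inner (fst (snd (snd F))) one_l2)"
  by (rule bounded_linear_compose[OF bounded_linear_inner_left component_bounded_linear(2)],
      rule bounded_linear_compose[OF bounded_linear_inner_left component_bounded_linear(3)])

lemma ell_bounded_linear: "bounded_linear \<Lambda>"
proof -
  have "bounded_linear (\<lambda>F::state. inner (fst (snd F)) one_l2 + m * fst (snd (snd (snd F))) + M * snd (snd (snd (snd F)))
      + \<mu> * h1_value (fst F) 0 + \<tau> * \<alpha> * inner (fst (snd (snd F))) one_l2)"
    by (intro bounded_linear_add bounded_linear_const_mult component_bounded_linear value_bounded_linear mean_bounded_linear) simp
  moreover have "\<Lambda> = (\<lambda>F. inner (fst (snd F)) one_l2 + m * fst (snd (snd (snd F))) + M * snd (snd (snd (snd F)))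
      + \<mu> * h1_value (fst F) 0 + \<tau> * \<alpha> * inner (fst (snd (snd F))) one_l2)"
  proof
    fix F :: state
    obtain f g h p q where F: "F = (f, g, h, p, q)" by (metis surj_pair)
    show "\<Lambda> F = inner (fst (snd F)) one_l2 + m * fst (snd (snd (snd F))) + M * snd (snd (snd (snd F)))
      + \<mu> * h1_value (fst F) 0 + \<tau> * \<alpha> * inner (fst (snd (snd F))) one_l2"
      unfolding F ell_eq by simp
  qed
  ultimately show ?thesis by simp
qed

lemma shift_bounded_linear: "bounded_linear shift"
proof -
  have "bounded_linear (\<lambda>F. (- 1 / \<mu>) * \<Lambda> F)" by (rule bounded_linear_const_mult[OF ell_bounded_linear])
  moreover have "shift = (\<lambda>F. (- 1 / \<mu>) * \<Lambda> F)" by (auto simp: shift_def)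
  ultimately show ?thesis by simp
qed

text \<open>The formula for \<open>R\<close> with a parameter in the place of the Volterra operator, so that
  \<open>R\<close> and its finite rank approximation are instances of one definition.\<close>

definition R_with :: "(l2 \<Rightarrow> l2) \<Rightarrow> state \<Rightarrow> state" where
  "R_with V F =
    (make_h1 (shift F, mulc recip (V (fst (snd F)) - (M * snd (snd (snd (snd F))) + inner (fst (snd F)) one_l2) *\<^sub>R one_l2)),
     (h1_value (fst F) 0 + shift F) *\<^sub>R one_l2 + V (h1_deriv (fst F)),
     (h1_value (fst F) 0 + shift F) *\<^sub>R one_l2 - \<tau> *\<^sub>R V (fst (snd (snd F))),
     h1_value (fst F) 0 + shift F,
     h1_value (fst F) 1 + shift F)"

lemma R_eq_R_with: "R = R_with volterra"
proof
  fix F :: state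
  obtain f g h p q where F: "F = (f, g, h, p, q)" by (metis surj_pair)
  have "h1_fun f + shift F *\<^sub>R one_l2 = (h1_value f 0 + shift F) *\<^sub>R one_l2 + volterra (h1_deriv f)"
    by (subst h1_fun_expand) (simp add: algebra_simps)
  then show "R F = R_with volterra F" by (simp add: F R_def R_with_def)
qed

lemma R_with_bounded_linear:
  assumes V: "bounded_linear V"
  shows "bounded_linear (R_with V)"
proof -
  note s = bounded_linear_add[OF value_bounded_linear shift_bounded_linear]
  have r: "bounded_linear (\<lambda>F::state. V (fst (snd F)) - (M * snd (snd (snd (snd F))) + inner (fst (snd F)) one_l2) *\<^sub>R one_l2)"
    by (intro bounded_linear_sub bounded_linear_compose[OF V component_bounded_linear(2)]
      bounded_linear_compose[OF bounded_linear_scaleR_left] bounded_linear_add bounded_linear_const_mult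
      component_bounded_linear mean_bounded_linear)
  have V1: "bounded_linear (\<lambda>F::state. V (h1_deriv (fst F)))"
    by (rule bounded_linear_compose[OF V bounded_linear_compose[OF h1_deriv_bounded_linear component_bounded_linear(1)]])
  have V3: "bounded_linear (\<lambda>F::state. \<tau> *\<^sub>R V (fst (snd (snd F))))"
    by (rule bounded_linear_compose[OF bounded_linear_scaleR_right bounded_linear_compose[OF V component_bounded_linear(3)]])
  have c: "bounded_linear (\<lambda>F::state. (h1_value (fst F) 0 + shift F) *\<^sub>R one_l2)"
    by (rule bounded_linear_compose[OF bounded_linear_scaleR_left s]) simp
  show ?thesis
    unfolding R_with_def
    by (intro bounded_linear_Pair bounded_linear_compose[OF make_h1_bounded_linear] shift_bounded_linear
      bounded_linear_compose[OF mulc_bounded_linear[OF recip_continuous] r]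
      bounded_linear_add[OF c V1] bounded_linear_sub[OF c V3] s) simp_all
qed

lemma R_bounded_linear: "bounded_linear R"
  unfolding R_eq_R_with by (rule R_with_bounded_linear[OF volterra_bounded_linear])

lemma inj_R: "inj R"
proof -
  interpret R: bounded_linear R by (rule R_bounded_linear)
  have "F = 0" if "R F = 0" for F :: state
  proof -
    obtain f g h p q where F: "F = (f, g, h, p, q)" by (metis surj_pair)
    have "make_h1 (shift F, mulc recip (volterra g - (M * q + inner g one_l2) *\<^sub>R one_l2)) = 0"
      using that by (simp add: F R_def zero_prod_def)
    then have "h1_value (make_h1 (shift F, mulc recip (volterra g - (M * q + inner g one_l2) *\<^sub>R one_l2))) 0 = h1_value 0 0"
      by simp
    then have "shift F = 0"
      using h1_value_scale_0[of 0 0] by (simp add: point_value_affine primitive_0)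
    then have "A 0 = F" using A_R[of F] that by simp
    moreover have "A 0 = 0" using A_scale[of 0 0] subspace_0[OF dom_A_subspace] by simp
    ultimately show ?thesis by simp
  qed
  then show ?thesis using R.linear linear_injective_0 by blast
qed

text \<open>\<open>R\<close> is a finite rank operator plus three occurrences of the Volterra operator, and this one is approximated by
operators of finite rank.\<close>

lemma R_approx:
  assumes e: "e > 0"
  shows "\<exists>E. bounded_linear E \<and> (\<forall>F. norm (E F) \<le> e * norm F) \<and> finite_rank (\<lambda>F. R F - E F)"
proof -
  obtain B where B: "B \<ge> 0" "\<And>x. x \<in> {0..1} \<Longrightarrow> \<bar>recip x\<bar> \<le> B"
    using continuous_bounded_01[OF recip_continuous] by blast
  (* the contributions of the components y, z and u *)
  define C where "C = 2 * B + 1 + \<tau>"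
  have C: "C > 0" using B(1) tau by (simp add: C_def)
  obtain V where V: "finite_rank V" "bounded_linear V" and close: "\<And>g. norm (volterra g - V g) \<le> e / C * norm g"
    using volterra_finite_rank_approx[of "e / C"] e C by auto
  define E where "E = (\<lambda>F. R F - R_with V F)"
  interpret mk: bounded_linear make_h1 by (rule make_h1_bounded_linear)
  interpret mr: bounded_linear "mulc recip" by (rule mulc_bounded_linear[OF recip_continuous])
  have E_eq: "E (f, g, h, p, q) = (make_h1 (0, mulc recip (volterra g - V g)), volterra (h1_deriv f) - V (h1_deriv f),
      - \<tau> *\<^sub>R (volterra h - V h), 0, 0)" for f :: h1 and g h :: l2 and p q :: real
  proof -
    have "make_h1 (s, mulc recip (v - w)) - make_h1 (s, mulc recip (v' - w)) = make_h1 (0, mulc recip (v - v'))" for s v v' w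
      by (simp add: mk.diff[symmetric] mr.diff[symmetric])
    then show ?thesis by (simp add: E_def R_eq_R_with R_with_def zero_prod_def scaleR_diff_right)
  qed
  have "bounded_linear E"
    unfolding E_def by (rule bounded_linear_sub[OF R_bounded_linear R_with_bounded_linear[OF V(2)]])
  moreover have "norm (E F) \<le> e * norm F" for F :: state
  proof -
    obtain f g h p q where F: "F = (f, g, h, p, q)" by (metis surj_pair)
    have fgh: "norm f \<le> norm F" "norm g \<le> norm F" "norm h \<le> norm F"
      using norm_fst_le[of f "(g, h, p, q)"] norm_snd_le[of "(g, h, p, q)" f] norm_fst_le[of g "(h, p, q)"]
        norm_snd_le[of "(h, p, q)" g] norm_fst_le[of h "(p, q)"] unfolding F by linarith+
    have d: "norm (volterra k - V k) \<le> e / C * norm F" if "norm k \<le> norm F" for k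
      using close[of k] mult_left_mono[OF that, of "e / C"] e C by simp
    have "norm (make_h1 (0, k)) \<le> 2 * norm k" for k
    proof -
      have "norm (make_h1 (0, k)) \<le> norm (volterra k) + norm k"
        unfolding norm_h1_eq by (simp add: norm_Pair_le del: norm_Pair)
      then show ?thesis using norm_volterra[of k] by simp
    qed
    then have "norm (make_h1 (0, mulc recip (volterra g - V g))) \<le> 2 * norm (mulc recip (volterra g - V g))" .
    also have "\<dots> \<le> 2 * (B * norm (volterra g - V g))"
      using norm_mulc[OF recip_continuous B(2,1)] by simp
    also have "\<dots> \<le> 2 * (B * (e / C * norm F))"
      using d[OF fgh(2)] B(1) by (intro mult_left_mono) auto
    finally have n1: "norm (make_h1 (0, mulc recip (volterra g - V g))) \<le> 2 * (B * (e / C * norm F))" .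
    have n2: "norm (volterra (h1_deriv f) - V (h1_deriv f)) \<le> e / C * norm F"
      by (rule d) (use norm_h1_deriv[of f] fgh(1) in linarith)
    have n3: "norm (- \<tau> *\<^sub>R (volterra h - V h)) \<le> \<tau> * (e / C * norm F)"
      using mult_left_mono[OF d[OF fgh(3)], of \<tau>] tau by simp
    have "norm (E F) \<le> norm (make_h1 (0, mulc recip (volterra g - V g)))
        + (norm (volterra (h1_deriv f) - V (h1_deriv f)) + norm (- \<tau> *\<^sub>R (volterra h - V h)))"
      unfolding F E_eq
      using norm_Pair_le[of "make_h1 (0, mulc recip (volterra g - V g))" "(volterra (h1_deriv f) - V (h1_deriv f), - \<tau> *\<^sub>R (volterra h - V h), 0::real, 0::real)"]
        norm_Pair_le[of "volterra (h1_deriv f) - V (h1_deriv f)" "(- \<tau> *\<^sub>R (volterra h - V h), 0::real, 0::real)"]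
        norm_Pair_le[of "- \<tau> *\<^sub>R (volterra h - V h)" "(0::real, 0::real)"]
      by (simp add: norm_Pair)
    also have "\<dots> \<le> 2 * (B * (e / C * norm F)) + (e / C * norm F + \<tau> * (e / C * norm F))"
      by (intro add_mono n1 n2 n3)
    also have "\<dots> = C * (e / C * norm F)"
    proof -
      have "2 * (B * k) + (k + \<tau> * k) = C * k" for k by (simp add: C_def algebra_simps)
      then show ?thesis .
    qed
    also have "\<dots> = e * norm F" using C by simp
    finally show ?thesis .
  qed
  moreover have "finite_rank (\<lambda>F. R F - E F)"
  proof -
    define i1 where "i1 = (\<lambda>y. (y, 0, 0, 0, 0) :: state)"
    define i2 where "i2 = (\<lambda>z. (0, z, 0, 0, 0) :: state)"
    define i3 where "i3 = (\<lambda>u. (0, 0, u, 0, 0) :: state)"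
    have i: "bounded_linear i1" "bounded_linear i2" "bounded_linear i3"
      unfolding i1_def i2_def i3_def
      by (intro bounded_linear_Pair bounded_linear_ident bounded_linear_zero)+
    define w where "w = i1 (make_h1 (0, mulc recip one_l2))"
    have s: "bounded_linear (\<lambda>F. h1_value (fst F) x + shift F)" if "x \<in> {0..1}" for x
      by (rule bounded_linear_add[OF value_bounded_linear[OF that] shift_bounded_linear])
    have b: "bounded_linear (\<lambda>F::state. - (M * snd (snd (snd (snd F))) + inner (fst (snd F)) one_l2))"
      by (intro bounded_linear_minus bounded_linear_add bounded_linear_const_mult component_bounded_linear mean_bounded_linear)
    have m1: "bounded_linear (\<lambda>k. i1 (make_h1 (0, mulc recip k)))"
      by (intro bounded_linear_compose[OF i(1)] bounded_linear_compose[OF make_h1_bounded_linear]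
        bounded_linear_Pair bounded_linear_zero mulc_bounded_linear recip_continuous)
    have m3: "bounded_linear (\<lambda>k. i3 (- \<tau> *\<^sub>R k))"
      by (intro bounded_linear_compose[OF i(3)] bounded_linear_scaleR_right)
    have V1: "finite_rank (\<lambda>F::state. i1 (make_h1 (0, mulc recip (V (fst (snd F))))))"
      by (rule finite_rank_compose_left[OF finite_rank_compose_right[OF V(1) component_bounded_linear(2)] m1])
    have V2: "finite_rank (\<lambda>F::state. i2 (V (h1_deriv (fst F))))"
      by (rule finite_rank_compose_left[OF finite_rank_compose_right[OF V(1)
        bounded_linear_compose[OF h1_deriv_bounded_linear component_bounded_linear(1)]] i(2)])
    have V3: "finite_rank (\<lambda>F::state. i3 (- \<tau> *\<^sub>R V (fst (snd (snd F)))))"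
      by (rule finite_rank_compose_left[OF finite_rank_compose_right[OF V(1) component_bounded_linear(3)] m3])
    let ?d0 = "(0, one_l2, one_l2, 1, 0) :: state" and ?d1 = "(0, 0, 0, 0, 1) :: state"
    have "finite_rank (\<lambda>F. i1 (make_h1 (0, mulc recip (V (fst (snd F))))) + (i2 (V (h1_deriv (fst F))) +
      (i3 (- \<tau> *\<^sub>R V (fst (snd (snd F)))) + (shift F *\<^sub>R rigid +
      ((- (M * snd (snd (snd (snd F))) + inner (fst (snd F)) one_l2)) *\<^sub>R w +
      ((h1_value (fst F) 0 + shift F) *\<^sub>R ?d0 + (h1_value (fst F) 1 + shift F) *\<^sub>R ?d1))))))"
      by (intro finite_rank_add V1 V2 V3 finite_rank_one shift_bounded_linear b s) simp_all
    moreover have "R F - E F = i1 (make_h1 (0, mulc recip (V (fst (snd F))))) + (i2 (V (h1_deriv (fst F))) +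
      (i3 (- \<tau> *\<^sub>R V (fst (snd (snd F)))) + (shift F *\<^sub>R rigid +
      ((- (M * snd (snd (snd (snd F))) + inner (fst (snd F)) one_l2)) *\<^sub>R w +
      ((h1_value (fst F) 0 + shift F) *\<^sub>R ?d0 + (h1_value (fst F) 1 + shift F) *\<^sub>R ?d1)))))" for F
    proof -
      have mk: "make_h1 (s, mulc recip (v - r *\<^sub>R one_l2)) =
        make_h1 (0, mulc recip v) + (s *\<^sub>R make_h1 (1, 0) + (- r) *\<^sub>R make_h1 (0, mulc recip one_l2))" for s r v
        unfolding mk.scaleR[symmetric] mk.add[symmetric] mr.diff mr.scaleR by simp
      define r where "r = M * snd (snd (snd (snd F))) + inner (fst (snd F)) one_l2"
      show ?thesis
        unfolding E_def R_with_def r_def[symmetric]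
        by (simp add: mk i1_def i2_def i3_def w_def rigid_def)
    qed
    ultimately show ?thesis by simp
  qed
  ultimately show ?thesis by blast
qed

lemma R_rank_one: "finite_rank (\<lambda>F. shift F *\<^sub>R rigid)"
  by (rule finite_rank_one[OF shift_bounded_linear])

end

text \<open>With the equivalence of the norms dissipativity excludes positive eigenvalues.  As the spectrum
consists of eigenvalues, every $1-hA$ with $h>0$ is onto, and the generation theorem applies.\<close>

locale equivalent_damped_string = damped_string +
  fixes c C :: real
  assumes c: "c > 0" and N_lower: "\<And>\<Phi>. c * norm \<Phi> \<le> norm_X a m M \<tau> \<alpha> \<beta> K \<omega> \<Phi>"
    and N_upper: "\<And>\<Phi>. norm_X a m M \<tau> \<alpha> \<beta> K \<omega> \<Phi> \<le> C * norm \<Phi>"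
begin

lemma positive_not_eigenvalue:
  assumes h: "h > 0"
  shows "\<not> eigenvalue dom_A A (of_real h)"
proof
  assume "eigenvalue dom_A A (of_real h)"
  then obtain v1 v2 where v: "v1 \<in> dom_A" "v2 \<in> dom_A" "(v1, v2) \<noteq> 0" "A v1 = h *\<^sub>R v1" "A v2 = h *\<^sub>R v2"
    unfolding eigenvalue_def complexify_def by (auto simp: scaleC_of_real)
  have "w = 0" if w: "w \<in> dom_A" "A w = h *\<^sub>R w" for w
  proof -
    have "h * ip w w \<le> 0" using A_dissipative[OF w(1)] by (simp add: w(2) ip_scale)
    then have "ip w w \<le> 0" using h by (simp add: mult_le_0_iff)
    then have "norm_X a m M \<tau> \<alpha> \<beta> K \<omega> w \<le> 0" by (simp add: norm_X_def)
    then have "c * norm w \<le> 0" using N_lower[of w] by linarith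
    then show ?thesis using c by (simp add: mult_le_0_iff)
  qed
  then have "v1 = 0" "v2 = 0" using v by blast+
  then show False using v(3) by (simp add: zero_prod_def)
qed

sublocale spectral: finite_rank_approximable_resolvent dom_A A R "\<lambda>F. shift F *\<^sub>R rigid" 1
proof (rule finite_rank_approximable_resolvent.intro[OF R_bounded_linear inj_R dom_A_eq A_R R_rank_one R_approx])
  show "\<not> eigenvalue dom_A A 1" using positive_not_eigenvalue[of 1] by simp
qed

lemma resolvent_equation_solvable:
  assumes h: "h > 0"
  shows "\<exists>\<Phi>\<in>dom_A. \<Phi> - h *\<^sub>R A \<Phi> = F"
proof -
  have "of_real (1 / h) \<in> resolvent_set dom_A A"
    by (rule spectral.not_eigenvalue_resolvent_set[OF positive_not_eigenvalue]) (use h in simp)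
  then have "bij_betw (\<lambda>v. scaleC (of_real (1 / h)) v - complexify A v) (dom_A \<times> dom_A) UNIV"
    unfolding resolvent_set_def by blast
  then have "((1 / h) *\<^sub>R F, 0) \<in> (\<lambda>v. scaleC (of_real (1 / h)) v - complexify A v) ` (dom_A \<times> dom_A)"
    by (simp add: bij_betw_def)
  then obtain v where v: "v \<in> dom_A \<times> dom_A" "((1 / h) *\<^sub>R F, 0) = scaleC (of_real (1 / h)) v - complexify A v"
    by (rule imageE)
  then have v1: "fst v \<in> dom_A" "(1 / h) *\<^sub>R F = (1 / h) *\<^sub>R fst v - A (fst v)"
    unfolding scaleC_of_real complexify_def by (auto simp: prod_eq_iff)
  have "F = h *\<^sub>R ((1 / h) *\<^sub>R F)" using h by simp
  also have "\<dots> = fst v - h *\<^sub>R A (fst v)" unfolding v1(2) using h by (simp add: scaleR_diff_right)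
  finally show ?thesis using v1(1) by metis
qed

sublocale generator: maximal_dissipative dom_A A ip "norm_X a m M \<tau> \<alpha> \<beta> K \<omega>" c C
  by unfold_locales
    (use dom_A_subspace A_add A_scale ip_add ip_scale ip_sym c N_lower N_upper A_dissipative
      resolvent_equation_solvable dom_A_dense in \<open>auto simp: norm_X_def\<close>)

end

theorem theorem1:
  fixes a :: h1 and a0 m M \<tau> \<beta> K \<alpha> \<omega> :: real
  assumes "m > 0" "M > 0" "\<tau> > 0" "\<beta> > 0" "K > 0"
    and "\<omega> > 0" and "norm_X_equivalent a m M \<tau> \<alpha> \<beta> K \<omega>"
    and "a0 > 0" and "\<forall>x\<in>{0..1}. h1_value a x \<ge> a0"
    and "\<bar>\<alpha>\<bar> < \<beta>" and "\<bar>\<alpha>\<bar> \<le> K" and "K \<le> 2 * \<beta> - \<bar>\<alpha>\<bar>"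
  defines "A \<equiv> op_A a m M \<tau> \<alpha> \<beta>" and "NX \<equiv> norm_X a m M \<tau> \<alpha> \<beta> K \<omega>"
  shows
    "(closure dom_A = UNIV \<and>
     (\<exists>T. C0_semigroup T \<and> generates dom_A A T \<and> (\<forall>t\<ge>0. \<forall>\<Phi>. NX (T t \<Phi>) \<le> NX \<Phi>)) \<and>
     (\<forall>z\<in>spectrum dom_A A.
        z isolated_in spectrum dom_A A \<and> eigenvalue dom_A A z \<and>
        finite_algebraic_multiplicity dom_A A z))
     \<and>
     (\<forall>\<Phi>0. \<exists>\<Phi>. mild_solution dom_A A \<Phi>0 \<Phi> \<and>
        (\<forall>\<Psi>. mild_solution dom_A A \<Phi>0 \<Psi> \<longrightarrow> (\<forall>t\<ge>0. \<Psi> t = \<Phi> t)) \<and>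
        (\<Phi>0 \<in> dom_A \<longrightarrow>
           strong_solution dom_A A \<Phi>0 \<Phi> \<and> continuous_into_domain dom_A A \<Phi> \<and>
           continuously_differentiable \<Phi>))"
proof -
  obtain c C where cC: "c > 0" "\<And>\<Phi>. c * norm \<Phi> \<le> norm_X a m M \<tau> \<alpha> \<beta> K \<omega> \<Phi>"
    "\<And>\<Phi>. norm_X a m M \<tau> \<alpha> \<beta> K \<omega> \<Phi> \<le> C * norm \<Phi>"
    using assms(7) unfolding norm_X_equivalent_def by blast
  interpret string: equivalent_damped_string a a0 m M \<tau> \<beta> K \<alpha> \<omega> c C
    by unfold_locales (use assms(1-12) cC in auto)
  show ?thesis
    unfolding A_def NX_def
  proof (intro conjI ballI allI)
    show "closure dom_A = UNIV" by (rule dom_A_dense)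
    show "\<exists>T. C0_semigroup T \<and> generates dom_A (op_A a m M \<tau> \<alpha> \<beta>) T \<and>
        (\<forall>t\<ge>0. \<forall>\<Phi>. norm_X a m M \<tau> \<alpha> \<beta> K \<omega> (T t \<Phi>) \<le> norm_X a m M \<tau> \<alpha> \<beta> K \<omega> \<Phi>)"
      using string.generator.C0_semigroup_T string.generator.generates_T string.generator.T_contraction by blast
    fix z assume "z \<in> spectrum dom_A (op_A a m M \<tau> \<alpha> \<beta>)"
    then show "z isolated_in spectrum dom_A (op_A a m M \<tau> \<alpha> \<beta>)" "eigenvalue dom_A (op_A a m M \<tau> \<alpha> \<beta>) z"
      "finite_algebraic_multiplicity dom_A (op_A a m M \<tau> \<alpha> \<beta>) z"
      by (rule string.spectral.spectrum_isolated, rule string.spectral.spectrum_eigenvalue,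
          rule string.spectral.spectrum_finite_multiplicity)
  next
    fix \<Phi>0 :: state
    let ?\<Phi> = "\<lambda>t. string.generator.T t \<Phi>0"
    show "\<exists>\<Phi>. mild_solution dom_A (op_A a m M \<tau> \<alpha> \<beta>) \<Phi>0 \<Phi> \<and>
        (\<forall>\<Psi>. mild_solution dom_A (op_A a m M \<tau> \<alpha> \<beta>) \<Phi>0 \<Psi> \<longrightarrow> (\<forall>t\<ge>0. \<Psi> t = \<Phi> t)) \<and>
        (\<Phi>0 \<in> dom_A \<longrightarrow>
           strong_solution dom_A (op_A a m M \<tau> \<alpha> \<beta>) \<Phi>0 \<Phi> \<and> continuous_into_domain dom_A (op_A a m M \<tau> \<alpha> \<beta>) \<Phi> \<and>
           continuously_differentiable \<Phi>)"
      by (rule exI[of _ ?\<Phi>])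
        (use string.generator.mild_solution_T string.generator.mild_solution_unique[OF _ string.generator.mild_solution_T]
          string.generator.strong_solution_T in blast)
  qed
qed

end
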